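(* Let $(Q,W)$ be a quiver with potential, let $G$ be an admissible group of automorphisms of $(Q,W)$, and let $(Q_G,W_G)$ be the orbit quiver with its induced potential. Let $\pi:\widehat{kQ}\to\widehat{kQ_G}$ be the continuous $k$-linear functor with $\pi(a)=Ga$ for every vertex or arrow $a$ of $Q$ (it is a $G$-covering of $k$-categories). Then $\pi$ induces a $G$-covering $$\pi: J(Q,W)\to J(Q_G,W_G)$$ of the Jacobian algebras, regarded as $k$-categories.
   Context: Throughout, $k$ is an algebraically closed field, $G$ is a finite group whose order is not divisible by $\mathrm{char}\,k$, and $Q=(Q_0,Q_1)$ is a finite quiver; paths are composed from right to left. Quivers with potential. Two oriented cycles of $Q$ are equivalent if one is a cyclic rotation of the other; $[p]$ is the class of $p$ and $\mathrm{cyc}(Q)$ is the set of classes. A potential $W$ is a (possibly infinite) $k$-linear combination of distinct elements of $\mathrm{cyc}(Q)$. For an arrow $\alpha$ and a cycle $p=\alpha_r\cdots\alpha_1$, $\partial_\alpha[p]=\sum_{i}\delta_{\alpha_i,\alpha}\,\alpha_{i-1}\cdots\alpha_1\alpha_r\cdots\alpha_{i+1}$. The Jacobian algebra is $J(Q,W)=\widehat{kQ}/\widehat I$, where $\widehat{kQ}$ is the completed path algebra and $\widehat I$ is the closure of the ideal $I$ generated by all $\partial_\alpha(W)$, $\alpha\in Q_1$. Group actions. An automorphism of $(Q,W)$ is a quiver automorphism $\varphi$ of $Q$ such that whenever $\lambda[p]$ is a summand of $W$ ($\lambda\in k$), so is $\lambda\varphi[p]$. A group $G$ of automorphisms of $(Q,W)$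 is admissible if it acts freely on $Q_0$. The orbit quiver $Q_G$ has the $G$-orbits of vertices as vertices and the $G$-orbits of arrows as arrows. For admissible $G$, classes of cycles in $Q_G$ are the $G$-orbits $G[p]$ of classes of cycles in $Q$; writing $W=\sum_{G[p]}\lambda_{G[p]}\sum_{[q]\in G[p]}[q]$, the potential on $Q_G$ is $W_G=\sum_{G[p]}\lambda_{G[p]}\,|G[p]|\,G[p]$. Algebras as categories and coverings. An algebra $A$ with a complete set $e_1,\dots,e_n$ of primitive orthogonal idempotents is viewed as a $k$-category with objects the $e_i$ and morphisms $e_i\to e_j$ the elements of $e_jAe_i$. If $\mathcal A,\mathcal B$ are skeletal $k$-categories and $G$ acts on $\mathcal A$ by automorphisms, a $k$-linear functor $F:\mathcal A\to\mathcal B$ is a $G$-precovering if $F$ induces, by summing images, functorial isomorphisms $\bigoplus_{g\in G}\mathcal A(a,gb)\cong\mathcal B(Fa,Fb)$ and $\bigoplus_{g\in G}\mathcal A(ga,b)\cong\mathcal B(Fa,Fb)$ for all objects $a,b$; it is a $G$-covering if moreover it is surjective on objects. *)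

theory Defs
  imports
    "HOL-Algebra.Algebra"
    "HOL-Algebra.Algebraic_Closure_Type"
    "HOL-Computational_Algebra.Computational_Algebra"
    "HOL-Analysis.Abstract_Topology"
    "Graph_Theory.Arc_Walk"
begin

section \<open>Categories over a field and coverings\<close>

text \<open>
  Morphism sets are modules over the field; the ring multiplication and unit that the record
  type for modules carries along are irrelevant for them. \<open>cmp C g f\<close> is g after f.
  Morphism sets between different objects need not be disjoint, so everything defined on
  morphisms is indexed by source and target where this matters.
\<close>

record ('o, 'k, 'm) kcat =
  Obj :: "'o set"
  Hom :: "'o \<Rightarrow> 'o \<Rightarrow> ('k, 'm) module"
  cmp :: "'m \<Rightarrow> 'm \<Rightarrow> 'm"
  idn :: "'o \<Rightarrow> 'm"

abbreviation Mor :: "('o, 'k, 'm) kcat \<Rightarrow> 'o \<Rightarrow> 'o \<Rightarrow> 'm set" where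
  "Mor C a b \<equiv> carrier (Hom C a b)"

locale k_category =
  fixes R :: "'k ring" and C :: "('o, 'k, 'm) kcat"
  assumes field: "field R"
    and module_Hom: "\<lbrakk>a \<in> Obj C; b \<in> Obj C\<rbrakk> \<Longrightarrow> module R (Hom C a b)"
    and idn_closed: "a \<in> Obj C \<Longrightarrow> idn C a \<in> Mor C a a"
    and cmp_closed: "\<lbrakk>a \<in> Obj C; b \<in> Obj C; c \<in> Obj C; f \<in> Mor C a b; g \<in> Mor C b c\<rbrakk>
      \<Longrightarrow> cmp C g f \<in> Mor C a c"
    and idn_left: "\<lbrakk>a \<in> Obj C; b \<in> Obj C; f \<in> Mor C a b\<rbrakk> \<Longrightarrow> cmp C (idn C b) f = f"
    and idn_right: "\<lbrakk>a \<in> Obj C; b \<in> Obj C; f \<in> Mor C a b\<rbrakk> \<Longrightarrow> cmp C f (idn C a) = f"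
    and cmp_assoc: "\<lbrakk>a \<in> Obj C; b \<in> Obj C; c \<in> Obj C; d \<in> Obj C;
        f \<in> Mor C a b; g \<in> Mor C b c; h \<in> Mor C c d\<rbrakk>
      \<Longrightarrow> cmp C (cmp C h g) f = cmp C h (cmp C g f)"
    and cmp_add_left: "\<lbrakk>a \<in> Obj C; b \<in> Obj C; c \<in> Obj C;
        f \<in> Mor C a b; g \<in> Mor C b c; g' \<in> Mor C b c\<rbrakk>
      \<Longrightarrow> cmp C (g \<oplus>\<^bsub>Hom C b c\<^esub> g') f = cmp C g f \<oplus>\<^bsub>Hom C a c\<^esub> cmp C g' f"
    and cmp_add_right: "\<lbrakk>a \<in> Obj C; b \<in> Obj C; c \<in> Obj C;
        f \<in> Mor C a b; f' \<in> Mor C a b; g \<in> Mor C b c\<rbrakk>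
      \<Longrightarrow> cmp C g (f \<oplus>\<^bsub>Hom C a b\<^esub> f') = cmp C g f \<oplus>\<^bsub>Hom C a c\<^esub> cmp C g f'"
    and cmp_smult_left: "\<lbrakk>a \<in> Obj C; b \<in> Obj C; c \<in> Obj C; r \<in> carrier R;
        f \<in> Mor C a b; g \<in> Mor C b c\<rbrakk>
      \<Longrightarrow> cmp C (r \<odot>\<^bsub>Hom C b c\<^esub> g) f = r \<odot>\<^bsub>Hom C a c\<^esub> cmp C g f"
    and cmp_smult_right: "\<lbrakk>a \<in> Obj C; b \<in> Obj C; c \<in> Obj C; r \<in> carrier R;
        f \<in> Mor C a b; g \<in> Mor C b c\<rbrakk>
      \<Longrightarrow> cmp C g (r \<odot>\<^bsub>Hom C a b\<^esub> f) = r \<odot>\<^bsub>Hom C a c\<^esub> cmp C g f"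

text \<open>
  Coverings are considered between skeletal categories. Skeletality is stated separately from the
  covering conditions below, which do not involve it: if a potential has terms of length 1, then
  the ideal contains trivial paths, and the Jacobian category can have several zero objects.
\<close>

definition skeletal :: "('o, 'k, 'm) kcat \<Rightarrow> bool" where
  "skeletal C \<longleftrightarrow> (\<forall>a\<in>Obj C. \<forall>b\<in>Obj C.
     (\<exists>f\<in>Mor C a b. \<exists>g\<in>Mor C b a. cmp C g f = idn C a \<and> cmp C f g = idn C b) \<longrightarrow> a = b)"

record ('o, 'm, 'p, 'n) kfunctor =
  fobj :: "'o \<Rightarrow> 'p"
  fmor :: "'o \<Rightarrow> 'o \<Rightarrow> 'm \<Rightarrow> 'n"

locale linear_functor = A: k_category R A + B: k_category R B
  for R :: "'k ring" and A :: "('o, 'k, 'm) kcat" and B :: "('p, 'k, 'n) kcat" +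
  fixes F :: "('o, 'm, 'p, 'n) kfunctor"
  assumes fobj_closed: "a \<in> Obj A \<Longrightarrow> fobj F a \<in> Obj B"
    and fmor_closed: "\<lbrakk>a \<in> Obj A; b \<in> Obj A; f \<in> Mor A a b\<rbrakk>
      \<Longrightarrow> fmor F a b f \<in> Mor B (fobj F a) (fobj F b)"
    and fmor_idn: "a \<in> Obj A \<Longrightarrow> fmor F a a (idn A a) = idn B (fobj F a)"
    and fmor_cmp: "\<lbrakk>a \<in> Obj A; b \<in> Obj A; c \<in> Obj A; f \<in> Mor A a b; g \<in> Mor A b c\<rbrakk>
      \<Longrightarrow> fmor F a c (cmp A g f) = cmp B (fmor F b c g) (fmor F a b f)"
    and fmor_add: "\<lbrakk>a \<in> Obj A; b \<in> Obj A; f \<in> Mor A a b; f' \<in> Mor A a b\<rbrakk>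
      \<Longrightarrow> fmor F a b (f \<oplus>\<^bsub>Hom A a b\<^esub> f')
          = fmor F a b f \<oplus>\<^bsub>Hom B (fobj F a) (fobj F b)\<^esub> fmor F a b f'"
    and fmor_smult: "\<lbrakk>a \<in> Obj A; b \<in> Obj A; r \<in> carrier R; f \<in> Mor A a b\<rbrakk>
      \<Longrightarrow> fmor F a b (r \<odot>\<^bsub>Hom A a b\<^esub> f) = r \<odot>\<^bsub>Hom B (fobj F a) (fobj F b)\<^esub> fmor F a b f"

locale category_action = G: group G
  for R :: "'k ring" and A :: "('o, 'k, 'm) kcat" and G :: "('g, 'x) monoid_scheme" (structure) +
  fixes act :: "'g \<Rightarrow> ('o, 'm, 'o, 'm) kfunctor"
  assumes act_functor: "g \<in> carrier G \<Longrightarrow> linear_functor R A A (act g)"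
    and act_one_obj: "a \<in> Obj A \<Longrightarrow> fobj (act \<one>) a = a"
    and act_one_mor: "\<lbrakk>a \<in> Obj A; b \<in> Obj A; f \<in> Mor A a b\<rbrakk> \<Longrightarrow> fmor (act \<one>) a b f = f"
    and act_mult_obj: "\<lbrakk>g \<in> carrier G; h \<in> carrier G; a \<in> Obj A\<rbrakk>
      \<Longrightarrow> fobj (act (g \<otimes> h)) a = fobj (act g) (fobj (act h) a)"
    and act_mult_mor: "\<lbrakk>g \<in> carrier G; h \<in> carrier G; a \<in> Obj A; b \<in> Obj A; f \<in> Mor A a b\<rbrakk>
      \<Longrightarrow> fmor (act (g \<otimes> h)) a b f
          = fmor (act g) (fobj (act h) a) (fobj (act h) b) (fmor (act h) a b f)"

text \<open>
  The two direct sums attached to objects a and b, and the maps out of them that sum the images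
  under F. The sums are restricted to the finite support, because \<open>finsum\<close> over an infinite index
  set is a dummy value.
\<close>

definition covering_sum1 ::
  "('g, 'x) monoid_scheme \<Rightarrow> ('g \<Rightarrow> ('o, 'm, 'o, 'm) kfunctor) \<Rightarrow> ('o, 'k, 'm) kcat \<Rightarrow> 'o \<Rightarrow> 'o
    \<Rightarrow> ('g \<Rightarrow> 'm) monoid" where
  "covering_sum1 G act A a b =
     sum_group (carrier G) (\<lambda>g. add_monoid (Hom A a (fobj (act g) b)))"

definition covering_sum2 ::
  "('g, 'x) monoid_scheme \<Rightarrow> ('g \<Rightarrow> ('o, 'm, 'o, 'm) kfunctor) \<Rightarrow> ('o, 'k, 'm) kcat \<Rightarrow> 'o \<Rightarrow> 'o
    \<Rightarrow> ('g \<Rightarrow> 'm) monoid" where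
  "covering_sum2 G act A a b =
     sum_group (carrier G) (\<lambda>g. add_monoid (Hom A (fobj (act g) a) b))"

definition covering_map1 ::
  "('g, 'x) monoid_scheme \<Rightarrow> ('g \<Rightarrow> ('o, 'm, 'o, 'm) kfunctor) \<Rightarrow> ('o, 'k, 'm) kcat
    \<Rightarrow> ('p, 'k, 'n) kcat \<Rightarrow> ('o, 'm, 'p, 'n) kfunctor \<Rightarrow> 'o \<Rightarrow> 'o \<Rightarrow> ('g \<Rightarrow> 'm) \<Rightarrow> 'n" where
  "covering_map1 G act A B F a b x =
     (\<Oplus>\<^bsub>Hom B (fobj F a) (fobj F b)\<^esub>
        g \<in> {g \<in> carrier G. x g \<noteq> \<zero>\<^bsub>Hom A a (fobj (act g) b)\<^esub>}. fmor F a (fobj (act g) b) (x g))"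

definition covering_map2 ::
  "('g, 'x) monoid_scheme \<Rightarrow> ('g \<Rightarrow> ('o, 'm, 'o, 'm) kfunctor) \<Rightarrow> ('o, 'k, 'm) kcat
    \<Rightarrow> ('p, 'k, 'n) kcat \<Rightarrow> ('o, 'm, 'p, 'n) kfunctor \<Rightarrow> 'o \<Rightarrow> 'o \<Rightarrow> ('g \<Rightarrow> 'm) \<Rightarrow> 'n" where
  "covering_map2 G act A B F a b x =
     (\<Oplus>\<^bsub>Hom B (fobj F a) (fobj F b)\<^esub>
        g \<in> {g \<in> carrier G. x g \<noteq> \<zero>\<^bsub>Hom A (fobj (act g) a) b\<^esub>}. fmor F (fobj (act g) a) b (x g))"

text \<open>
  \<open>fobj_act\<close> is what makes the images summable in a single morphism space of B. The isomorphisms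
  are automatically compatible with scalars, as F is linear. The naturality conditions express
  functoriality in a and b simultaneously, a morphism h from b to b' acting on the summand
  A(a,gb) through gh, and dually.
\<close>

locale G_precovering = F: linear_functor R A B F + category_action R A G act
  for R :: "'k ring" and A :: "('o, 'k, 'm) kcat" and B :: "('p, 'k, 'n) kcat"
    and G :: "('g, 'x) monoid_scheme" and act :: "'g \<Rightarrow> ('o, 'm, 'o, 'm) kfunctor"
    and F :: "('o, 'm, 'p, 'n) kfunctor" +
  assumes fobj_act: "\<lbrakk>g \<in> carrier G; a \<in> Obj A\<rbrakk> \<Longrightarrow> fobj F (fobj (act g) a) = fobj F a"
    and iso1: "\<lbrakk>a \<in> Obj A; b \<in> Obj A\<rbrakk> \<Longrightarrow>
      covering_map1 G act A B F a b
        \<in> iso (covering_sum1 G act A a b) (add_monoid (Hom B (fobj F a) (fobj F b)))"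
    and iso2: "\<lbrakk>a \<in> Obj A; b \<in> Obj A\<rbrakk> \<Longrightarrow>
      covering_map2 G act A B F a b
        \<in> iso (covering_sum2 G act A a b) (add_monoid (Hom B (fobj F a) (fobj F b)))"
    and natural1: "\<lbrakk>a \<in> Obj A; a' \<in> Obj A; b \<in> Obj A; b' \<in> Obj A; u \<in> Mor A a' a; h \<in> Mor A b b';
        x \<in> carrier (covering_sum1 G act A a b)\<rbrakk> \<Longrightarrow>
      covering_map1 G act A B F a' b'
          (\<lambda>g\<in>carrier G. cmp A (fmor (act g) b b' h) (cmp A (x g) u))
        = cmp B (fmor F b b' h) (cmp B (covering_map1 G act A B F a b x) (fmor F a' a u))"
    and natural2: "\<lbrakk>a \<in> Obj A; a' \<in> Obj A; b \<in> Obj A; b' \<in> Obj A; u \<in> Mor A a' a; h \<in> Mor A b b';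
        x \<in> carrier (covering_sum2 G act A a b)\<rbrakk> \<Longrightarrow>
      covering_map2 G act A B F a' b'
          (\<lambda>g\<in>carrier G. cmp A h (cmp A (x g) (fmor (act g) a' a u)))
        = cmp B (fmor F b b' h) (cmp B (covering_map2 G act A B F a b x) (fmor F a' a u))"

locale G_covering = G_precovering +
  assumes surj_obj: "fobj F ` Obj A = Obj B"

text \<open>
  The category of an algebra with idempotents e v, v in V: the morphisms from i to j are the
  elements of the corner e j A e i.
\<close>

definition algebra_category ::
  "('k, 'm) module \<Rightarrow> 'o set \<Rightarrow> ('o \<Rightarrow> 'm) \<Rightarrow> ('o, 'k, 'm) kcat" where
  "algebra_category A V e =
     \<lparr>Obj = V,
      Hom = (\<lambda>i j. A\<lparr>carrier := {e j \<otimes>\<^bsub>A\<^esub> x \<otimes>\<^bsub>A\<^esub> e i | x. x \<in> carrier A}\<rparr>),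
      cmp = (\<lambda>g f. g \<otimes>\<^bsub>A\<^esub> f),
      idn = e\<rparr>"

definition quotient_algebra :: "('k, 'm) module \<Rightarrow> 'm set \<Rightarrow> ('k, 'm set) module" where
  "quotient_algebra A I =
     ring.extend (A Quot I) (module.fields (\<lambda>r Y. \<Union>y\<in>Y. I +>\<^bsub>A\<^esub> (r \<odot>\<^bsub>A\<^esub> y)))"


section \<open>Completed path algebras\<close>

text \<open>
  A quiver is a \<open>pre_digraph\<close> satisfying \<open>fin_digraph\<close>, which allows loops and multiple arrows.
  A path is given by its start vertex (needed for trivial paths) and the list of its arrows in
  the order in which they are traversed: the path written \<open>\<alpha>\<^sub>r\<dots>\<alpha>\<^sub>1\<close> from right to left is the
  list \<open>[\<alpha>\<^sub>1, \<dots>, \<alpha>\<^sub>r]\<close>.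
\<close>

type_synonym ('v, 'e) path = "'v \<times> 'e list"

definition paths :: "('v, 'e) pre_digraph \<Rightarrow> ('v, 'e) path set" where
  "paths Q = {(u, p). \<exists>v. pre_digraph.awalk Q u p v}"

definition path_elem :: "('v, 'e) path \<Rightarrow> ('v, 'e) path \<Rightarrow> 'k::field" where
  "path_elem x = (\<lambda>y. if y = x then 1 else 0)"

abbreviation vertex_elem :: "'v \<Rightarrow> ('v, 'e) path \<Rightarrow> 'k::field" where
  "vertex_elem v \<equiv> path_elem (v, [])"

abbreviation arrow_elem :: "('v, 'e) pre_digraph \<Rightarrow> 'e \<Rightarrow> ('v, 'e) path \<Rightarrow> 'k::field" where
  "arrow_elem Q \<alpha> \<equiv> path_elem (tail Q \<alpha>, [\<alpha>])"

text \<open>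
  Elements are arbitrary families of coefficients, indexed by the paths. In a product \<open>f g\<close>, the
  factor g contributes the initial segment of a path and f the final one.
\<close>

definition path_algebra :: "('v, 'e) pre_digraph \<Rightarrow> ('k::field, ('v, 'e) path \<Rightarrow> 'k) module" where
  "path_algebra Q =
     \<lparr>carrier = {f. \<forall>x. x \<notin> paths Q \<longrightarrow> f x = 0},
      monoid.mult = (\<lambda>f g (u, p). if (u, p) \<in> paths Q
        then \<Sum>i\<le>length p. f (pre_digraph.awlast Q u (take i p), drop i p) * g (u, take i p)
        else 0),
      one = (\<lambda>(u, p). if u \<in> verts Q \<and> p = [] then 1 else 0),
      ring.zero = (\<lambda>_. 0),
      add = (\<lambda>f g x. f x + g x),
      module.smult = (\<lambda>r f x. r * f x)\<rparr>"

text \<open>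
  The adic topology for the ideal generated by the arrows: a basis of neighbourhoods of f consists
  of the sets \<open>f + M\<^sub>n\<close>, where \<open>M\<^sub>n\<close>, the n-th power of that ideal, consists of the series in
  paths of length at least n.
\<close>

definition adic_open ::
  "('v, 'e) pre_digraph \<Rightarrow> (('v, 'e) path \<Rightarrow> 'k::field) set \<Rightarrow> bool" where
  "adic_open Q U \<longleftrightarrow> U \<subseteq> carrier (path_algebra Q) \<and>
     (\<forall>f\<in>U. \<exists>n. \<forall>g\<in>carrier (path_algebra Q).
        (\<forall>x. length (snd x) < n \<longrightarrow> g x = f x) \<longrightarrow> g \<in> U)"

lemma istopology_adic_open: "istopology (adic_open Q)"
  unfolding istopology_def
proof safe
  fix S T :: "(('a, 'b) path \<Rightarrow> 'c) set"
  assume S: "adic_open Q S" and T: "adic_open Q T"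
  show "adic_open Q (S \<inter> T)"
    unfolding adic_open_def
  proof (intro conjI ballI)
    show "S \<inter> T \<subseteq> carrier (path_algebra Q)"
      using S by (auto simp: adic_open_def)
    fix f assume f: "f \<in> S \<inter> T"
    obtain m where m: "\<And>g. g \<in> carrier (path_algebra Q) \<Longrightarrow>
        (\<forall>x. length (snd x) < m \<longrightarrow> g x = f x) \<Longrightarrow> g \<in> S"
      using S f unfolding adic_open_def by blast
    obtain n where n: "\<And>g. g \<in> carrier (path_algebra Q) \<Longrightarrow>
        (\<forall>x. length (snd x) < n \<longrightarrow> g x = f x) \<Longrightarrow> g \<in> T"
      using T f unfolding adic_open_def by blast
    show "\<exists>n. \<forall>g\<in>carrier (path_algebra Q).
        (\<forall>x. length (snd x) < n \<longrightarrow> g x = f x) \<longrightarrow> g \<in> S \<inter> T"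
      by (rule exI[of _ "max m n"]) (auto intro: m n)
  qed
next
  fix K :: "(('a, 'b) path \<Rightarrow> 'c) set set"
  assume K: "\<forall>S\<in>K. adic_open Q S"
  show "adic_open Q (\<Union>K)"
    unfolding adic_open_def
  proof (intro conjI ballI)
    show "\<Union>K \<subseteq> carrier (path_algebra Q)"
      using K by (auto simp: adic_open_def)
    fix f assume "f \<in> \<Union>K"
    then obtain S where S: "S \<in> K" "f \<in> S" by blast
    then obtain n where "\<forall>g\<in>carrier (path_algebra Q).
        (\<forall>x. length (snd x) < n \<longrightarrow> g x = f x) \<longrightarrow> g \<in> S"
      using K unfolding adic_open_def by blast
    then show "\<exists>n. \<forall>g\<in>carrier (path_algebra Q).
        (\<forall>x. length (snd x) < n \<longrightarrow> g x = f x) \<longrightarrow> g \<in> \<Union>K"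
      using S(1) by blast
  qed
qed

definition adic_topology ::
  "('v, 'e) pre_digraph \<Rightarrow> (('v, 'e) path \<Rightarrow> 'k::field) topology" where
  "adic_topology Q = topology (adic_open Q)"

definition path_category ::
  "('v, 'e) pre_digraph \<Rightarrow> ('v, 'k::field, ('v, 'e) path \<Rightarrow> 'k) kcat" where
  "path_category Q = algebra_category (path_algebra Q) (verts Q) vertex_elem"


section \<open>Potentials and Jacobian algebras\<close>

text \<open>An oriented cycle is nontrivial, so its list of arrows determines its start vertex.\<close>

definition cycles :: "('v, 'e) pre_digraph \<Rightarrow> 'e list set" where
  "cycles Q = {p. p \<noteq> [] \<and> (\<exists>u. pre_digraph.awalk Q u p u)}"

definition cyc_class :: "'e list \<Rightarrow> 'e list set" where
  "cyc_class p = {rotate i p | i. True}"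

definition cyc :: "('v, 'e) pre_digraph \<Rightarrow> 'e list set set" where
  "cyc Q = cyc_class ` cycles Q"

definition potential :: "('v, 'e) pre_digraph \<Rightarrow> ('e list set \<Rightarrow> 'k::field) \<Rightarrow> bool" where
  "potential Q W \<longleftrightarrow> (\<forall>c. W c \<noteq> 0 \<longrightarrow> c \<in> cyc Q)"

text \<open>
  With 0-based indices, removing the arrow at position i from a cycle leaves the path that
  traverses \<open>drop (Suc i) p\<close> and then \<open>take i p\<close>. The coefficient of a path in the derivative
  counts the positions that yield it; this does not depend on the representative p.
\<close>

definition cycle_deriv ::
  "('v, 'e) pre_digraph \<Rightarrow> 'e \<Rightarrow> 'e list \<Rightarrow> ('v, 'e) path \<Rightarrow> 'k::field" where
  "cycle_deriv Q \<alpha> p =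
     (\<lambda>x. \<Sum>i\<in>{i. i < length p \<and> p ! i = \<alpha>}. path_elem (head Q \<alpha>, drop (Suc i) p @ take i p) x)"

definition cyc_deriv ::
  "('v, 'e) pre_digraph \<Rightarrow> 'e \<Rightarrow> 'e list set \<Rightarrow> ('v, 'e) path \<Rightarrow> 'k::field" where
  "cyc_deriv Q \<alpha> c = cycle_deriv Q \<alpha> (SOME p. p \<in> c)"

text \<open>For each path, at most one cycle class contributes a nonzero term to the sum below.\<close>

definition potential_deriv ::
  "('v, 'e) pre_digraph \<Rightarrow> ('e list set \<Rightarrow> 'k::field) \<Rightarrow> 'e \<Rightarrow> ('v, 'e) path \<Rightarrow> 'k" where
  "potential_deriv Q W \<alpha> = (\<lambda>x.
     \<Sum>c\<in>{c \<in> cyc Q. cyc_deriv Q \<alpha> c x \<noteq> (0::'k)}. W c * cyc_deriv Q \<alpha> c x)"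

definition jacobian_ideal ::
  "('v, 'e) pre_digraph \<Rightarrow> ('e list set \<Rightarrow> 'k::field) \<Rightarrow> (('v, 'e) path \<Rightarrow> 'k) set" where
  "jacobian_ideal Q W = adic_topology Q closure_of
     (Idl\<^bsub>path_algebra Q\<^esub> (potential_deriv Q W ` arcs Q))"

definition jacobian_algebra ::
  "('v, 'e) pre_digraph \<Rightarrow> ('e list set \<Rightarrow> 'k::field) \<Rightarrow> ('k, (('v, 'e) path \<Rightarrow> 'k) set) module" where
  "jacobian_algebra Q W = quotient_algebra (path_algebra Q) (jacobian_ideal Q W)"

definition jacobian_class ::
  "('v, 'e) pre_digraph \<Rightarrow> ('e list set \<Rightarrow> 'k::field) \<Rightarrow> (('v, 'e) path \<Rightarrow> 'k)
    \<Rightarrow> (('v, 'e) path \<Rightarrow> 'k) set" where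
  "jacobian_class Q W f = jacobian_ideal Q W +>\<^bsub>path_algebra Q\<^esub> f"

definition jacobian_category ::
  "('v, 'e) pre_digraph \<Rightarrow> ('e list set \<Rightarrow> 'k::field)
    \<Rightarrow> ('v, 'k, (('v, 'e) path \<Rightarrow> 'k) set) kcat" where
  "jacobian_category Q W =
     algebra_category (jacobian_algebra Q W) (verts Q) (\<lambda>v. jacobian_class Q W (vertex_elem v))"


section \<open>Groups of automorphisms and orbit quivers\<close>

type_synonym ('v, 'e) quiver_map = "('v \<Rightarrow> 'v) \<times> ('e \<Rightarrow> 'e)"

definition bij_group :: "('v, 'e) pre_digraph \<Rightarrow> ('v, 'e) quiver_map monoid" where
  "bij_group Q = BijGroup (verts Q) \<times>\<times> BijGroup (arcs Q)"

definition quiver_automorphisms :: "('v, 'e) pre_digraph \<Rightarrow> ('v, 'e) quiver_map set" where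
  "quiver_automorphisms Q = {\<phi> \<in> carrier (bij_group Q). \<forall>\<alpha>\<in>arcs Q.
     tail Q (snd \<phi> \<alpha>) = fst \<phi> (tail Q \<alpha>) \<and> head Q (snd \<phi> \<alpha>) = fst \<phi> (head Q \<alpha>)}"

definition path_map :: "('v, 'e) quiver_map \<Rightarrow> ('v, 'e) path \<Rightarrow> ('v, 'e) path" where
  "path_map \<phi> x = (fst \<phi> (fst x), map (snd \<phi>) (snd x))"

definition cyc_map :: "('v, 'e) quiver_map \<Rightarrow> 'e list set \<Rightarrow> 'e list set" where
  "cyc_map \<phi> c = map (snd \<phi>) ` c"

definition qp_automorphisms ::
  "('v, 'e) pre_digraph \<Rightarrow> ('e list set \<Rightarrow> 'k::field) \<Rightarrow> ('v, 'e) quiver_map set" where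
  "qp_automorphisms Q W =
     {\<phi> \<in> quiver_automorphisms Q. \<forall>c\<in>cyc Q. W c \<noteq> 0 \<longrightarrow> W (cyc_map \<phi> c) = W c}"

definition admissible_group ::
  "('v, 'e) pre_digraph \<Rightarrow> ('e list set \<Rightarrow> 'k::field) \<Rightarrow> ('v, 'e) quiver_map set \<Rightarrow> bool" where
  "admissible_group Q W G \<longleftrightarrow> subgroup G (bij_group Q) \<and> G \<subseteq> qp_automorphisms Q W \<and>
     (\<forall>g\<in>G. \<forall>v\<in>verts Q. fst g v = v \<longrightarrow> g = \<one>\<^bsub>bij_group Q\<^esub>)"

definition acting_group ::
  "('v, 'e) pre_digraph \<Rightarrow> ('v, 'e) quiver_map set \<Rightarrow> ('v, 'e) quiver_map monoid" where
  "acting_group Q G = (bij_group Q)\<lparr>carrier := G\<rparr>"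

abbreviation vertex_orbit ::
  "('v, 'e) pre_digraph \<Rightarrow> ('v, 'e) quiver_map set \<Rightarrow> 'v \<Rightarrow> 'v set" where
  "vertex_orbit Q G \<equiv> orbit (acting_group Q G) fst"

abbreviation arrow_orbit ::
  "('v, 'e) pre_digraph \<Rightarrow> ('v, 'e) quiver_map set \<Rightarrow> 'e \<Rightarrow> 'e set" where
  "arrow_orbit Q G \<equiv> orbit (acting_group Q G) snd"

text \<open>
  As automorphisms commute with tails and heads, the tails of the arrows in an orbit form the
  orbit of the tail of any one of them, and likewise for heads.
\<close>

definition orbit_quiver ::
  "('v, 'e) pre_digraph \<Rightarrow> ('v, 'e) quiver_map set \<Rightarrow> ('v set, 'e set) pre_digraph" where
  "orbit_quiver Q G =
     \<lparr>verts = orbits (acting_group Q G) (verts Q) fst,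
      arcs = orbits (acting_group Q G) (arcs Q) snd,
      tail = (\<lambda>a. tail Q ` a),
      head = (\<lambda>a. head Q ` a)\<rparr>"

text \<open>
  An orbit C of cycle classes of Q is read as a class of cycles of the orbit quiver by replacing
  every arrow by its orbit. Distinct orbits give distinct classes when G is admissible, so the sum
  below has at most one term. Classes of cycles of the orbit quiver that lift only to non-closed
  paths of Q are of no such form; they get coefficient 0.
\<close>

definition orbit_class ::
  "('v, 'e) pre_digraph \<Rightarrow> ('v, 'e) quiver_map set \<Rightarrow> 'e list set set \<Rightarrow> 'e set list set" where
  "orbit_class Q G C = map (arrow_orbit Q G) ` \<Union>C"

definition orbit_potential ::
  "('v, 'e) pre_digraph \<Rightarrow> ('v, 'e) quiver_map set \<Rightarrow> ('e list set \<Rightarrow> 'k::field)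
    \<Rightarrow> 'e set list set \<Rightarrow> 'k" where
  "orbit_potential Q G W = (\<lambda>d.
     \<Sum>C\<in>{C \<in> orbits (acting_group Q G) (cyc Q) cyc_map. orbit_class Q G C = d}.
       W (SOME c. c \<in> C) * of_nat (card C))"


section \<open>The actions on the categories, and the projection functor\<close>

text \<open>The linear extension of the action on paths: the coefficient of x in gf is that of
  \<open>g\<^sup>-\<^sup>1x\<close> in f.\<close>

definition path_action ::
  "('v, 'e) pre_digraph \<Rightarrow> ('v, 'e) quiver_map \<Rightarrow> (('v, 'e) path \<Rightarrow> 'k::field)
    \<Rightarrow> ('v, 'e) path \<Rightarrow> 'k" where
  "path_action Q g f = (\<lambda>x. if x \<in> paths Q then f (path_map (inv\<^bsub>bij_group Q\<^esub> g) x) else 0)"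

definition path_category_action ::
  "('v, 'e) pre_digraph \<Rightarrow> ('v, 'e) quiver_map
    \<Rightarrow> ('v, ('v, 'e) path \<Rightarrow> 'k::field, 'v, ('v, 'e) path \<Rightarrow> 'k) kfunctor" where
  "path_category_action Q g = \<lparr>fobj = fst g, fmor = (\<lambda>a b. path_action Q g)\<rparr>"

definition jacobian_category_action ::
  "('v, 'e) pre_digraph \<Rightarrow> ('v, 'e) quiver_map
    \<Rightarrow> ('v, (('v, 'e) path \<Rightarrow> 'k::field) set, 'v, (('v, 'e) path \<Rightarrow> 'k) set) kfunctor" where
  "jacobian_category_action Q g = \<lparr>fobj = fst g, fmor = (\<lambda>a b Y. path_action Q g ` Y)\<rparr>"

definition projection_functor ::
  "('v, 'e) pre_digraph \<Rightarrow> ('v, 'e) quiver_map set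
    \<Rightarrow> ('v, ('v, 'e) path \<Rightarrow> 'k::field, 'v set, ('v set, 'e set) path \<Rightarrow> 'k) kfunctor \<Rightarrow> bool" where
  "projection_functor Q G \<pi> \<longleftrightarrow>
     linear_functor ring_of_type_algebra (path_category Q) (path_category (orbit_quiver Q G)) \<pi> \<and>
     (\<forall>a\<in>verts Q. \<forall>b\<in>verts Q.
        continuous_map (subtopology (adic_topology Q) (Mor (path_category Q) a b))
          (adic_topology (orbit_quiver Q G)) (fmor \<pi> a b)) \<and>
     (\<forall>v\<in>verts Q. fobj \<pi> v = vertex_orbit Q G v) \<and>
     (\<forall>\<alpha>\<in>arcs Q. fmor \<pi> (tail Q \<alpha>) (head Q \<alpha>) (arrow_elem Q \<alpha>)
        = arrow_elem (orbit_quiver Q G) (arrow_orbit Q G \<alpha>))"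

text \<open>The equations determine the induced functor, every morphism of the Jacobian category being
  the class of a morphism of the path category.\<close>

definition induced_functor ::
  "('v, 'e) pre_digraph \<Rightarrow> ('e list set \<Rightarrow> 'k::field)
    \<Rightarrow> ('w, 'f) pre_digraph \<Rightarrow> ('f list set \<Rightarrow> 'k)
    \<Rightarrow> ('v, ('v, 'e) path \<Rightarrow> 'k, 'w, ('w, 'f) path \<Rightarrow> 'k) kfunctor
    \<Rightarrow> ('v, (('v, 'e) path \<Rightarrow> 'k) set, 'w, (('w, 'f) path \<Rightarrow> 'k) set) kfunctor \<Rightarrow> bool" where
  "induced_functor Q W Q' W' \<pi> F \<longleftrightarrow>
     (\<forall>v\<in>verts Q. fobj F v = fobj \<pi> v) \<and>
     (\<forall>a\<in>verts Q. \<forall>b\<in>verts Q. \<forall>f\<in>Mor (path_category Q) a b.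
        fmor F a b (jacobian_class Q W f) = jacobian_class Q' W' (fmor \<pi> a b f))"

end

(* Let pi be the projection kQ^ -> k(Q_G)^. Lifting a path of Q_G is unique once its start vertex
   is prescribed, because G acts freely on vertices; so a series f on the paths of Q_G from Ga to Gb
   is the sum over g in G of the projections of its lifts to the paths from a to gb. This is the
   covering property of pi.

   The coefficient of a path r in d_alpha W is W[c] * per(c), where c is the cycle alpha r and per(c)
   is the number of rotations that fix c. The image of c in Q_G has per(c) * |Stab [c]| such
   rotations, and W_G gives it the coefficient W[c] * |G[c]|; by the orbit-stabilizer theorem,
   d_(G alpha) W_G = |G| pi(d_alpha W). As |G| is invertible in k, both the series on Q whose
   homogeneous components project into the Jacobian ideal of Q_G, and the series on Q_G whose lifts
   all lie in that of Q, form closed ideals that contain the generators. Hence projection and lifting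
   preserve the Jacobian ideals, and the covering property passes to the quotients. *)

theory Submission
  imports Defs
begin

section \<open>Coverings by finite groups\<close>

text \<open>The projection is not an algebra homomorphism: a product of two projected series also
  pairs paths that do not compose in Q. Multiplicativity is therefore available only between
  prescribed end vertices, and the ideal arguments run over the components e_b f e_a, for which a
  product of series becomes a matrix product over the intermediate vertices. Lifting is treated in
  the same way.

  The factor |G| acts differently in the two directions. Lifting a derivative of W_G gives |G| times
  a derivative of W, which is harmless in every characteristic; projecting a derivative of W calls
  for division by |G|. Invariance of the Jacobian ideal of Q under G then follows from both:
  translating a component from a to b by g amounts to projecting it and lifting the result again
  from ga.

  A cycle of Q_G may lift only to paths that do not close up in Q. The comparison of derivatives has
  to show that such cycles contribute nothing.

  The theorem concerns every continuous functor with the prescribed values. Such a functor is first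
  identified with the explicit sum over fibres, \<open>proj\<close>, and all computations are done
  with the latter.\<close>

context k_category
begin

lemma abelian_group_Hom: "a \<in> Obj C \<Longrightarrow> b \<in> Obj C \<Longrightarrow> abelian_group (Hom C a b)"
  using module_Hom module.axioms(2) by blast

lemma zero_closed: "a \<in> Obj C \<Longrightarrow> b \<in> Obj C \<Longrightarrow> \<zero>\<^bsub>Hom C a b\<^esub> \<in> Mor C a b"
  using abelian_group_Hom abelian_groupE(2) by blast

text \<open>Stated for a bare additive map, so that it serves composition on either side, linear
  functors and the passage to residue classes alike.\<close>

lemma additive_finsum:
  assumes ab: "a \<in> Obj C" "b \<in> Obj C" and B: "abelian_group B"
    and closed: "\<And>f. f \<in> Mor C a b \<Longrightarrow> h f \<in> carrier B"
    and add: "\<And>f f'. f \<in> Mor C a b \<Longrightarrow> f' \<in> Mor C a b \<Longrightarrow>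
      h (f \<oplus>\<^bsub>Hom C a b\<^esub> f') = h f \<oplus>\<^bsub>B\<^esub> h f'"
  shows "h \<zero>\<^bsub>Hom C a b\<^esub> = \<zero>\<^bsub>B\<^esub>"
    and "finite I \<Longrightarrow> (\<And>i. i \<in> I \<Longrightarrow> f i \<in> Mor C a b) \<Longrightarrow>
      h (finsum (Hom C a b) f I) = finsum B (\<lambda>i. h (f i)) I"
proof -
  interpret H: abelian_group "Hom C a b" using abelian_group_Hom ab by blast
  interpret B: abelian_group B by (rule B)
  interpret group_hom "add_monoid (Hom C a b)" "add_monoid B" h
    using closed add by unfold_locales (auto simp: hom_def)
  show zero: "h \<zero>\<^bsub>Hom C a b\<^esub> = \<zero>\<^bsub>B\<^esub>"
    using hom_one by simp
  show "h (finsum (Hom C a b) f I) = finsum B (\<lambda>i. h (f i)) I"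
    if "finite I" "\<And>i. i \<in> I \<Longrightarrow> f i \<in> Mor C a b"
    using that
  proof (induction I rule: finite_induct)
    case (insert i I)
    then show ?case
      using closed by (subst H.finsum_insert; (subst B.finsum_insert)?) (auto simp: add Pi_iff)
  qed (simp add: zero)
qed

lemma cmp_finsum_left:
  assumes "a \<in> Obj C" "b \<in> Obj C" "c \<in> Obj C" "finite I"
    "\<And>i. i \<in> I \<Longrightarrow> f i \<in> Mor C a b" "g \<in> Mor C b c"
  shows "cmp C g (finsum (Hom C a b) f I) = finsum (Hom C a c) (\<lambda>i. cmp C g (f i)) I"
  using assms cmp_closed cmp_add_right
  by (intro additive_finsum(2)) (auto simp: abelian_group_Hom)

lemma cmp_finsum_right:
  assumes "a \<in> Obj C" "b \<in> Obj C" "c \<in> Obj C" "finite I"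
    "\<And>i. i \<in> I \<Longrightarrow> g i \<in> Mor C b c" "f \<in> Mor C a b"
  shows "cmp C (finsum (Hom C b c) g I) f = finsum (Hom C a c) (\<lambda>i. cmp C (g i) f) I"
  using assms cmp_closed cmp_add_left
  by (intro additive_finsum(2)[where h = "\<lambda>g. cmp C g f"]) (auto simp: abelian_group_Hom)

end

lemma (in linear_functor) fmor_zero:
  assumes "a \<in> Obj A" "b \<in> Obj A"
  shows "fmor F a b \<zero>\<^bsub>Hom A a b\<^esub> = \<zero>\<^bsub>Hom B (fobj F a) (fobj F b)\<^esub>"
  using assms by (intro A.additive_finsum(1))
    (auto simp: fobj_closed fmor_closed fmor_add B.abelian_group_Hom)

context category_action
begin

lemma act_closed: "g \<in> carrier G \<Longrightarrow> a \<in> Obj A \<Longrightarrow> fobj (act g) a \<in> Obj A"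
  using act_functor linear_functor.fobj_closed by fastforce

lemma act_inv_obj:
  assumes "g \<in> carrier G" "a \<in> Obj A"
  shows "fobj (act g) (fobj (act (inv g)) a) = a" "fobj (act (inv g)) (fobj (act g) a) = a"
  using assms act_mult_obj[of g "inv g" a] act_mult_obj[of "inv g" g a] act_one_obj by auto

lemma act_mor_closed:
  assumes "g \<in> carrier G" "a \<in> Obj A" "b \<in> Obj A" "f \<in> Mor A a b"
  shows "fmor (act g) a b f \<in> Mor A (fobj (act g) a) (fobj (act g) b)"
  using assms act_functor linear_functor.fmor_closed by fastforce

lemma act_inv_mor:
  assumes "g \<in> carrier G" "a \<in> Obj A" "b \<in> Obj A" "f \<in> Mor A a b"
  shows "fmor (act (inv g)) (fobj (act g) a) (fobj (act g) b) (fmor (act g) a b f) = f"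
  using assms act_mult_mor[of "inv g" g a b f] act_one_mor by auto

lemma act_zero:
  assumes "g \<in> carrier G" "a \<in> Obj A" "b \<in> Obj A"
  shows "fmor (act g) a b \<zero>\<^bsub>Hom A a b\<^esub> = \<zero>\<^bsub>Hom A (fobj (act g) a) (fobj (act g) b)\<^esub>"
  using assms linear_functor.fmor_zero[OF act_functor] by auto

end

text \<open>Bijectivity is required only for the first family of covering maps. The condition
  \<open>fmor_act\<close>, that F does not see translation by G, gives the second family and both
  naturality laws. As the group is finite, the sums may run over all of it.\<close>

locale finite_covering = F: linear_functor R A B F + category_action R A G act
  for R :: "'k ring" and A :: "('o, 'k, 'm) kcat" and B :: "('p, 'k, 'n) kcat"
    and G :: "('g, 'x) monoid_scheme" (structure) and act :: "'g \<Rightarrow> ('o, 'm, 'o, 'm) kfunctor"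
    and F :: "('o, 'm, 'p, 'n) kfunctor" +
  assumes finite_group: "finite (carrier G)"
    and fobj_act: "\<lbrakk>g \<in> carrier G; a \<in> Obj A\<rbrakk> \<Longrightarrow> fobj F (fobj (act g) a) = fobj F a"
    and fmor_act: "\<lbrakk>g \<in> carrier G; a \<in> Obj A; b \<in> Obj A; f \<in> Mor A a b\<rbrakk> \<Longrightarrow>
      fmor F (fobj (act g) a) (fobj (act g) b) (fmor (act g) a b f) = fmor F a b f"
    and sum_inj: "\<lbrakk>a \<in> Obj A; b \<in> Obj A; \<And>g. g \<in> carrier G \<Longrightarrow> x g \<in> Mor A a (fobj (act g) b);
        (\<Oplus>\<^bsub>Hom B (fobj F a) (fobj F b)\<^esub> g \<in> carrier G. fmor F a (fobj (act g) b) (x g))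
          = \<zero>\<^bsub>Hom B (fobj F a) (fobj F b)\<^esub>; g \<in> carrier G\<rbrakk>
      \<Longrightarrow> x g = \<zero>\<^bsub>Hom A a (fobj (act g) b)\<^esub>"
    and sum_surj: "\<lbrakk>a \<in> Obj A; b \<in> Obj A; y \<in> Mor B (fobj F a) (fobj F b)\<rbrakk> \<Longrightarrow>
      \<exists>x. (\<forall>g\<in>carrier G. x g \<in> Mor A a (fobj (act g) b)) \<and>
        (\<Oplus>\<^bsub>Hom B (fobj F a) (fobj F b)\<^esub> g \<in> carrier G. fmor F a (fobj (act g) b) (x g)) = y"
    and surj_obj: "fobj F ` Obj A = Obj B"
begin

section \<open>Direct sums of Hom spaces over a finite group, and the covering maps\<close>

abbreviation HB where "HB a b \<equiv> Hom B (fobj F a) (fobj F b)"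

lemma abelian_HB: "a \<in> Obj A \<Longrightarrow> b \<in> Obj A \<Longrightarrow> abelian_group (HB a b)"
  by (simp add: F.B.abelian_group_Hom F.fobj_closed)

lemma group_HA: "a \<in> Obj A \<Longrightarrow> b \<in> Obj A \<Longrightarrow> Group.group (add_monoid (Hom A a b))"
  by (simp add: F.A.abelian_group_Hom abelian_group.a_group)

lemma fmor_closed1:
  assumes "g \<in> carrier G" "a \<in> Obj A" "b \<in> Obj A" "f \<in> Mor A a (fobj (act g) b)"
  shows "fmor F a (fobj (act g) b) f \<in> carrier (HB a b)"
  using F.fmor_closed[of a "fobj (act g) b" f] assms act_closed fobj_act by simp

lemma fmor_closed2:
  assumes "g \<in> carrier G" "a \<in> Obj A" "b \<in> Obj A" "f \<in> Mor A (fobj (act g) a) b"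
  shows "fmor F (fobj (act g) a) b f \<in> carrier (HB a b)"
  using F.fmor_closed[of "fobj (act g) a" b f] assms act_closed fobj_act by simp

lemma carrier_sum1:
  assumes "a \<in> Obj A" "b \<in> Obj A"
  shows "carrier (covering_sum1 G act A a b) = (\<Pi>\<^sub>E g\<in>carrier G. Mor A a (fobj (act g) b))"
  using assms act_closed finite_group
  by (auto simp: covering_sum1_def carrier_sum_group group_HA)

lemma carrier_sum2:
  assumes "a \<in> Obj A" "b \<in> Obj A"
  shows "carrier (covering_sum2 G act A a b) = (\<Pi>\<^sub>E g\<in>carrier G. Mor A (fobj (act g) a) b)"
  using assms act_closed finite_group
  by (auto simp: covering_sum2_def carrier_sum_group group_HA)

text \<open>Leaving the support is harmless: F sends zero to zero, so the added terms
  vanish.\<close>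

lemma covering_map1_eq:
  assumes "a \<in> Obj A" "b \<in> Obj A" "\<And>g. g \<in> carrier G \<Longrightarrow> x g \<in> Mor A a (fobj (act g) b)"
  shows "covering_map1 G act A B F a b x
    = (\<Oplus>\<^bsub>HB a b\<^esub> g \<in> carrier G. fmor F a (fobj (act g) b) (x g))"
proof -
  interpret H: abelian_group "HB a b" using assms by (rule_tac abelian_HB)
  show ?thesis unfolding covering_map1_def
    using assms finite_group F.fmor_zero[OF assms(1) act_closed[OF _ assms(2)]]
    by (intro H.add.finprod_mono_neutral_cong_left) (auto simp: fmor_closed1 fobj_act)
qed

lemma covering_map2_eq:
  assumes "a \<in> Obj A" "b \<in> Obj A" "\<And>g. g \<in> carrier G \<Longrightarrow> x g \<in> Mor A (fobj (act g) a) b"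
  shows "covering_map2 G act A B F a b x
    = (\<Oplus>\<^bsub>HB a b\<^esub> g \<in> carrier G. fmor F (fobj (act g) a) b (x g))"
proof -
  interpret H: abelian_group "HB a b" using assms by (rule_tac abelian_HB)
  show ?thesis unfolding covering_map2_def
    using assms finite_group F.fmor_zero[OF act_closed[OF _ assms(1)] assms(2)]
    by (intro H.add.finprod_mono_neutral_cong_left) (auto simp: fmor_closed2 fobj_act)
qed

lemma iso1:
  assumes a: "a \<in> Obj A" and b: "b \<in> Obj A"
  shows "covering_map1 G act A B F a b
    \<in> iso (covering_sum1 G act A a b) (add_monoid (HB a b))"
proof -
  interpret H: abelian_group "HB a b" using a b by (rule abelian_HB)
  let ?S = "covering_sum1 G act A a b" and ?c = "covering_map1 G act A B F a b"
  note car = carrier_sum1[OF a b]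
  have S: "group ?S"
    using a b act_closed by (auto simp: covering_sum1_def group_HA)
  have eq: "?c x = (\<Oplus>\<^bsub>HB a b\<^esub> g \<in> carrier G. fmor F a (fobj (act g) b) (x g))"
    if "x \<in> carrier ?S" for x
    using that a b by (intro covering_map1_eq) (auto simp: car)
  have hom: "?c \<in> hom ?S (add_monoid (HB a b))"
  proof (rule homI)
    fix x y assume x: "x \<in> carrier ?S" and y: "y \<in> carrier ?S"
    have xy: "x \<otimes>\<^bsub>?S\<^esub> y \<in> carrier ?S"
      using S x y by (simp add: group.is_monoid monoid.m_closed)
    have m: "x g \<in> Mor A a (fobj (act g) b)" "y g \<in> Mor A a (fobj (act g) b)" if "g \<in> carrier G" for g
      using x y that by (auto simp: car)
    have "(x \<otimes>\<^bsub>?S\<^esub> y) g = x g \<oplus>\<^bsub>Hom A a (fobj (act g) b)\<^esub> y g" if "g \<in> carrier G" for g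
      using that by (simp add: covering_sum1_def)
    then have "?c (x \<otimes>\<^bsub>?S\<^esub> y) = (\<Oplus>\<^bsub>HB a b\<^esub> g \<in> carrier G.
        fmor F a (fobj (act g) b) (x g) \<oplus>\<^bsub>HB a b\<^esub> fmor F a (fobj (act g) b) (y g))"
      unfolding eq[OF xy] using a b m act_closed
      by (intro H.finsum_cong') (auto simp: F.fmor_add fobj_act fmor_closed1)
    then show "?c (x \<otimes>\<^bsub>?S\<^esub> y) = ?c x \<otimes>\<^bsub>add_monoid (HB a b)\<^esub> ?c y"
      using m a b by (simp add: eq[OF x] eq[OF y] H.finsum_addf fmor_closed1 Pi_iff)
  next
    fix x assume "x \<in> carrier ?S"
    then show "?c x \<in> carrier (add_monoid (HB a b))"
      using a b fmor_closed1[OF _ a b] PiE_mem[of x "carrier G", OF _ ] unfolding eq[OF \<open>x \<in> carrier ?S\<close>]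
      by (auto intro!: H.finsum_closed simp: car)
  qed
  interpret c: group_hom ?S "add_monoid (HB a b)" ?c
    using S hom H.a_group by (simp add: group_hom_def group_hom_axioms_def)
  have "inj_on ?c (carrier ?S)"
  proof (subst c.inj_on_one_iff, intro ballI allI impI)
    fix x assume x: "x \<in> carrier ?S" "?c x = \<one>\<^bsub>add_monoid (HB a b)\<^esub>"
    have "x g = \<zero>\<^bsub>Hom A a (fobj (act g) b)\<^esub>" if "g \<in> carrier G" for g
      using x eq[OF x(1)] a b that by (intro sum_inj[of a b x g]) (auto simp: car PiE_mem)
    then show "x = \<one>\<^bsub>?S\<^esub>"
      using x(1) unfolding covering_sum1_def
      by (auto simp: fun_eq_iff car[unfolded covering_sum1_def] PiE_def extensional_def)
  qed
  moreover have "carrier (HB a b) \<subseteq> ?c ` carrier ?S"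
  proof
    fix y assume "y \<in> carrier (HB a b)"
    then obtain x where x: "\<forall>g\<in>carrier G. x g \<in> Mor A a (fobj (act g) b)"
      and y: "(\<Oplus>\<^bsub>HB a b\<^esub> g \<in> carrier G. fmor F a (fobj (act g) b) (x g)) = y"
      using sum_surj[OF a b] by blast
    have r: "restrict x (carrier G) \<in> carrier ?S" using x by (auto simp: car)
    moreover have "?c (restrict x (carrier G)) = y"
      unfolding eq[OF r] y[symmetric] using x a b
      by (intro H.add.finprod_cong') (auto simp: fmor_closed1)
    ultimately show "y \<in> ?c ` carrier ?S" by blast
  qed
  ultimately show ?thesis
    using hom c.hom_closed by (auto simp: iso_def bij_betw_def)
qed

text \<open>Translating by g turns a component from g^-1 a to b into one from a to gb with the same
  image under F. Up to inversion of the index, this identifies the second sum with the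
  first.\<close>

lemma iso2:
  assumes a: "a \<in> Obj A" and b: "b \<in> Obj A"
  shows "covering_map2 G act A B F a b
    \<in> iso (covering_sum2 G act A a b) (add_monoid (HB a b))"
proof -
  interpret H: abelian_group "HB a b" using a b by (rule abelian_HB)
  let ?S = "covering_sum2 G act A a b" and ?c = "covering_map2 G act A B F a b"
  note car = carrier_sum2[OF a b]
  have S: "group ?S"
    using a b act_closed by (auto simp: covering_sum2_def group_HA)
  have eq: "?c x = (\<Oplus>\<^bsub>HB a b\<^esub> g \<in> carrier G. fmor F (fobj (act g) a) b (x g))"
    if "x \<in> carrier ?S" for x
    using that a b by (intro covering_map2_eq) (auto simp: car)
  have hom: "?c \<in> hom ?S (add_monoid (HB a b))"
  proof (rule homI)
    fix x y assume x: "x \<in> carrier ?S" and y: "y \<in> carrier ?S"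
    have xy: "x \<otimes>\<^bsub>?S\<^esub> y \<in> carrier ?S"
      using S x y by (simp add: group.is_monoid monoid.m_closed)
    have m: "x g \<in> Mor A (fobj (act g) a) b" "y g \<in> Mor A (fobj (act g) a) b" if "g \<in> carrier G" for g
      using x y that by (auto simp: car)
    have "(x \<otimes>\<^bsub>?S\<^esub> y) g = x g \<oplus>\<^bsub>Hom A (fobj (act g) a) b\<^esub> y g" if "g \<in> carrier G" for g
      using that by (simp add: covering_sum2_def)
    then have "?c (x \<otimes>\<^bsub>?S\<^esub> y) = (\<Oplus>\<^bsub>HB a b\<^esub> g \<in> carrier G.
        fmor F (fobj (act g) a) b (x g) \<oplus>\<^bsub>HB a b\<^esub> fmor F (fobj (act g) a) b (y g))"
      unfolding eq[OF xy] using a b m act_closed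
      by (intro H.finsum_cong') (auto simp: F.fmor_add fobj_act fmor_closed2)
    then show "?c (x \<otimes>\<^bsub>?S\<^esub> y) = ?c x \<otimes>\<^bsub>add_monoid (HB a b)\<^esub> ?c y"
      using m a b by (simp add: eq[OF x] eq[OF y] H.finsum_addf fmor_closed2 Pi_iff)
  next
    fix x assume "x \<in> carrier ?S"
    then show "?c x \<in> carrier (add_monoid (HB a b))"
      using a b fmor_closed2[OF _ a b] PiE_mem[of x "carrier G", OF _ ] unfolding eq[OF \<open>x \<in> carrier ?S\<close>]
      by (auto intro!: H.finsum_closed simp: car)
  qed
  interpret c: group_hom ?S "add_monoid (HB a b)" ?c
    using S hom H.a_group by (simp add: group_hom_def group_hom_axioms_def)
  have transl: "(\<Oplus>\<^bsub>HB a b\<^esub> g \<in> carrier G. fmor F (fobj (act g) a) b (x g))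
      = (\<Oplus>\<^bsub>HB a b\<^esub> g \<in> carrier G. fmor F a (fobj (act g) b)
          (fmor (act g) (fobj (act (inv g)) a) b (x (inv g))))"
    if x: "\<And>g. g \<in> carrier G \<Longrightarrow> x g \<in> Mor A (fobj (act g) a) b" for x
  proof -
    have "(\<Oplus>\<^bsub>HB a b\<^esub> g \<in> carrier G. fmor F (fobj (act g) a) b (x g))
        = (\<Oplus>\<^bsub>HB a b\<^esub> g \<in> m_inv G ` carrier G. fmor F (fobj (act g) a) b (x g))"
      using G.inv_inv by (metis (no_types, lifting) G.inv_closed image_iff subsetI subset_antisym image_subset_iff)
    also have "\<dots> = (\<Oplus>\<^bsub>HB a b\<^esub> g \<in> carrier G. fmor F (fobj (act (inv g)) a) b (x (inv g)))"
      using x a b by (intro H.finsum_reindex) (auto simp: fmor_closed2 inj_on_def)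
    also have "\<dots> = (\<Oplus>\<^bsub>HB a b\<^esub> g \<in> carrier G. fmor F a (fobj (act g) b)
          (fmor (act g) (fobj (act (inv g)) a) b (x (inv g))))"
    proof (intro H.finsum_cong' refl)
      have "fmor (act g) (fobj (act (inv g)) a) b (x (inv g)) \<in> Mor A a (fobj (act g) b)"
        if "g \<in> carrier G" for g
        using act_mor_closed[of g "fobj (act (inv g)) a" b "x (inv g)"] that a b x
        by (simp add: act_closed act_inv_obj)
      then show "(\<lambda>g. fmor F a (fobj (act g) b) (fmor (act g) (fobj (act (inv g)) a) b (x (inv g))))
          \<in> carrier G \<rightarrow> carrier (HB a b)"
        using fmor_closed1[OF _ a b] by blast
      show "fmor F (fobj (act (inv g)) a) b (x (inv g))
        = fmor F a (fobj (act g) b) (fmor (act g) (fobj (act (inv g)) a) b (x (inv g)))"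
        if "g \<in> carrier G" for g
        using fmor_act[of g "fobj (act (inv g)) a" b "x (inv g)"] that a b x
        by (simp add: act_closed act_inv_obj)
    qed
    finally show ?thesis .
  qed
  have "inj_on ?c (carrier ?S)"
  proof (subst c.inj_on_one_iff, intro ballI allI impI)
    fix x assume x: "x \<in> carrier ?S" "?c x = \<one>\<^bsub>add_monoid (HB a b)\<^esub>"
    have xm: "x g \<in> Mor A (fobj (act g) a) b" if "g \<in> carrier G" for g
      using x(1) that by (auto simp: car)
    let ?y = "\<lambda>g. fmor (act g) (fobj (act (inv g)) a) b (x (inv g))"
    have y: "?y g \<in> Mor A a (fobj (act g) b)" if "g \<in> carrier G" for g
      using act_mor_closed[of g "fobj (act (inv g)) a" b "x (inv g)"] that a b xm
      by (simp add: act_closed act_inv_obj)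
    have y0: "?y g = \<zero>\<^bsub>Hom A a (fobj (act g) b)\<^esub>" if "g \<in> carrier G" for g
      using x eq[OF x(1)] a b that transl[of x, OF xm] by (intro sum_inj[of a b ?y g] y) auto
    have "x g = \<zero>\<^bsub>Hom A (fobj (act g) a) b\<^esub>" if g: "g \<in> carrier G" for g
    proof -
      \<comment> \<open>Translating by g undoes the substitution at the index \<open>inv g\<close>,
        so the vanishing of \<open>?y\<close> passes back to \<open>x\<close>.\<close>
      have "x g = fmor (act g) a (fobj (act (inv g)) b) (?y (inv g))"
        using act_inv_mor[of "inv g" "fobj (act g) a" b "x g"] g a b xm
        by (simp add: act_closed act_inv_obj)
      then show ?thesis using y0[of "inv g"] act_zero[of g a "fobj (act (inv g)) b"] g a b
        by (simp add: act_closed act_inv_obj)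
    qed
    then show "x = \<one>\<^bsub>?S\<^esub>"
      using x(1) unfolding covering_sum2_def
      by (auto simp: fun_eq_iff car[unfolded covering_sum2_def] PiE_def extensional_def)
  qed
  moreover have "carrier (HB a b) \<subseteq> ?c ` carrier ?S"
  proof
    fix y assume "y \<in> carrier (HB a b)"
    then obtain x where x: "\<And>g. g \<in> carrier G \<Longrightarrow> x g \<in> Mor A a (fobj (act g) b)"
      and y: "(\<Oplus>\<^bsub>HB a b\<^esub> g \<in> carrier G. fmor F a (fobj (act g) b) (x g)) = y"
      using sum_surj[OF a b] by blast
    \<comment> \<open>The inverse of the substitution in \<open>transl\<close>, applied to a
      preimage under the first sum.\<close>
    let ?z = "\<lambda>g\<in>carrier G. fmor (act g) a (fobj (act (inv g)) b) (x (inv g))"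
    have z: "?z g \<in> Mor A (fobj (act g) a) b" if g: "g \<in> carrier G" for g
      using act_mor_closed[of g a "fobj (act (inv g)) b" "x (inv g)"] g a b x
      by (simp add: act_closed act_inv_obj)
    then have r: "?z \<in> carrier ?S" by (auto simp: car)
    have "fmor (act g) (fobj (act (inv g)) a) b (?z (inv g)) = x g" if g: "g \<in> carrier G" for g
      using act_inv_mor[of "inv g" a "fobj (act g) b" "x g"] g a b x
      by (simp add: act_closed act_inv_obj)
    then have "(\<Oplus>\<^bsub>HB a b\<^esub> g \<in> carrier G. fmor F a (fobj (act g) b)
        (fmor (act g) (fobj (act (inv g)) a) b (?z (inv g)))) = y"
      unfolding y[symmetric] using fmor_closed1[OF _ a b x] by (intro H.finsum_cong') auto
    then have "?c ?z = y"
      unfolding eq[OF r] by (subst transl[of ?z, OF z])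
    then show "y \<in> ?c ` carrier ?S" using r by blast
  qed
  ultimately show ?thesis
    using hom c.hom_closed by (auto simp: iso_def bij_betw_def)
qed

text \<open>F does not distinguish h from its translate gh, so the identity holds summand by
  summand; composition in B then distributes over the finite sum.\<close>

lemma natural1:
  assumes a: "a \<in> Obj A" "a' \<in> Obj A" and b: "b \<in> Obj A" "b' \<in> Obj A"
    and u: "u \<in> Mor A a' a" and h: "h \<in> Mor A b b'"
    and x: "x \<in> carrier (covering_sum1 G act A a b)"
  shows "covering_map1 G act A B F a' b'
      (\<lambda>g\<in>carrier G. cmp A (fmor (act g) b b' h) (cmp A (x g) u))
    = cmp B (fmor F b b' h) (cmp B (covering_map1 G act A B F a b x) (fmor F a' a u))"
proof -
  have xg: "x g \<in> Mor A a (fobj (act g) b)" if "g \<in> carrier G" for g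
    using x that by (auto simp: carrier_sum1[OF a(1) b(1)])
  have xu: "cmp A (x g) u \<in> Mor A a' (fobj (act g) b)" if "g \<in> carrier G" for g
    using F.A.cmp_closed[OF _ _ _ u xg[OF that]] that a b act_closed by auto
  have hg: "fmor (act g) b b' h \<in> Mor A (fobj (act g) b) (fobj (act g) b')" if "g \<in> carrier G" for g
    using act_mor_closed[OF that b h] .
  have hxu: "cmp A (fmor (act g) b b' h) (cmp A (x g) u) \<in> Mor A a' (fobj (act g) b')"
    if "g \<in> carrier G" for g
    using F.A.cmp_closed[OF _ _ _ xu[OF that] hg[OF that]] that a b act_closed by auto
  have Fu: "fmor F a' a u \<in> Mor B (fobj F a') (fobj F a)"
    and Fh: "fmor F b b' h \<in> Mor B (fobj F b) (fobj F b')"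
    using F.fmor_closed a b u h by auto
  have Fx: "fmor F a (fobj (act g) b) (x g) \<in> carrier (HB a b)" if "g \<in> carrier G" for g
    using fmor_closed1 that a b xg by auto
  have "covering_map1 G act A B F a' b'
      (\<lambda>g\<in>carrier G. cmp A (fmor (act g) b b' h) (cmp A (x g) u))
    = (\<Oplus>\<^bsub>HB a' b'\<^esub> g \<in> carrier G. fmor F a' (fobj (act g) b')
          (cmp A (fmor (act g) b b' h) (cmp A (x g) u)))"
    using a b hxu abelian_HB[of a' b']
    by (subst covering_map1_eq) (auto intro!: abelian_monoid.finsum_cong'
        simp: abelian_group_def fmor_closed1)
  also have "\<dots> = (\<Oplus>\<^bsub>HB a' b'\<^esub> g \<in> carrier G. cmp B (fmor F b b' h)
      (cmp B (fmor F a (fobj (act g) b) (x g)) (fmor F a' a u)))"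
  proof (intro abelian_monoid.finsum_cong' refl)
    show "abelian_monoid (HB a' b')" using abelian_HB[of a' b'] a b by (simp add: abelian_group_def)
    show "(\<lambda>g. cmp B (fmor F b b' h) (cmp B (fmor F a (fobj (act g) b) (x g)) (fmor F a' a u)))
      \<in> carrier G \<rightarrow> carrier (HB a' b')"
      by (intro Pi_I F.B.cmp_closed[OF _ _ _ F.B.cmp_closed[OF _ _ _ Fu Fx] Fh])
        (simp_all add: a b F.fobj_closed)
    show "fmor F a' (fobj (act g) b') (cmp A (fmor (act g) b b' h) (cmp A (x g) u))
      = cmp B (fmor F b b' h) (cmp B (fmor F a (fobj (act g) b) (x g)) (fmor F a' a u))"
      if g: "g \<in> carrier G" for g
      using F.fmor_cmp[OF _ _ _ xu[OF g] hg[OF g]] F.fmor_cmp[OF _ _ _ u xg[OF g]]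
        fmor_act[OF g b h] g a b by (simp add: act_closed)
  qed
  also have "\<dots> = cmp B (fmor F b b' h) (\<Oplus>\<^bsub>HB a' b\<^esub> g \<in> carrier G.
      cmp B (fmor F a (fobj (act g) b) (x g)) (fmor F a' a u))"
    by (intro F.B.cmp_finsum_left[symmetric] F.B.cmp_closed[OF _ _ _ Fu Fx] finite_group Fh)
      (simp_all add: a b F.fobj_closed)
  also have "\<dots> = cmp B (fmor F b b' h) (cmp B (covering_map1 G act A B F a b x) (fmor F a' a u))"
    using a b F.fobj_closed finite_group Fu Fx xg
    by (subst F.B.cmp_finsum_right[symmetric]) (auto simp: covering_map1_eq)
  finally show ?thesis .
qed

text \<open>As for the first sum, except that u is translated instead of h.\<close>

lemma natural2:
  assumes a: "a \<in> Obj A" "a' \<in> Obj A" and b: "b \<in> Obj A" "b' \<in> Obj A"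
    and u: "u \<in> Mor A a' a" and h: "h \<in> Mor A b b'"
    and x: "x \<in> carrier (covering_sum2 G act A a b)"
  shows "covering_map2 G act A B F a' b'
      (\<lambda>g\<in>carrier G. cmp A h (cmp A (x g) (fmor (act g) a' a u)))
    = cmp B (fmor F b b' h) (cmp B (covering_map2 G act A B F a b x) (fmor F a' a u))"
proof -
  have xg: "x g \<in> Mor A (fobj (act g) a) b" if "g \<in> carrier G" for g
    using x that by (auto simp: carrier_sum2[OF a(1) b(1)])
  have ug: "fmor (act g) a' a u \<in> Mor A (fobj (act g) a') (fobj (act g) a)" if "g \<in> carrier G" for g
    using act_mor_closed[OF that a(2,1) u] .
  have xu: "cmp A (x g) (fmor (act g) a' a u) \<in> Mor A (fobj (act g) a') b" if "g \<in> carrier G" for g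
    using F.A.cmp_closed[OF _ _ _ ug[OF that] xg[OF that]] that a b act_closed by auto
  have hxu: "cmp A h (cmp A (x g) (fmor (act g) a' a u)) \<in> Mor A (fobj (act g) a') b'"
    if "g \<in> carrier G" for g
    using F.A.cmp_closed[OF _ _ _ xu[OF that] h] that a b act_closed by auto
  have Fu: "fmor F a' a u \<in> Mor B (fobj F a') (fobj F a)"
    and Fh: "fmor F b b' h \<in> Mor B (fobj F b) (fobj F b')"
    using F.fmor_closed a b u h by auto
  have Fx: "fmor F (fobj (act g) a) b (x g) \<in> carrier (HB a b)" if "g \<in> carrier G" for g
    using fmor_closed2 that a b xg by auto
  have "covering_map2 G act A B F a' b'
      (\<lambda>g\<in>carrier G. cmp A h (cmp A (x g) (fmor (act g) a' a u)))
    = (\<Oplus>\<^bsub>HB a' b'\<^esub> g \<in> carrier G. fmor F (fobj (act g) a') b'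
          (cmp A h (cmp A (x g) (fmor (act g) a' a u))))"
    using a b hxu abelian_HB[of a' b']
    by (subst covering_map2_eq) (auto intro!: abelian_monoid.finsum_cong'
        simp: abelian_group_def fmor_closed2)
  also have "\<dots> = (\<Oplus>\<^bsub>HB a' b'\<^esub> g \<in> carrier G. cmp B (fmor F b b' h)
      (cmp B (fmor F (fobj (act g) a) b (x g)) (fmor F a' a u)))"
  proof (intro abelian_monoid.finsum_cong' refl)
    show "abelian_monoid (HB a' b')" using abelian_HB[of a' b'] a b by (simp add: abelian_group_def)
    show "(\<lambda>g. cmp B (fmor F b b' h) (cmp B (fmor F (fobj (act g) a) b (x g)) (fmor F a' a u)))
      \<in> carrier G \<rightarrow> carrier (HB a' b')"
      by (intro Pi_I F.B.cmp_closed[OF _ _ _ F.B.cmp_closed[OF _ _ _ Fu Fx] Fh])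
        (simp_all add: a b F.fobj_closed)
    show "fmor F (fobj (act g) a') b' (cmp A h (cmp A (x g) (fmor (act g) a' a u)))
      = cmp B (fmor F b b' h) (cmp B (fmor F (fobj (act g) a) b (x g)) (fmor F a' a u))"
      if g: "g \<in> carrier G" for g
      using F.fmor_cmp[OF _ _ _ xu[OF g] h] F.fmor_cmp[OF _ _ _ ug[OF g] xg[OF g]]
        fmor_act[OF g a(2,1) u] g a b by (simp add: act_closed fobj_act)
  qed
  also have "\<dots> = cmp B (fmor F b b' h) (\<Oplus>\<^bsub>HB a' b\<^esub> g \<in> carrier G.
      cmp B (fmor F (fobj (act g) a) b (x g)) (fmor F a' a u))"
    by (intro F.B.cmp_finsum_left[symmetric] F.B.cmp_closed[OF _ _ _ Fu Fx] finite_group Fh)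
      (simp_all add: a b F.fobj_closed)
  also have "\<dots> = cmp B (fmor F b b' h) (cmp B (covering_map2 G act A B F a b x) (fmor F a' a u))"
    using a b F.fobj_closed finite_group Fu Fx xg
    by (subst F.B.cmp_finsum_right[symmetric]) (auto simp: covering_map2_eq)
  finally show ?thesis .
qed

lemma G_covering: "G_covering R A B G act F"
  by unfold_locales (auto intro: fobj_act iso1 iso2 natural1 natural2 simp: surj_obj)

end

section \<open>Categories of algebras with idempotents\<close>

text \<open>Path algebras are not commutative, so scalars have to be moved through each factor of a
  product separately.\<close>

locale k_algebra = A: ring A
  for R :: "'k ring" and A :: "('k, 'm) module" (structure) +
  assumes field_R: "field R" and module_A: "module R A"
    and smult_mult_left: "\<lbrakk>r \<in> carrier R; x \<in> carrier A; y \<in> carrier A\<rbrakk>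
      \<Longrightarrow> (r \<odot> x) \<otimes> y = r \<odot> (x \<otimes> y)"
    and smult_mult_right: "\<lbrakk>r \<in> carrier R; x \<in> carrier A; y \<in> carrier A\<rbrakk>
      \<Longrightarrow> x \<otimes> (r \<odot> y) = r \<odot> (x \<otimes> y)"
begin

lemma smult_closed_A: "r \<in> carrier R \<Longrightarrow> x \<in> carrier A \<Longrightarrow> r \<odot> x \<in> carrier A"
  using module.smult_closed[OF module_A] .

text \<open>Idempotency turns membership in the corner from an existence statement into two
  equations, which are visibly stable under linear operations and composition.\<close>

lemma Mor_algebra_category:
  assumes "e i \<in> carrier A" "e j \<in> carrier A" "e i \<otimes> e i = e i" "e j \<otimes> e j = e j"
  shows "Mor (algebra_category A V e) i j = {x \<in> carrier A. e j \<otimes> x = x \<and> x \<otimes> e i = x}"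
proof (intro equalityI subsetI)
  fix x assume "x \<in> Mor (algebra_category A V e) i j"
  then obtain y where y: "y \<in> carrier A" "x = e j \<otimes> y \<otimes> e i"
    by (auto simp: algebra_category_def)
  have "e j \<otimes> (e j \<otimes> y \<otimes> e i) = (e j \<otimes> e j) \<otimes> y \<otimes> e i"
    using assms(1,2) y(1) by (simp add: A.m_assoc)
  moreover have "e j \<otimes> y \<otimes> e i \<otimes> e i = e j \<otimes> y \<otimes> (e i \<otimes> e i)"
    using assms(1,2) y(1) by (simp add: A.m_assoc)
  ultimately show "x \<in> {x \<in> carrier A. e j \<otimes> x = x \<and> x \<otimes> e i = x}"
    using assms y by simp
next
  fix x assume "x \<in> {x \<in> carrier A. e j \<otimes> x = x \<and> x \<otimes> e i = x}"
  then have "x = e j \<otimes> x \<otimes> e i" "x \<in> carrier A" by auto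
  then show "x \<in> Mor (algebra_category A V e) i j" unfolding algebra_category_def by auto
qed

lemma k_category_algebra_category:
  assumes e: "\<And>v. v \<in> V \<Longrightarrow> e v \<in> carrier A" "\<And>v. v \<in> V \<Longrightarrow> e v \<otimes> e v = e v"
  shows "k_category R (algebra_category A V e)"
proof -
  interpret M: module R A by (rule module_A)
  let ?C = "algebra_category A V e"
  have Obj: "Obj ?C = V" and cmp: "cmp ?C = (\<lambda>g f. g \<otimes> f)" and idn: "idn ?C = e"
    by (simp_all add: algebra_category_def)
  have Mor: "Mor ?C i j = {x \<in> carrier A. e j \<otimes> x = x \<and> x \<otimes> e i = x}"
    if "i \<in> V" "j \<in> V" for i j
    using e that by (intro Mor_algebra_category)
  have ops: "(\<oplus>\<^bsub>Hom ?C i j\<^esub>) = (\<oplus>\<^bsub>A\<^esub>)" "(\<odot>\<^bsub>Hom ?C i j\<^esub>) = (\<odot>\<^bsub>A\<^esub>)" for i j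
    by (simp_all add: algebra_category_def)
  have "module R (Hom ?C i j)" if ij: "i \<in> V" "j \<in> V" for i j
  proof -
    have "submodule (Mor ?C i j) R A"
      unfolding Mor[OF ij] using e ij A.minus_eq
      by (intro M.submoduleI)
        (auto simp: A.r_distr A.l_distr smult_mult_left smult_mult_right A.r_minus A.l_minus smult_closed_A)
    then have "module R (A\<lparr>carrier := Mor ?C i j\<rparr>)"
      by (rule submodule.submodule_is_module) (rule module_A)
    then show ?thesis by (simp add: algebra_category_def)
  qed
  moreover have closed: "f \<in> carrier A" if "f \<in> Mor ?C i j" "i \<in> V" "j \<in> V" for f i j
    using that by (simp add: Mor)
  moreover have "g \<otimes> f \<in> Mor ?C a c"
    if "a \<in> V" "b \<in> V" "c \<in> V" "f \<in> Mor ?C a b" "g \<in> Mor ?C b c" for a b c f g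
    using that e unfolding Mor[OF that(1,2)] Mor[OF that(2,3)] Mor[OF that(1,3)]
    by (simp add: A.m_assoc) (simp add: A.m_assoc[symmetric])
  moreover have "e b \<otimes> f = f" "f \<otimes> e a = f"
    if "a \<in> V" "b \<in> V" "f \<in> Mor ?C a b" for a b f
    using that by (simp_all add: Mor)
  moreover have "e a \<in> Mor ?C a a" if "a \<in> V" for a
    using that e by (simp add: Mor)
  ultimately show ?thesis
    unfolding k_category_def Obj cmp idn ops using field_R
    by (simp add: A.m_assoc A.l_distr A.r_distr smult_mult_left smult_mult_right)
qed

end

locale k_algebra_ideal = k_algebra R A + I: ideal I A
  for R :: "'k ring" and A :: "('k, 'm) module" (structure) and I
begin

abbreviation cl where "cl x \<equiv> I +> x"

abbreviation B where "B \<equiv> quotient_algebra A I"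

lemma quotient_simps:
  "carrier B = carrier (A Quot I)" "monoid.mult B = monoid.mult (A Quot I)" "one B = one (A Quot I)"
  "ring.zero B = ring.zero (A Quot I)" "add B = add (A Quot I)"
  "(\<odot>\<^bsub>B\<^esub>) = (\<lambda>r Y. \<Union>y\<in>Y. I +> (r \<odot> y))"
  by (simp_all add: quotient_algebra_def ring.extend_def module.fields_def)

lemma carrier_quotient: "carrier B = cl ` carrier A"
  by (auto simp: quotient_simps FactRing_def A_RCOSETS_def')

lemma cl_eq_iff: "x \<in> carrier A \<Longrightarrow> y \<in> carrier A \<Longrightarrow> cl x = cl y \<longleftrightarrow> x \<ominus> y \<in> I"
  using A.quotient_eq_iff_same_a_r_cos[OF I.ideal_axioms] by blast

lemma cl_eq_zero_iff: "x \<in> carrier A \<Longrightarrow> cl x = \<zero>\<^bsub>B\<^esub> \<longleftrightarrow> x \<in> I"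
  using I.a_rcos_const I.a_rcos_self by (auto simp: quotient_simps FactRing_def)

lemma cl_mult: "x \<in> carrier A \<Longrightarrow> y \<in> carrier A \<Longrightarrow> cl x \<otimes>\<^bsub>B\<^esub> cl y = cl (x \<otimes> y)"
  by (simp add: quotient_simps FactRing_def I.rcoset_mult_add)

lemma cl_add: "x \<in> carrier A \<Longrightarrow> y \<in> carrier A \<Longrightarrow> cl x \<oplus>\<^bsub>B\<^esub> cl y = cl (x \<oplus> y)"
  by (simp add: quotient_simps FactRing_def I.a_rcos_sum)

text \<open>A ring ideal is closed under scalars because r acts as multiplication by the element r1
  of the algebra.\<close>

lemma smult_mem:
  assumes "r \<in> carrier R" "x \<in> I" shows "r \<odot> x \<in> I"
proof -
  have x: "x \<in> carrier A" using assms(2) by (rule I.a_Hcarr)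
  have "r \<odot> x = (r \<odot> \<one>) \<otimes> x" using assms(1) x by (simp add: smult_mult_left)
  then show ?thesis using assms smult_closed_A[of r \<one>] by (simp add: I.I_l_closed)
qed

lemma cl_smult:
  assumes "r \<in> carrier R" "x \<in> carrier A" shows "r \<odot>\<^bsub>B\<^esub> cl x = cl (r \<odot> x)"
proof -
  interpret M: module R A by (rule module_A)
  \<comment> \<open>All cosets in the union that defines the scalar action coincide, so the union is
    a single coset.\<close>
  have eq: "cl (r \<odot> y) = cl (r \<odot> x)" if "y \<in> cl x" for y
  proof -
    have y: "y \<in> carrier A" using that assms A.a_r_coset_subset_G[OF I.a_subset] by blast
    have "cl y = cl x" using that assms(2) I.a_repr_independence' by auto
    then have "y \<ominus> x \<in> I" using y assms cl_eq_iff by blast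
    then have "r \<odot> (y \<ominus> x) \<in> I" using assms smult_mem by blast
    moreover have "r \<odot> (y \<ominus> x) = r \<odot> y \<ominus> r \<odot> x"
      using y assms by (simp add: A.minus_eq M.smult_r_distr M.smult_r_minus)
    ultimately show ?thesis using y assms by (subst cl_eq_iff) auto
  qed
  moreover have "x \<in> cl x" using assms(2) I.a_rcos_self by blast
  ultimately show ?thesis unfolding quotient_simps by blast
qed

text \<open>\<open>B\<close> is another record than \<open>A Quot I\<close>, so the ring laws are
  carried over operation by operation, while the laws for scalars are checked on
  representatives.\<close>

sublocale quot: k_algebra R B
proof -
  interpret M: module R A by (rule module_A)
  interpret Q: ring "A Quot I" by (rule I.quotient_is_ring)
  have "abelian_group B"
  proof (rule abelian_groupI)
    show "\<exists>y\<in>carrier B. y \<oplus>\<^bsub>B\<^esub> x = \<zero>\<^bsub>B\<^esub>" if "x \<in> carrier B" for x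
      using that Q.l_neg[of x] Q.a_inv_closed[of x] unfolding quotient_simps by blast
  qed (auto simp: quotient_simps Q.a_ac)
  moreover have "Group.monoid B"
    using Q.monoid_axioms unfolding Group.monoid_def by (simp add: quotient_simps)
  ultimately have ring: "ring B"
    by (rule ringI) (auto simp: quotient_simps Q.l_distr Q.r_distr)
  have "module R B"
  proof (rule moduleI)
    show "cring R" using field_R by (simp add: field_def domain_def)
    show "abelian_group B" by fact
  qed (auto simp: carrier_quotient cl_smult cl_add smult_closed_A M.smult_l_distr M.smult_r_distr M.smult_assoc1)
  then show "k_algebra R B"
    using ring field_R
    by (intro k_algebra.intro k_algebra_axioms.intro)
      (auto simp: carrier_quotient cl_smult cl_mult smult_closed_A smult_mult_left smult_mult_right)
qed

lemma cl_closed: "x \<in> carrier A \<Longrightarrow> cl x \<in> carrier B"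
  by (simp add: carrier_quotient)

text \<open>A morphism between residue classes of idempotents has a representative in the corner
  itself: replace any representative x by e_j x e_i.\<close>

lemma Mor_quotient_category:
  "Mor (algebra_category B V (\<lambda>v. cl (e v))) i j = cl ` Mor (algebra_category A V e) i j"
  if "e i \<in> carrier A" "e j \<in> carrier A"
  using that by (auto simp: algebra_category_def carrier_quotient cl_mult image_iff) (auto simp flip: cl_mult)

lemma k_category_quotient:
  assumes "\<And>v. v \<in> V \<Longrightarrow> e v \<in> carrier A" "\<And>v. v \<in> V \<Longrightarrow> e v \<otimes> e v = e v"
  shows "k_category R (algebra_category B V (\<lambda>v. cl (e v)))"
  using assms by (intro quot.k_category_algebra_category) (auto simp: cl_closed cl_mult)

end

section \<open>Completed path algebras\<close>

lemma finsum_pointwise: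
  fixes M :: "('c::comm_monoid_add, 'd \<Rightarrow> 'c, 'z) module_scheme"
  assumes "abelian_group M" "\<And>f g. f \<oplus>\<^bsub>M\<^esub> g = (\<lambda>x. f x + g x)" "\<zero>\<^bsub>M\<^esub> = (\<lambda>_. 0)"
    "\<And>i. i \<in> I \<Longrightarrow> f i \<in> carrier M" "finite I"
  shows "finsum M f I = (\<lambda>x. \<Sum>i\<in>I. f i x)"
proof -
  interpret M: abelian_group M by (rule assms(1))
  show ?thesis using assms(5,4)
    by (induction I rule: finite_induct) (auto simp: assms(2,3) M.finsum_insert Pi_iff)
qed

locale quiver = fin_digraph Q for Q :: "('v, 'e) pre_digraph"
begin

section \<open>Paths and their cuts\<close>

abbreviation tgt :: "('v, 'e) path \<Rightarrow> 'v" where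
  "tgt x \<equiv> awlast (fst x) (snd x)"

lemma paths_iff: "(u, p) \<in> paths Q \<longleftrightarrow> awalk u p (awlast u p)"
  by (auto simp: paths_def)

lemma paths_append_iff:
  "(u, p @ q) \<in> paths Q \<longleftrightarrow> (u, p) \<in> paths Q \<and> (awlast u p, q) \<in> paths Q"
  by (simp add: paths_iff awlast_append)

lemma paths_take_drop:
  "(u, p) \<in> paths Q \<longleftrightarrow> (u, take i p) \<in> paths Q \<and> (awlast u (take i p), drop i p) \<in> paths Q"
  using paths_append_iff[of u "take i p" "drop i p"] by simp

lemma awlast_take_drop: "awlast (awlast u (take i p)) (drop i p) = awlast u p"
  by (metis append_take_drop_id awlast_append)

lemma paths_Nil: "(u, []) \<in> paths Q \<longleftrightarrow> u \<in> verts Q"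
  by (simp add: paths_iff awalk_Nil_iff)

lemma paths_Cons: "(u, \<alpha> # p) \<in> paths Q \<longleftrightarrow> \<alpha> \<in> arcs Q \<and> u = tail Q \<alpha> \<and> (head Q \<alpha>, p) \<in> paths Q"
  by (simp add: paths_iff awalk_Cons_iff)

lemma paths_ends:
  assumes "x \<in> paths Q" shows "fst x \<in> verts Q" "tgt x \<in> verts Q"
  using assms awalk_hd_in_verts awalk_last_in_verts by (cases x; auto simp: paths_iff)+

lemma paths_arcs: "(u, p) \<in> paths Q \<Longrightarrow> set p \<subseteq> arcs Q"
  by (auto simp: paths_iff awalk_def)

text \<open>Makes truncations of series finite combinations of paths, and the fibres over paths of
  the orbit quiver finite.\<close>

lemma finite_paths: "finite {x \<in> paths Q. length (snd x) < n}"
proof (rule finite_subset)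
  show "{x \<in> paths Q. length (snd x) < n} \<subseteq> verts Q \<times> {p. set p \<subseteq> arcs Q \<and> length p \<le> n}"
    by (auto dest: paths_arcs) (use paths_ends(1) in force)
  show "finite (verts Q \<times> {p. set p \<subseteq> arcs Q \<and> length p \<le> n})"
    by (simp add: finite_lists_length_le)
qed

section \<open>The convolution product of series\<close>

abbreviation A :: "('k::field, ('v, 'e) path \<Rightarrow> 'k) module" where
  "A \<equiv> path_algebra Q"

lemma carrier_path_algebra: "f \<in> carrier A \<longleftrightarrow> (\<forall>x. f x \<noteq> 0 \<longrightarrow> x \<in> paths Q)"
  by (auto simp: path_algebra_def)

lemma path_algebra_mult:
  "(f \<otimes>\<^bsub>A\<^esub> g) (u, p) = (if (u, p) \<in> paths Q
    then \<Sum>i\<le>length p. f (awlast u (take i p), drop i p) * g (u, take i p) else 0)"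
  by (simp add: path_algebra_def)

lemma path_algebra_simps:
  "\<zero>\<^bsub>A\<^esub> = (\<lambda>_. 0)" "f \<oplus>\<^bsub>A\<^esub> g = (\<lambda>x. f x + g x)" "r \<odot>\<^bsub>A\<^esub> f = (\<lambda>x. r * f x)"
  by (simp_all add: path_algebra_def)

lemma path_algebra_one: "\<one>\<^bsub>A\<^esub> (u, p) = (if u \<in> verts Q \<and> p = [] then 1 else 0)"
  by (simp add: path_algebra_def)

lemma mult_closed:
  fixes f g :: "('v, 'e) path \<Rightarrow> 'k::field"
  shows "f \<otimes>\<^bsub>A\<^esub> g \<in> carrier A"
  by (auto simp: carrier_path_algebra path_algebra_mult split: if_splits)

lemma path_algebra_mult_assoc:
  fixes f g h :: "('v, 'e) path \<Rightarrow> 'k::field"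
  shows "(f \<otimes>\<^bsub>A\<^esub> g) \<otimes>\<^bsub>A\<^esub> h = f \<otimes>\<^bsub>A\<^esub> (g \<otimes>\<^bsub>A\<^esub> h)"
proof
  fix x :: "('v, 'e) path"
  obtain u p where x: "x = (u, p)" by (cases x)
  show "((f \<otimes>\<^bsub>A\<^esub> g) \<otimes>\<^bsub>A\<^esub> h) x = (f \<otimes>\<^bsub>A\<^esub> (g \<otimes>\<^bsub>A\<^esub> h)) x"
  proof (cases "x \<in> paths Q")
    case True
    let ?n = "length p"
    define t where "t i = awlast u (take i p)" for i
    \<comment> \<open>The term of a double cut: h takes the first i arrows, g the next j, and f the
      rest.\<close>
    define F where "F i j = f (t (i + j), drop (i + j) p) * g (t i, take j (drop i p)) * h (u, take i p)" for i j
    have "((f \<otimes>\<^bsub>A\<^esub> g) \<otimes>\<^bsub>A\<^esub> h) x = (\<Sum>i\<le>?n. \<Sum>j\<le>?n - i. F i j)"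
    proof -
      have "(f \<otimes>\<^bsub>A\<^esub> g) (t i, drop i p) * h (u, take i p) = (\<Sum>j\<le>?n - i. F i j)" if "i \<le> ?n" for i
      proof -
        have "(t i, drop i p) \<in> paths Q" 
          using True paths_take_drop[of u p i] by (simp add: x t_def)
        moreover have "awlast (t i) (take j (drop i p)) = t (i + j)" for j
          unfolding t_def by (simp add: take_add awlast_append)
        ultimately show ?thesis
          by (simp add: path_algebra_mult F_def sum_distrib_right add.commute)
      qed
      then show ?thesis using True by (simp add: x path_algebra_mult t_def)
    qed
    \<comment> \<open>Substitution k = i + j. Here k is the position of the second cut, which is the
      one that the other bracketing makes first.\<close>
    also have "\<dots> = (\<Sum>k\<le>?n. \<Sum>i\<le>k. F i (k - i))"
      by (subst sum.triangle_reindex_eq[symmetric], subst sum.Sigma)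
        (auto intro!: sum.cong simp: Sigma_def)
    also have "\<dots> = (f \<otimes>\<^bsub>A\<^esub> (g \<otimes>\<^bsub>A\<^esub> h)) x"
    proof -
      have "f (t k, drop k p) * (g \<otimes>\<^bsub>A\<^esub> h) (u, take k p) = (\<Sum>i\<le>k. F i (k - i))" if "k \<le> ?n" for k
      proof -
        have "(u, take k p) \<in> paths Q" using True paths_take_drop[of u p k] by (simp add: x)
        then show ?thesis using that
          by (simp add: path_algebra_mult F_def sum_distrib_left t_def min_def mult.assoc drop_take)
      qed
      then show ?thesis using True by (simp add: x path_algebra_mult t_def)
    qed
    finally show ?thesis .
  qed (simp add: x path_algebra_mult)
qed

text \<open>Only the cut at the very end leaves a trivial path for the left factor, so a trivial
  path on the left selects paths by target; dually, one on the right selects by source.\<close>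

lemma vertex_mult:
  assumes f: "f \<in> carrier A"
  shows "vertex_elem v \<otimes>\<^bsub>A\<^esub> f = (\<lambda>x. if tgt x = v then f x else 0)"
proof
  fix x :: "('v, 'e) path"
  obtain u p where x: "x = (u, p)" by (cases x)
  have "(\<Sum>i\<le>length p. (path_elem (v, []) (awlast u (take i p), drop i p) :: 'a) * f (u, take i p))
      = (\<Sum>i\<le>length p. if i = length p then (if awlast u p = v then f (u, p) else 0) else 0)"
    by (intro sum.cong) (auto simp: path_elem_def)
  then show "(vertex_elem v \<otimes>\<^bsub>A\<^esub> f) x = (if tgt x = v then f x else 0)"
    using f by (auto simp: x path_algebra_mult carrier_path_algebra)
qed

lemma mult_vertex:
  assumes f: "f \<in> carrier A"
  shows "f \<otimes>\<^bsub>A\<^esub> vertex_elem v = (\<lambda>x. if fst x = v then f x else 0)"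
proof
  fix x :: "('v, 'e) path"
  obtain u p where x: "x = (u, p)" by (cases x)
  have "(\<Sum>i\<le>length p. f (awlast u (take i p), drop i p) * (path_elem (v, []) (u, take i p) :: 'a))
      = (\<Sum>i\<le>length p. if i = 0 then (if u = v then f (u, p) else 0) else 0)"
    by (intro sum.cong) (auto simp: path_elem_def)
  then show "(f \<otimes>\<^bsub>A\<^esub> vertex_elem v) x = (if fst x = v then f x else 0)"
    using f by (auto simp: x path_algebra_mult carrier_path_algebra)
qed

lemma one_mult:
  assumes f: "f \<in> carrier A"
  shows "\<one>\<^bsub>A\<^esub> \<otimes>\<^bsub>A\<^esub> f = f"
proof
  fix x :: "('v, 'e) path"
  obtain u p where x: "x = (u, p)" by (cases x)
  have "(\<Sum>i\<le>length p. (\<one>\<^bsub>A\<^esub> (awlast u (take i p), drop i p) :: 'a) * f (u, take i p))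
      = (\<Sum>i\<le>length p. if i = length p then f (u, p) else 0)" if "(u, p) \<in> paths Q"
    using paths_ends(2)[OF that] by (intro sum.cong) (auto simp: path_algebra_one)
  then show "(\<one>\<^bsub>A\<^esub> \<otimes>\<^bsub>A\<^esub> f) x = f x"
    using f by (auto simp: x path_algebra_mult carrier_path_algebra)
qed

lemma mult_one:
  assumes f: "f \<in> carrier A"
  shows "f \<otimes>\<^bsub>A\<^esub> \<one>\<^bsub>A\<^esub> = f"
proof
  fix x :: "('v, 'e) path"
  obtain u p where x: "x = (u, p)" by (cases x)
  have "(\<Sum>i\<le>length p. f (awlast u (take i p), drop i p) * (\<one>\<^bsub>A\<^esub> (u, take i p) :: 'a))
      = (\<Sum>i\<le>length p. if i = 0 then f (u, p) else 0)" if "(u, p) \<in> paths Q"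
    using paths_ends(1)[OF that] by (intro sum.cong) (auto simp: path_algebra_one)
  then show "(f \<otimes>\<^bsub>A\<^esub> \<one>\<^bsub>A\<^esub>) x = f x"
    using f by (auto simp: x path_algebra_mult carrier_path_algebra)
qed

lemma abelian_group_A: "abelian_group (A :: ('k::field, ('v, 'e) path \<Rightarrow> 'k) module)"
proof (rule abelian_groupI)
  show "\<exists>y\<in>carrier A. y \<oplus>\<^bsub>A\<^esub> x = \<zero>\<^bsub>A\<^esub>" if "x \<in> carrier A" for x :: "('v, 'e) path \<Rightarrow> 'k"
    using that by (intro bexI[of _ "\<lambda>z. - x z"]) (auto simp: path_algebra_simps carrier_path_algebra)
qed (auto simp: path_algebra_simps carrier_path_algebra add_ac, (metis add_0)+)

lemma k_algebra_A: "k_algebra ring_of_type_algebra (A :: ('k::field, ('v, 'e) path \<Rightarrow> 'k) module)"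
proof -
  \<comment> \<open>The test for being a path is moved inside the sum, so that the distributive and
    scalar laws hold term by term.\<close>
  have mult: "(f \<otimes>\<^bsub>A\<^esub> g) x = (\<Sum>i\<le>length (snd x). if x \<in> paths Q
      then f (awlast (fst x) (take i (snd x)), drop i (snd x)) * g (fst x, take i (snd x)) else 0)"
    for f g :: "('v, 'e) path \<Rightarrow> 'k" and x
    by (cases x) (simp add: path_algebra_mult)
  have ring: "ring (A :: ('k, ('v, 'e) path \<Rightarrow> 'k) module)"
  proof (rule ringI)
    show "Group.monoid (A :: ('k, ('v, 'e) path \<Rightarrow> 'k) module)"
      by (rule monoidI) (auto simp: mult_closed path_algebra_mult_assoc one_mult mult_one,
          auto simp: carrier_path_algebra path_algebra_one paths_Nil split: if_splits)
  qed (auto simp: abelian_group_A path_algebra_simps mult fun_eq_iff algebra_simps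
      sum.distrib[symmetric] intro!: sum.cong)
  have mod: "module ring_of_type_algebra (A :: ('k, ('v, 'e) path \<Rightarrow> 'k) module)"
    by (rule moduleI) (auto simp: abelian_group_A path_algebra_simps carrier_path_algebra
        ring_of_type_algebra_def[where 'a='k] algebra_simps
        cring_from_type_algebra[unfolded ring_of_type_algebra_def])
  show ?thesis
    using ring mod field_from_type_algebra
    by (intro k_algebra.intro k_algebra_axioms.intro)
      (auto simp: path_algebra_simps mult fun_eq_iff sum_distrib_left intro!: sum.cong)
qed

sublocale A: k_algebra ring_of_type_algebra "A :: ('k::field, ('v, 'e) path \<Rightarrow> 'k) module"
  by (rule k_algebra_A)

lemma vertex_elem_closed: "v \<in> verts Q \<Longrightarrow> vertex_elem v \<in> carrier A"
  by (auto simp: carrier_path_algebra path_elem_def paths_Nil split: if_splits)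

lemma vertex_elem_idem: "v \<in> verts Q \<Longrightarrow> vertex_elem v \<otimes>\<^bsub>A\<^esub> vertex_elem v = (vertex_elem v :: _ \<Rightarrow> 'k::field)"
  by (simp add: vertex_mult[OF vertex_elem_closed]) (auto simp: path_elem_def)

section \<open>Hom spaces as series with prescribed ends\<close>

abbreviation PC :: "('v, 'k::field, ('v, 'e) path \<Rightarrow> 'k) kcat" where
  "PC \<equiv> path_category Q"

lemma Mor_path_category:
  assumes "a \<in> verts Q" "b \<in> verts Q"
  shows "f \<in> Mor PC a b \<longleftrightarrow> (\<forall>x. f x \<noteq> 0 \<longrightarrow> x \<in> paths Q \<and> fst x = a \<and> tgt x = b)"
proof -
  have "f \<in> Mor PC a b \<longleftrightarrow> f \<in> carrier A \<and> vertex_elem b \<otimes>\<^bsub>A\<^esub> f = f \<and> f \<otimes>\<^bsub>A\<^esub> vertex_elem a = f"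
    unfolding path_category_def using assms
    by (subst A.Mor_algebra_category) (auto simp: vertex_elem_closed vertex_elem_idem)
  also have "\<dots> \<longleftrightarrow> f \<in> carrier A \<and> (\<forall>x. tgt x \<noteq> b \<longrightarrow> f x = 0) \<and> (\<forall>x. fst x \<noteq> a \<longrightarrow> f x = 0)"
    by (cases "f \<in> carrier A") (auto simp add: vertex_mult mult_vertex fun_eq_iff)
  also have "\<dots> \<longleftrightarrow> (\<forall>x. f x \<noteq> 0 \<longrightarrow> x \<in> paths Q \<and> fst x = a \<and> tgt x = b)"
    unfolding carrier_path_algebra by blast
  finally show ?thesis .
qed

lemma path_category_simps:
  "Obj PC = verts Q" "cmp PC = (\<otimes>\<^bsub>A\<^esub>)" "idn PC = vertex_elem"
  "\<zero>\<^bsub>Hom PC a b\<^esub> = (\<lambda>_. 0)" "f \<oplus>\<^bsub>Hom PC a b\<^esub> g = (\<lambda>x. f x + g x)" "r \<odot>\<^bsub>Hom PC a b\<^esub> f = (\<lambda>x. r * f x)"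
  by (simp_all add: path_category_def algebra_category_def path_algebra_simps)

lemma k_category_PC: "k_category ring_of_type_algebra (PC :: ('v, 'k::field, ('v, 'e) path \<Rightarrow> 'k) kcat)"
  unfolding path_category_def
  by (intro A.k_category_algebra_category) (auto simp: vertex_elem_closed vertex_elem_idem)

sublocale PC: k_category ring_of_type_algebra "PC :: ('v, 'k::field, ('v, 'e) path \<Rightarrow> 'k) kcat"
  by (rule k_category_PC)

lemma finsum_PC:
  assumes "a \<in> verts Q" "b \<in> verts Q" "\<And>i. i \<in> I \<Longrightarrow> f i \<in> Mor PC a b" "finite I"
  shows "finsum (Hom PC a b) f I = (\<lambda>x. \<Sum>i\<in>I. f i x)"
  using assms PC.abelian_group_Hom by (intro finsum_pointwise) (auto simp: path_category_simps)

text \<open>The Peirce component e_b f e_a (\<open>restr_eq\<close>), given coefficientwise so that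
  it makes sense for every function on paths.\<close>

definition restr :: "'v \<Rightarrow> 'v \<Rightarrow> (('v, 'e) path \<Rightarrow> 'k::field) \<Rightarrow> ('v, 'e) path \<Rightarrow> 'k" where
  "restr a b f = (\<lambda>x. if fst x = a \<and> tgt x = b then f x else 0)"

lemma restr_in_Mor: "f \<in> carrier A \<Longrightarrow> a \<in> verts Q \<Longrightarrow> b \<in> verts Q \<Longrightarrow> restr a b f \<in> Mor PC a b"
  by (auto simp: Mor_path_category restr_def carrier_path_algebra)

lemma Mor_carrier: "a \<in> verts Q \<Longrightarrow> b \<in> verts Q \<Longrightarrow> f \<in> Mor PC a b \<Longrightarrow> f \<in> carrier A"
  by (auto simp: Mor_path_category carrier_path_algebra)

lemma restr_eq: "f \<in> carrier A \<Longrightarrow> restr a b f = vertex_elem b \<otimes>\<^bsub>A\<^esub> (f \<otimes>\<^bsub>A\<^esub> vertex_elem a)"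
  by (auto simp: mult_vertex vertex_mult restr_def carrier_path_algebra fun_eq_iff)

text \<open>A cut of a path from a to b passes through exactly one vertex c, so components multiply
  like matrices indexed by the vertices.\<close>

lemma restr_mult:
  fixes f g :: "('v, 'e) path \<Rightarrow> 'k::field"
  shows "restr a b (f \<otimes>\<^bsub>A\<^esub> g) = (\<lambda>x. \<Sum>c\<in>verts Q. (restr c b f \<otimes>\<^bsub>A\<^esub> restr a c g) x)"
proof
  fix x :: "('v, 'e) path"
  obtain u p where x: "x = (u, p)" by (cases x)
  show "restr a b (f \<otimes>\<^bsub>A\<^esub> g) x = (\<Sum>c\<in>verts Q. (restr c b f \<otimes>\<^bsub>A\<^esub> restr a c g) x)"
  proof (cases "x \<in> paths Q")
    case True
    have v: "awlast u (take i p) \<in> verts Q" for i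
      using True paths_take_drop[of u p i] paths_ends(2)[of "(u, take i p)"] by (simp add: x)
    have "(\<Sum>c\<in>verts Q. (restr c b f \<otimes>\<^bsub>A\<^esub> restr a c g) x)
      = (\<Sum>c\<in>verts Q. \<Sum>i\<le>length p. if awlast u (take i p) = c then
          (if u = a \<and> awlast u p = b then f (awlast u (take i p), drop i p) * g (u, take i p) else 0) else 0)"
      using True by (intro sum.cong refl)
        (auto simp: x path_algebra_mult restr_def awlast_take_drop intro!: sum.cong)
    also have "\<dots> = (\<Sum>i\<le>length p. if u = a \<and> awlast u p = b
        then f (awlast u (take i p), drop i p) * g (u, take i p) else 0)"
      using v by (subst sum.swap) simp
    also have "\<dots> = restr a b (f \<otimes>\<^bsub>A\<^esub> g) x"
      using True by (cases "u = a \<and> awlast u p = b") (simp_all add: x path_algebra_mult restr_def cong: if_cong conj_cong)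
    finally show ?thesis ..
  qed (auto simp add: x path_algebra_mult restr_def)
qed

lemma restr_sum: "f \<in> carrier A \<Longrightarrow> f = (\<lambda>x. \<Sum>a\<in>verts Q. \<Sum>b\<in>verts Q. restr a b f x)"
proof
  fix x assume f: "f \<in> carrier A"
  have "(\<Sum>a\<in>verts Q. \<Sum>b\<in>verts Q. restr a b f x) = (\<Sum>a\<in>verts Q. if a = fst x then
      (\<Sum>b\<in>verts Q. if b = tgt x then f x else 0) else 0)"
    by (intro sum.cong refl) (auto simp: restr_def)
  also have "\<dots> = f x"
    using f paths_ends[of x] unfolding carrier_path_algebra
    by (cases "x \<in> paths Q") (auto simp del: split_paired_All)
  finally show "f x = (\<Sum>a\<in>verts Q. \<Sum>b\<in>verts Q. restr a b f x)" ..
qed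

text \<open>A trivial path can only be cut into trivial paths. A constant term of the composite thus
  needs one of f, and a trivial path from a to b forces a = b.\<close>

lemma cmp_eq_idn_imp_vertex_eq:
  assumes "a \<in> verts Q" "b \<in> verts Q" "f \<in> Mor PC a b"
    and "(g \<otimes>\<^bsub>A\<^esub> f) (a, []) \<noteq> 0"
  shows "a = b"
proof -
  have "f (a, []) \<noteq> 0" using assms(4) by (auto simp: path_algebra_mult split: if_splits)
  then show ?thesis using assms(3) unfolding Mor_path_category[OF assms(1,2)]
    by (elim allE[of _ "(a, [])"]) simp
qed

lemma skeletal_PC: "skeletal (PC :: ('v, 'k::field, ('v, 'e) path \<Rightarrow> 'k) kcat)"
  unfolding skeletal_def path_category_simps
proof (intro ballI impI)
  fix a b assume ab: "a \<in> verts Q" "b \<in> verts Q"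
    and "\<exists>f\<in>Mor (PC :: ('v, 'k, _) kcat) a b. \<exists>g\<in>Mor PC b a. g \<otimes>\<^bsub>A\<^esub> f = vertex_elem a \<and> f \<otimes>\<^bsub>A\<^esub> g = vertex_elem b"
  then obtain f g where "f \<in> Mor (PC :: ('v, 'k, _) kcat) a b" "g \<otimes>\<^bsub>A\<^esub> f = vertex_elem a" by blast
  then show "a = b" using ab cmp_eq_idn_imp_vertex_eq[of a b f g] by (simp add: path_elem_def)
qed

end

section \<open>Closed ideals\<close>

text \<open>Closure under negatives is left multiplication by -1.\<close>

lemma (in ring) ideal_of_closed_set:
  assumes "S \<subseteq> carrier R" "\<zero> \<in> S" "\<And>x y. x \<in> S \<Longrightarrow> y \<in> S \<Longrightarrow> x \<oplus> y \<in> S"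
    and left: "\<And>x a. x \<in> S \<Longrightarrow> a \<in> carrier R \<Longrightarrow> a \<otimes> x \<in> S"
    and "\<And>x a. x \<in> S \<Longrightarrow> a \<in> carrier R \<Longrightarrow> x \<otimes> a \<in> S"
  shows "ideal S R"
proof (rule idealI)
  have "\<ominus> x \<in> S" if "x \<in> S" for x
    using left[OF that, of "\<ominus> \<one>"] that assms(1) by (auto simp: l_minus)
  then show "subgroup S (add_monoid R)"
    using assms by (intro add.subgroupI) auto
qed (use assms ring_axioms in auto)

context quiver
begin

text \<open>Congruence modulo the n-th power \<open>M\<^sub>n\<close> of the arrow ideal; its
  classes are the basic neighbourhoods of the adic topology.\<close>

definition agree :: "nat \<Rightarrow> (('v, 'e) path \<Rightarrow> 'k::field) \<Rightarrow> (('v, 'e) path \<Rightarrow> 'k) \<Rightarrow> bool" where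
  "agree n f g \<longleftrightarrow> (\<forall>x. length (snd x) < n \<longrightarrow> g x = f x)"

lemma openin_adic: "openin (adic_topology Q) = adic_open Q"
  unfolding adic_topology_def by (rule topology_inverse'[OF istopology_adic_open])

lemma topspace_adic: "topspace (adic_topology Q) = carrier A"
proof -
  have "adic_open Q (carrier A)" by (simp add: adic_open_def)
  moreover have "T \<subseteq> carrier A" if "adic_open Q T" for T
    using that by (simp add: adic_open_def)
  ultimately show ?thesis unfolding topspace_def openin_adic by blast
qed

lemma adic_open_ball: "f \<in> carrier A \<Longrightarrow> adic_open Q {g \<in> carrier A. agree n f g}"
  by (auto simp: adic_open_def agree_def intro!: exI[of _ n])

lemma in_adic_closure:
  "f \<in> adic_topology Q closure_of S \<longleftrightarrow> f \<in> carrier A \<and> (\<forall>n. \<exists>h\<in>S \<inter> carrier A. agree n f h)"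
  (is "?L \<longleftrightarrow> ?R")
proof
  assume L: ?L
  then have f: "f \<in> carrier A" by (simp add: in_closure_of topspace_adic)
  have "\<exists>h\<in>S \<inter> carrier A. agree n f h" for n
  proof -
    have "f \<in> {g \<in> carrier A. agree n f g}" using f by (simp add: agree_def)
    moreover have "\<forall>T. f \<in> T \<and> adic_open Q T \<longrightarrow> (\<exists>y. y \<in> S \<and> y \<in> T)"
      using L unfolding in_closure_of openin_adic by (rule conjunct2)
    ultimately have "\<exists>y. y \<in> S \<and> y \<in> {g \<in> carrier A. agree n f g}"
      using adic_open_ball[OF f, of n] by (elim allE impE) (rule conjI)
    then show ?thesis by blast
  qed
  then show ?R using f by blast
next
  assume R: ?R
  show ?L unfolding in_closure_of openin_adic topspace_adic
  proof (intro conjI allI impI)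
    fix T assume T: "f \<in> T \<and> adic_open Q T"
    then obtain n where "\<forall>g\<in>carrier A. agree n f g \<longrightarrow> g \<in> T"
      unfolding adic_open_def agree_def by blast
    then show "\<exists>y. y \<in> S \<and> y \<in> T" using R by blast
  qed (use R in simp)
qed

text \<open>Closedness is phrased by congruences, so that it can be tested one precision n at a
  time.\<close>

definition closed_ideal :: "(('v, 'e) path \<Rightarrow> 'k::field) set \<Rightarrow> bool" where
  "closed_ideal I \<longleftrightarrow> ideal I A \<and> (\<forall>f\<in>carrier A. (\<forall>n. \<exists>h\<in>I. agree n f h) \<longrightarrow> f \<in> I)"

text \<open>A coefficient of a product at x involves only segments of x, and these are no longer
  than x.\<close>

lemma agree_mult:
  assumes "agree n f f'" "agree n g g'"
  shows "agree n (f \<otimes>\<^bsub>A\<^esub> g) (f' \<otimes>\<^bsub>A\<^esub> g')"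
  unfolding agree_def
proof (intro allI impI)
  fix x :: "('v, 'e) path" assume x: "length (snd x) < n"
  obtain u p where up: "x = (u, p)" by (cases x)
  have "f' (awlast u (take i p), drop i p) = f (awlast u (take i p), drop i p)"
    "g' (u, take i p) = g (u, take i p)" if "i \<le> length p" for i
    using assms x that by (auto simp: agree_def up)
  then show "(f' \<otimes>\<^bsub>A\<^esub> g') x = (f \<otimes>\<^bsub>A\<^esub> g) x" by (simp add: up path_algebra_mult)
qed

lemma agree_refl: "agree n f f"
  by (simp add: agree_def)

lemma agree_add: "agree n f f' \<Longrightarrow> agree n g g' \<Longrightarrow> agree n (f \<oplus>\<^bsub>A\<^esub> g) (f' \<oplus>\<^bsub>A\<^esub> g')"
  by (simp add: agree_def path_algebra_simps)

lemma agree_trans: "agree n f g \<Longrightarrow> agree n g h \<Longrightarrow> agree n f h"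
  by (simp add: agree_def)

text \<open>Sums and products respect congruences, so approximations of the factors approximate the
  result. The closure is itself closed because congruence is transitive.\<close>

lemma closed_ideal_closure:
  fixes I :: "(('v, 'e) path \<Rightarrow> 'k::field) set"
  assumes "ideal I A"
  shows "closed_ideal (adic_topology Q closure_of I)" (is "closed_ideal ?J")
proof -
  interpret I: ideal I A by (rule assms)
  have J: "f \<in> ?J \<longleftrightarrow> f \<in> carrier A \<and> (\<forall>n. \<exists>h\<in>I. agree n f h)" for f
    using I.a_subset by (auto simp: in_adic_closure) blast
  have "ideal ?J A"
  proof (rule A.A.ideal_of_closed_set)
    show "\<zero>\<^bsub>A\<^esub> \<in> ?J" unfolding J using I.zero_closed agree_refl by blast
    show "f \<oplus>\<^bsub>A\<^esub> g \<in> ?J" if "f \<in> ?J" "g \<in> ?J" for f g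
      using that I.a_closed agree_add unfolding J by (meson A.A.a_closed)
    show "a \<otimes>\<^bsub>A\<^esub> f \<in> ?J" if "f \<in> ?J" "a \<in> carrier A" for f a
      using that I.I_l_closed agree_mult[OF agree_refl] unfolding J by (meson mult_closed)
    show "f \<otimes>\<^bsub>A\<^esub> a \<in> ?J" if "f \<in> ?J" "a \<in> carrier A" for f a
      using that I.I_r_closed agree_mult[OF _ agree_refl] unfolding J by (meson mult_closed)
  qed (auto simp: J)
  moreover have "f \<in> ?J" if f: "f \<in> carrier A" "\<forall>n. \<exists>h\<in>?J. agree n f h" for f
    unfolding J
  proof (intro conjI allI f(1))
    fix n
    obtain h where "h \<in> ?J" "agree n f h" using f(2) by blast
    then show "\<exists>h\<in>I. agree n f h" unfolding J using agree_trans by blast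
  qed
  ultimately show ?thesis unfolding closed_ideal_def by blast
qed

end

section \<open>Cyclic derivatives\<close>

lemma cyc_class_refl: "p \<in> cyc_class p"
  unfolding cyc_class_def by (auto intro: exI[of _ 0])

text \<open>The inverse rotation needs a natural exponent; reducing j modulo the length keeps the
  difference from being cut off at 0.\<close>

lemma rotate_back: "rotate (length p - j mod length p) (rotate j p) = p"
proof (cases "p = []")
  case False
  then have "(length p - j mod length p + j) mod length p = 0"
    by (metis add.commute add_diff_inverse_nat length_greater_0_conv less_imp_not_less mod_add_left_eq
        mod_less_divisor mod_self)
  then show ?thesis by (metis rotate_rotate rotate_conv_mod rotate0 id_apply)
qed simp

lemma cyc_class_eq: "q \<in> cyc_class p \<Longrightarrow> cyc_class q = cyc_class p"
proof -
  have sub: "cyc_class (rotate i p) \<subseteq> cyc_class p" for i and p :: "'e list"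
    by (auto simp: cyc_class_def rotate_rotate)
  assume "q \<in> cyc_class p"
  then obtain i where q: "q = rotate i p" by (auto simp: cyc_class_def)
  show ?thesis using sub[of i p] sub[of "length p - i mod length p" "rotate i p"] by (simp add: q rotate_back)
qed

text \<open>For nonempty p this is the order of its stabilizer in the cyclic group of rotations,
  that is, the exponent e in p = q^e with q primitive.\<close>

definition period_count :: "'e list \<Rightarrow> nat" where
  "period_count p = card {i. i < length p \<and> rotate i p = p}"

lemma bij_betw_shift_mod: "bij_betw (\<lambda>i. (i + j) mod n) {..<n} {..<n::nat}"
proof (cases "n = 0")
  case False
  have "inj_on (\<lambda>i. (i + j) mod n) {..<n}"
  proof (rule linorder_inj_onI)
    fix x y assume "x < y" "x \<in> {..<n}" "y \<in> {..<n}"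
    moreover have "n dvd (y + j) - (x + j)" if "(x + j) mod n = (y + j) mod n"
      using that \<open>x < y\<close> mod_eq_dvd_iff_nat[of "x + j" "y + j" n] by simp
    ultimately show "(x + j) mod n \<noteq> (y + j) mod n"
      using dvd_imp_le[of n "y - x"] by auto
  qed auto
  then show ?thesis using False endo_inj_surj[of "{..<n}"] by (auto simp: bij_betw_def image_subset_iff)
qed (simp add: bij_betw_def)

text \<open>Allows rotations to be counted from another base point of the same cycle.\<close>

lemma card_shift_mod:
  fixes n j :: nat
  shows "card {i. i < n \<and> P ((i + j) mod n)} = card {i. i < n \<and> P i}"
proof (rule bij_betw_same_card)
  let ?f = "\<lambda>i. (i + j) mod n"
  have inj: "inj_on ?f {..<n}" and im: "?f ` {..<n} = {..<n}"
    using bij_betw_shift_mod[of j n] by (simp_all add: bij_betw_def)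
  have "{i. i < n \<and> P i} \<subseteq> ?f ` {i. i < n \<and> P (?f i)}"
  proof
    fix k assume k: "k \<in> {i. i < n \<and> P i}"
    then have "k \<in> ?f ` {..<n}" unfolding im by simp
    then show "k \<in> ?f ` {i. i < n \<and> P (?f i)}" using k by auto
  qed
  moreover have "inj_on ?f {i. i < n \<and> P (?f i)}" using inj by (rule inj_on_subset) auto
  ultimately show "bij_betw ?f {i. i < n \<and> P (?f i)} {i. i < n \<and> P i}"
    by (auto simp: bij_betw_def)
qed

text \<open>The rotations that take p to q, if there are any, form a coset of those that fix
  q.\<close>

lemma card_rotations:
  "card {i. i < length p \<and> rotate i p = q} = (if q \<in> cyc_class p then period_count q else 0)"
proof (cases "q \<in> cyc_class p")
  case True
  then have "p \<in> cyc_class q" using cyc_class_eq cyc_class_refl by blast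
  then obtain j where p: "p = rotate j q" by (auto simp: cyc_class_def)
  have "{i. i < length p \<and> rotate i p = q} = {i. i < length q \<and> rotate ((i + j) mod length q) q = q}"
    by (simp add: p rotate_rotate flip: rotate_conv_mod)
  then show ?thesis using True card_shift_mod[of "length q" "\<lambda>i. rotate i q = q" j]
    by (simp add: period_count_def)
next
  case False
  then have "{i. i < length p \<and> rotate i p = q} = {}" by (auto simp: cyc_class_def)
  then show ?thesis using False by simp
qed

text \<open>Deleting \<alpha> at position i leaves r exactly when the rotation of p by i is \<alpha>
  followed by r. The coefficient of r therefore counts rotations, which also makes it independent of
  the representative of the class.\<close>

lemma cycle_deriv_eq:
  "cycle_deriv Q \<alpha> p (u, r) = (if u = head Q \<alpha> \<and> \<alpha> # r \<in> cyc_class p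
    then of_nat (period_count (\<alpha> # r)) else (0::'k::field))"
proof -
  let ?S = "{i. i < length p \<and> p ! i = \<alpha>}"
  have rot: "rotate i p = p ! i # drop (Suc i) p @ take i p" if "i < length p" for i
    using that by (simp add: rotate_drop_take Cons_nth_drop_Suc flip: append_Cons)
  have "cycle_deriv Q \<alpha> p (u, r)
    = (\<Sum>i\<in>?S. if u = head Q \<alpha> \<and> rotate i p = \<alpha> # r then 1 else (0::'k))"
    unfolding cycle_deriv_def path_elem_def by (intro sum.cong) (auto simp: rot)
  also have "\<dots> = of_nat (card {i \<in> ?S. u = head Q \<alpha> \<and> rotate i p = \<alpha> # r})"
    by (subst sum.inter_filter[symmetric]) auto
  also have "{i \<in> ?S. u = head Q \<alpha> \<and> rotate i p = \<alpha> # r}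
    = (if u = head Q \<alpha> then {i. i < length p \<and> rotate i p = \<alpha> # r} else {})"
    by (auto simp: rot)
  finally show ?thesis by (auto simp: card_rotations)
qed

context quiver
begin

lemma rotate_cycles: "p \<in> cycles Q \<Longrightarrow> rotate i p \<in> cycles Q"
proof (induction i)
  case (Suc i)
  then obtain u where u: "awalk u (rotate i p) u" "rotate i p \<noteq> []" by (auto simp: cycles_def)
  then obtain a q where aq: "rotate i p = a # q" by (cases "rotate i p") auto
  have "awalk (head Q a) (q @ [a]) (head Q a)"
    using u(1) unfolding aq awalk_append_iff awalk_Cons_iff
    by (auto simp: awalk_Nil_iff awalk_Cons_iff)
  then show ?case unfolding rotate_Suc aq by (auto simp: cycles_def)
qed simp

lemma cyc_class_cycles: "p \<in> cycles Q \<Longrightarrow> q \<in> cyc_class p \<Longrightarrow> q \<in> cycles Q"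
  using rotate_cycles by (auto simp: cyc_class_def)

lemma cyc_mem: "c \<in> cyc Q \<Longrightarrow> p \<in> c \<Longrightarrow> p \<in> cycles Q \<and> c = cyc_class p"
proof -
  assume "c \<in> cyc Q" and p: "p \<in> c"
  then obtain q where q: "q \<in> cycles Q" "c = cyc_class q" by (auto simp: cyc_def)
  then show ?thesis using p cyc_class_cycles cyc_class_eq[of p q] by blast
qed

lemma cyc_deriv_eq:
  assumes "c \<in> cyc Q"
  shows "cyc_deriv Q \<alpha> c (u, r) = (if u = head Q \<alpha> \<and> \<alpha> # r \<in> c
    then of_nat (period_count (\<alpha> # r)) else (0::'k::field))"
proof -
  have "\<exists>p. p \<in> c" using assms cyc_class_refl by (auto simp: cyc_def)
  then have "(SOME p. p \<in> c) \<in> c" by (rule someI_ex)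
  then have "c = cyc_class (SOME p. p \<in> c)" using assms cyc_mem by blast
  then show ?thesis by (simp add: cyc_deriv_def cycle_deriv_eq)
qed

lemma potential_deriv_eq:
  fixes W :: "'e list set \<Rightarrow> 'k::field"
  shows "potential_deriv Q W \<alpha> (u, r) = (if u = head Q \<alpha> \<and> \<alpha> # r \<in> cycles Q
    then W (cyc_class (\<alpha> # r)) * of_nat (period_count (\<alpha> # r)) else 0)"
proof -
  let ?S = "{c \<in> cyc Q. cyc_deriv Q \<alpha> c (u, r) \<noteq> (0::'k)}"
  let ?c = "cyc_class (\<alpha> # r)"
  have S: "c = ?c \<and> \<alpha> # r \<in> cycles Q \<and> u = head Q \<alpha>" if "c \<in> ?S" for c
    using that cyc_mem[of c "\<alpha> # r"] by (auto simp: cyc_deriv_eq split: if_splits)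
  have mem: "?c \<in> cyc Q \<longleftrightarrow> \<alpha> # r \<in> cycles Q"
    using cyc_mem[of ?c "\<alpha> # r"] cyc_class_refl by (auto simp: cyc_def)
  show ?thesis
  proof (cases "?c \<in> ?S")
    case True
    then have eq: "?S = {?c}" using S by blast
    have "cyc_deriv Q \<alpha> ?c (u, r) = (of_nat (period_count (\<alpha> # r)) :: 'k)"
      using True S[OF True] cyc_deriv_eq[of ?c \<alpha> u r] cyc_class_refl[of "\<alpha> # r"] by simp
    then show ?thesis unfolding potential_deriv_def eq using S[OF True] by simp
  next
    case False
    then have "?S = {}" using S by blast
    \<comment> \<open>The class may be a cycle class of Q with the right start vertex and still be
      missing from \<open>?S\<close>, namely when its period count vanishes in k.\<close>
    moreover have "\<not> (u = head Q \<alpha> \<and> \<alpha> # r \<in> cycles Q \<and> of_nat (period_count (\<alpha> # r)) \<noteq> (0::'k))"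
      using False mem by (auto simp: cyc_deriv_eq cyc_class_refl)
    ultimately show ?thesis by (auto simp: potential_deriv_def)
  qed
qed

lemma cycles_Cons: "\<alpha> # r \<in> cycles Q \<longleftrightarrow>
    \<alpha> \<in> arcs Q \<and> (head Q \<alpha>, r) \<in> paths Q \<and> awlast (head Q \<alpha>) r = tail Q \<alpha>"
  by (auto simp: cycles_def awalk_Cons_iff paths_iff)

lemma potential_deriv_nonzero:
  assumes "potential_deriv Q W \<alpha> x \<noteq> 0"
  shows "x \<in> paths Q" "fst x = head Q \<alpha>" "tgt x = tail Q \<alpha>" "\<alpha> \<in> arcs Q"
    "W (cyc_class (\<alpha> # snd x)) \<noteq> 0"
  using assms by (cases x; auto simp: potential_deriv_eq cycles_Cons split: if_splits)+

lemma potential_deriv_closed: "potential_deriv Q W \<alpha> \<in> carrier A"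
  using potential_deriv_nonzero(1) by (auto simp: carrier_path_algebra simp del: split_paired_All)

section \<open>Jacobian categories\<close>

lemma closed_ideal_jacobian: "closed_ideal (jacobian_ideal Q W)"
  unfolding jacobian_ideal_def
  by (intro closed_ideal_closure A.A.genideal_ideal) (auto simp: potential_deriv_closed)

lemma ideal_jacobian: "ideal (jacobian_ideal Q W) A"
  using closed_ideal_jacobian by (auto simp: closed_ideal_def)

lemma potential_deriv_in_jacobian_ideal:
  assumes "\<alpha> \<in> arcs Q" shows "potential_deriv Q W \<alpha> \<in> jacobian_ideal Q W"
proof -
  have "potential_deriv Q W \<alpha> \<in> Idl\<^bsub>A\<^esub> (potential_deriv Q W ` arcs Q)"
    using assms A.A.genideal_self[of "potential_deriv Q W ` arcs Q"] potential_deriv_closed by auto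
  then show ?thesis
    unfolding jacobian_ideal_def in_adic_closure using potential_deriv_closed agree_refl by blast
qed

text \<open>The universal property through which every inclusion of a Jacobian ideal is proved:
  exhibit a closed ideal that contains the generators.\<close>

lemma jacobian_ideal_minimal:
  assumes "closed_ideal I" "\<And>\<alpha>. \<alpha> \<in> arcs Q \<Longrightarrow> potential_deriv Q W \<alpha> \<in> I"
  shows "jacobian_ideal Q W \<subseteq> I"
proof
  fix f assume f: "f \<in> jacobian_ideal Q W"
  have "Idl\<^bsub>A\<^esub> (potential_deriv Q W ` arcs Q) \<subseteq> I"
    using assms by (intro A.A.genideal_minimal) (auto simp: closed_ideal_def)
  then have "f \<in> carrier A" "\<forall>n. \<exists>h\<in>I. agree n f h"
    using f unfolding jacobian_ideal_def in_adic_closure by blast+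
  then show "f \<in> I" using assms(1) unfolding closed_ideal_def by blast
qed

sublocale J: k_algebra_ideal ring_of_type_algebra A "jacobian_ideal Q W"
  for W :: "'e list set \<Rightarrow> 'k::field"
  by (intro k_algebra_ideal.intro A.k_algebra_axioms ideal_jacobian)

abbreviation JC :: "('e list set \<Rightarrow> 'k::field) \<Rightarrow> ('v, 'k, (('v, 'e) path \<Rightarrow> 'k) set) kcat" where
  "JC W \<equiv> jacobian_category Q W"

abbreviation jcl :: "('e list set \<Rightarrow> 'k::field) \<Rightarrow> (('v, 'e) path \<Rightarrow> 'k) \<Rightarrow> (('v, 'e) path \<Rightarrow> 'k) set" where
  "jcl W \<equiv> jacobian_class Q W"

lemma k_category_JC: "k_category ring_of_type_algebra (JC W)"
  unfolding jacobian_category_def jacobian_algebra_def jacobian_class_def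
  by (intro J.k_category_quotient) (auto simp: vertex_elem_closed vertex_elem_idem)

lemma jacobian_category_simps:
  "Obj (JC W) = verts Q" "idn (JC W) v = jcl W (vertex_elem v)"
  by (simp_all add: jacobian_category_def algebra_category_def)

lemma Mor_JC:
  assumes "a \<in> verts Q" "b \<in> verts Q"
  shows "Mor (JC W) a b = jcl W ` Mor PC a b"
  unfolding jacobian_category_def jacobian_algebra_def jacobian_class_def path_category_def
  using assms by (intro J.Mor_quotient_category) (auto simp: vertex_elem_closed)

lemma jacobian_class_simps:
  assumes "f \<in> carrier A" "g \<in> carrier A"
  shows "cmp (JC W) (jcl W f) (jcl W g) = jcl W (f \<otimes>\<^bsub>A\<^esub> g)"
    "jcl W f \<oplus>\<^bsub>Hom (JC W) a b\<^esub> jcl W g = jcl W (\<lambda>x. f x + g x)"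
    "r \<odot>\<^bsub>Hom (JC W) a b\<^esub> jcl W f = jcl W (\<lambda>x. r * f x)"
    "jcl W f = \<zero>\<^bsub>Hom (JC W) a b\<^esub> \<longleftrightarrow> f \<in> jacobian_ideal Q W"
    "jcl W f = jcl W g \<longleftrightarrow> (\<lambda>x. f x - g x) \<in> jacobian_ideal Q W"
proof -
  \<comment> \<open>Subtraction is derived from inverses in the additive group, not a field of the
    record, and has to be identified with pointwise subtraction.\<close>
  have minus: "f \<ominus>\<^bsub>A\<^esub> g = (\<lambda>x. f x - g x)"
  proof -
    have m: "(\<lambda>x. f x - g x) \<in> carrier A"
      using assms by (simp add: path_algebra_def del: split_paired_All)
    have "(\<lambda>x. f x - g x) \<oplus>\<^bsub>A\<^esub> g = f" by (simp add: path_algebra_simps)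
    then have "(\<lambda>x. f x - g x) \<oplus>\<^bsub>A\<^esub> g \<ominus>\<^bsub>A\<^esub> g = f \<ominus>\<^bsub>A\<^esub> g" by simp
    then show ?thesis using m assms A.A.r_neg[OF assms(2)] by (simp add: A.A.minus_eq A.A.a_assoc)
  qed
  show "cmp (JC W) (jcl W f) (jcl W g) = jcl W (f \<otimes>\<^bsub>A\<^esub> g)"
    "jcl W f \<oplus>\<^bsub>Hom (JC W) a b\<^esub> jcl W g = jcl W (\<lambda>x. f x + g x)"
    "r \<odot>\<^bsub>Hom (JC W) a b\<^esub> jcl W f = jcl W (\<lambda>x. r * f x)"
    "jcl W f = \<zero>\<^bsub>Hom (JC W) a b\<^esub> \<longleftrightarrow> f \<in> jacobian_ideal Q W"
    using J.cl_mult[OF assms] J.cl_add[OF assms] J.cl_smult[of r f W] assms J.cl_eq_zero_iff[of f W]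
    by (simp_all add: jacobian_category_def algebra_category_def jacobian_algebra_def
        jacobian_class_def path_algebra_simps ring_of_type_algebra_def)
  show "jcl W f = jcl W g \<longleftrightarrow> (\<lambda>x. f x - g x) \<in> jacobian_ideal Q W"
    unfolding jacobian_class_def J.cl_eq_iff[OF assms] minus ..
qed

lemma zero_Hom_JC: "\<zero>\<^bsub>Hom (JC W) a b\<^esub> = jcl W (\<lambda>_. 0)"
  using jacobian_class_simps(4)[of "\<lambda>_. 0" "\<lambda>_. 0" W a b] J.I.zero_closed[of W]
  by (simp add: carrier_path_algebra path_algebra_simps)

lemma finsum_JC:
  fixes f :: "'i \<Rightarrow> ('v, 'e) path \<Rightarrow> 'k::field"
  assumes ab: "a \<in> verts Q" "b \<in> verts Q" and f: "\<And>i. i \<in> I \<Longrightarrow> f i \<in> Mor PC a b" and "finite I"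
  shows "finsum (Hom (JC W) a b) (\<lambda>i. jcl W (f i)) I = jcl W (\<lambda>x. \<Sum>i\<in>I. f i x)"
proof -
  interpret JC: k_category ring_of_type_algebra "JC W" by (rule k_category_JC)
  have m: "h \<in> carrier A" if "h \<in> Mor PC a b" for h :: "('v, 'e) path \<Rightarrow> 'k"
    using that Mor_carrier[OF ab] by blast
  have "jcl W (finsum (Hom PC a b) f I) = finsum (Hom (JC W) a b) (\<lambda>i. jcl W (f i)) I"
    using assms m
    by (intro PC.additive_finsum(2) JC.abelian_group_Hom)
      (auto simp: path_category_simps jacobian_category_simps Mor_JC jacobian_class_simps)
  then show ?thesis using assms by (simp add: finsum_PC)
qed

text \<open>Deleting an arrow from a cycle of length at least 2 leaves a path of positive length, so
  the generators lie in the arrow ideal, which is a closed ideal.\<close>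

lemma jacobian_ideal_Nil:
  fixes W :: "'e list set \<Rightarrow> 'k::field"
  assumes "\<And>c p. W c \<noteq> 0 \<Longrightarrow> p \<in> c \<Longrightarrow> length p \<ge> 2" "f \<in> jacobian_ideal Q W"
  shows "f (u, []) = 0"
proof -
  let ?M = "{f \<in> carrier A. \<forall>u. f (u, []) = (0::'k)}"
  have "ideal ?M A"
  proof (rule A.A.ideal_of_closed_set)
    show "f \<oplus>\<^bsub>A\<^esub> g \<in> ?M" if "f \<in> ?M" "g \<in> ?M" for f g
      using that A.A.a_closed[of f g] by (simp add: path_algebra_simps)
    show "\<zero>\<^bsub>A\<^esub> \<in> ?M" using A.A.zero_closed by (simp add: path_algebra_simps)
  qed (auto simp: mult_closed path_algebra_mult)
  moreover have "f \<in> ?M" if f: "f \<in> carrier A" "\<forall>n. \<exists>h\<in>?M. agree n f h" for f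
  proof -
    obtain h where "h \<in> ?M" "agree 1 f h" using f(2) by blast
    then have "f (u, []) = 0" for u
      unfolding agree_def by (metis (mono_tags, lifting) less_one list.size(3) mem_Collect_eq snd_conv)
    then show ?thesis using f(1) by simp
  qed
  ultimately have "closed_ideal ?M" by (simp add: closed_ideal_def)
  moreover have "potential_deriv Q W \<alpha> \<in> ?M" for \<alpha>
    using assms(1)[OF _ cyc_class_refl, of "[\<alpha>]"]
    by (auto simp: potential_deriv_closed potential_deriv_eq)
  ultimately have "jacobian_ideal Q W \<subseteq> ?M" by (intro jacobian_ideal_minimal)
  then show ?thesis using assms(2) by blast
qed

text \<open>Invertibility modulo the ideal determines the composite up to a series without constant
  terms. Its coefficient at the trivial path is still 1, and the argument for path categories
  applies.\<close>

lemma skeletal_JC: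
  assumes "\<And>c p. W c \<noteq> 0 \<Longrightarrow> p \<in> c \<Longrightarrow> length p \<ge> 2"
  shows "skeletal (JC W)"
  unfolding skeletal_def jacobian_category_simps
proof (intro ballI impI)
  fix a b assume ab: "a \<in> verts Q" "b \<in> verts Q"
    and "\<exists>f\<in>Mor (JC W) a b. \<exists>g\<in>Mor (JC W) b a. cmp (JC W) g f = jcl W (vertex_elem a)
      \<and> cmp (JC W) f g = jcl W (vertex_elem b)"
  then obtain f g where fg: "f \<in> Mor PC a b" "g \<in> Mor PC b a"
    and eq: "cmp (JC W) (jcl W g) (jcl W f) = jcl W (vertex_elem a)"
    by (auto simp: Mor_JC)
  have "f \<in> carrier A" "g \<in> carrier A" using fg ab Mor_carrier by blast+
  then have mem: "(\<lambda>x. (g \<otimes>\<^bsub>A\<^esub> f) x - vertex_elem a x) \<in> jacobian_ideal Q W"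
    using eq ab by (simp add: jacobian_class_simps mult_closed vertex_elem_closed)
  have "(g \<otimes>\<^bsub>A\<^esub> f) (a, []) - 1 = 0"
    using jacobian_ideal_Nil[OF _ mem, of a] assms by (auto simp: path_elem_def)
  then have "(g \<otimes>\<^bsub>A\<^esub> f) (a, []) \<noteq> 0" by auto
  then show "a = b" using cmp_eq_idn_imp_vertex_eq ab fg by blast
qed

end

section \<open>Orbit quivers and lifting of paths\<close>

locale qp_action = quiver Q for Q :: "('v, 'e) pre_digraph" +
  fixes W :: "'e list set \<Rightarrow> 'k::field" and G :: "('v, 'e) quiver_map set"
  assumes finite_G: "finite G" and admissible: "admissible_group Q W G"
begin

section \<open>The group and its free action on vertices and arrows\<close>

abbreviation Grp :: "('v, 'e) quiver_map monoid" where "Grp \<equiv> acting_group Q G"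

lemma group_bij_group: "group (bij_group Q)"
  unfolding bij_group_def by (intro DirProd_group group_BijGroup)

lemma subgroup_G: "subgroup G (bij_group Q)"
  using admissible by (simp add: admissible_group_def)

lemma carrier_Grp: "carrier Grp = G"
  by (simp add: acting_group_def)

sublocale Grp: group Grp
  unfolding acting_group_def
  by (rule subgroup.subgroup_is_group[OF subgroup_G group_bij_group])

lemma Grp_mult: "g \<in> G \<Longrightarrow> h \<in> G \<Longrightarrow> g \<otimes>\<^bsub>Grp\<^esub> h \<in> G"
  and Grp_one: "\<one>\<^bsub>Grp\<^esub> \<in> G"
  and Grp_inv: "g \<in> G \<Longrightarrow> inv\<^bsub>Grp\<^esub> g \<in> G"
  using Grp.m_closed Grp.one_closed Grp.inv_closed by (simp_all add: carrier_Grp)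

lemma inv_bij_group: "g \<in> G \<Longrightarrow> inv\<^bsub>bij_group Q\<^esub> g = inv\<^bsub>Grp\<^esub> g"
  using group.m_inv_consistent[OF group_bij_group subgroup_G] by (simp add: acting_group_def)

lemma G_Bij:
  assumes "g \<in> G"
  shows "fst g \<in> Bij (verts Q)" "snd g \<in> Bij (arcs Q)"
  using assms admissible
  by (auto simp: admissible_group_def qp_automorphisms_def quiver_automorphisms_def bij_group_def
      BijGroup_def DirProd_def)

lemma G_bij_betw:
  assumes "g \<in> G"
  shows "bij_betw (fst g) (verts Q) (verts Q)" "bij_betw (snd g) (arcs Q) (arcs Q)"
  using G_Bij[OF assms] by (auto simp: Bij_def)

lemma act_verts: "g \<in> G \<Longrightarrow> v \<in> verts Q \<Longrightarrow> fst g v \<in> verts Q"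
  and act_arcs: "g \<in> G \<Longrightarrow> \<alpha> \<in> arcs Q \<Longrightarrow> snd g \<alpha> \<in> arcs Q"
  using G_bij_betw bij_betwE by blast+

lemma act_tail: "g \<in> G \<Longrightarrow> \<alpha> \<in> arcs Q \<Longrightarrow> tail Q (snd g \<alpha>) = fst g (tail Q \<alpha>)"
  and act_head: "g \<in> G \<Longrightarrow> \<alpha> \<in> arcs Q \<Longrightarrow> head Q (snd g \<alpha>) = fst g (head Q \<alpha>)"
  using admissible by (auto simp: admissible_group_def qp_automorphisms_def quiver_automorphisms_def)

lemma act_one:
  shows "v \<in> verts Q \<Longrightarrow> fst \<one>\<^bsub>Grp\<^esub> v = v" "\<alpha> \<in> arcs Q \<Longrightarrow> snd \<one>\<^bsub>Grp\<^esub> \<alpha> = \<alpha>"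
  by (simp_all add: acting_group_def bij_group_def DirProd_def BijGroup_def)

lemma act_mult:
  assumes "g \<in> G" "h \<in> G"
  shows "v \<in> verts Q \<Longrightarrow> fst (g \<otimes>\<^bsub>Grp\<^esub> h) v = fst g (fst h v)"
    "\<alpha> \<in> arcs Q \<Longrightarrow> snd (g \<otimes>\<^bsub>Grp\<^esub> h) \<alpha> = snd g (snd h \<alpha>)"
  using G_Bij[OF assms(1)] G_Bij[OF assms(2)]
  by (simp_all add: acting_group_def bij_group_def DirProd_def BijGroup_def case_prod_unfold compose_def)

lemma act_inv:
  assumes "g \<in> G"
  shows "v \<in> verts Q \<Longrightarrow> fst (inv\<^bsub>Grp\<^esub> g) (fst g v) = v" "v \<in> verts Q \<Longrightarrow> fst g (fst (inv\<^bsub>Grp\<^esub> g) v) = v"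
    "\<alpha> \<in> arcs Q \<Longrightarrow> snd (inv\<^bsub>Grp\<^esub> g) (snd g \<alpha>) = \<alpha>" "\<alpha> \<in> arcs Q \<Longrightarrow> snd g (snd (inv\<^bsub>Grp\<^esub> g) \<alpha>) = \<alpha>"
  using assms act_mult[OF Grp_inv[OF assms] assms] act_mult[OF assms Grp_inv[OF assms]] act_one
  by (simp_all add: carrier_Grp)

text \<open>The element g^-1 h fixes v.\<close>

lemma free:
  assumes "g \<in> G" "h \<in> G" "v \<in> verts Q" "fst g v = fst h v" shows "g = h"
proof -
  have "fst (inv\<^bsub>Grp\<^esub> g \<otimes>\<^bsub>Grp\<^esub> h) v = v"
    using assms act_inv(1)[OF assms(1,3)] by (simp add: act_mult Grp_inv)
  moreover have "inv\<^bsub>Grp\<^esub> g \<otimes>\<^bsub>Grp\<^esub> h \<in> G" using assms by (intro Grp_mult Grp_inv)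
  ultimately have "inv\<^bsub>Grp\<^esub> g \<otimes>\<^bsub>Grp\<^esub> h = \<one>\<^bsub>Grp\<^esub>"
    using admissible assms(3) by (auto simp: admissible_group_def acting_group_def)
  then show ?thesis
    using assms(1,2) Grp.inv_solve_left'[of "\<one>\<^bsub>Grp\<^esub>" g h] Grp.r_one[of g] by (simp add: carrier_Grp Grp_one)
qed

text \<open>Arrows inherit freeness from their tails.\<close>

lemma free_arcs:
  assumes "g \<in> G" "h \<in> G" "\<alpha> \<in> arcs Q" "snd g \<alpha> = snd h \<alpha>" shows "g = h"
  using assms free[of g h "tail Q \<alpha>"] act_tail[of g \<alpha>] act_tail[of h \<alpha>] by simp

section \<open>Orbits and the orbit quiver\<close>

abbreviation vo :: "'v \<Rightarrow> 'v set" where "vo \<equiv> vertex_orbit Q G"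
abbreviation ao :: "'e \<Rightarrow> 'e set" where "ao \<equiv> arrow_orbit Q G"

lemma vo_iff: "w \<in> vo v \<longleftrightarrow> (\<exists>g\<in>G. w = fst g v)"
  and ao_iff: "\<beta> \<in> ao \<alpha> \<longleftrightarrow> (\<exists>g\<in>G. \<beta> = snd g \<alpha>)"
  unfolding orbit_def carrier_Grp by blast+

lemma vo_image: "vo v = (\<lambda>g. fst g v) ` G"
  and ao_image: "ao \<alpha> = (\<lambda>g. snd g \<alpha>) ` G"
  by (rule Set.set_eqI, unfold vo_iff ao_iff image_iff, rule refl)+

lemma vo_act: "g \<in> G \<Longrightarrow> v \<in> verts Q \<Longrightarrow> vo (fst g v) = vo v"
proof (intro Set.set_eqI)
  fix w assume g: "g \<in> G" and v: "v \<in> verts Q"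
  have "\<exists>k\<in>G. fst h (fst g v) = fst k v" if "h \<in> G" for h
    using that g v act_mult(1)[of h g v] Grp_mult by (metis)
  moreover have "\<exists>k\<in>G. fst h v = fst k (fst g v)" if "h \<in> G" for h
    using that g v act_mult(1)[of "h" "inv\<^bsub>Grp\<^esub> g" "fst g v"] Grp_mult Grp_inv act_verts act_inv(1)
    by metis
  ultimately show "w \<in> vo (fst g v) \<longleftrightarrow> w \<in> vo v" unfolding vo_iff by metis
qed

lemma ao_act: "g \<in> G \<Longrightarrow> \<alpha> \<in> arcs Q \<Longrightarrow> ao (snd g \<alpha>) = ao \<alpha>"
proof (intro Set.set_eqI)
  fix w assume g: "g \<in> G" and v: "\<alpha> \<in> arcs Q"
  have "\<exists>k\<in>G. snd h (snd g \<alpha>) = snd k \<alpha>" if "h \<in> G" for h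
    using that g v act_mult(2)[of h g \<alpha>] Grp_mult by (metis)
  moreover have "\<exists>k\<in>G. snd h \<alpha> = snd k (snd g \<alpha>)" if "h \<in> G" for h
    using that g v act_mult(2)[of "h" "inv\<^bsub>Grp\<^esub> g" "snd g \<alpha>"] Grp_mult Grp_inv act_arcs act_inv(3)
    by metis
  ultimately show "w \<in> ao (snd g \<alpha>) \<longleftrightarrow> w \<in> ao \<alpha>" unfolding ao_iff by metis
qed

lemma vo_eqD: "v \<in> verts Q \<Longrightarrow> w \<in> verts Q \<Longrightarrow> vo v = vo w \<Longrightarrow> \<exists>g\<in>G. w = fst g v"
  using vo_iff[of w w] vo_iff[of w v] act_one(1)[of w] Grp_one by metis

lemma ao_eqD: "\<alpha> \<in> arcs Q \<Longrightarrow> \<beta> \<in> arcs Q \<Longrightarrow> ao \<alpha> = ao \<beta> \<Longrightarrow> \<exists>g\<in>G. \<beta> = snd g \<alpha>"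
  using ao_iff[of \<beta> \<beta>] ao_iff[of \<beta> \<alpha>] act_one(2)[of \<beta>] Grp_one by metis

abbreviation QG :: "('v set, 'e set) pre_digraph" where "QG \<equiv> orbit_quiver Q G"

lemma QG_simps:
  "verts QG = vo ` verts Q" "arcs QG = ao ` arcs Q"
  by (auto simp: orbit_quiver_def orbits_def)

lemma QG_ends:
  assumes "\<alpha> \<in> arcs Q"
  shows "tail QG (ao \<alpha>) = vo (tail Q \<alpha>)" "head QG (ao \<alpha>) = vo (head Q \<alpha>)"
proof -
  have "tail Q ` ao \<alpha> = vo (tail Q \<alpha>)" "head Q ` ao \<alpha> = vo (head Q \<alpha>)"
    using assms by (simp_all add: vo_image ao_image image_image act_tail act_head)
  then show "tail QG (ao \<alpha>) = vo (tail Q \<alpha>)" "head QG (ao \<alpha>) = vo (head Q \<alpha>)"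
    by (simp_all add: orbit_quiver_def)
qed

sublocale O: quiver QG
  by unfold_locales (auto simp: QG_simps QG_ends)

section \<open>Projection and unique lifting of paths\<close>

definition opath :: "('v, 'e) path \<Rightarrow> ('v set, 'e set) path" where
  "opath x = (vo (fst x), map ao (snd x))"

lemma opath_simps: "opath (u, p) = (vo u, map ao p)" "fst (opath x) = vo (fst x)" "snd (opath x) = map ao (snd x)"
  by (simp_all add: opath_def)

lemma opath_paths:
  assumes "x \<in> paths Q" shows "opath x \<in> paths QG \<and> O.tgt (opath x) = vo (tgt x)"
proof -
  have "opath (u, p) \<in> paths QG \<and> O.tgt (opath (u, p)) = vo (awlast u p)" if "(u, p) \<in> paths Q" for u p
    using that
    by (induction p arbitrary: u) (auto simp: opath_simps paths_Nil O.paths_Nil paths_Cons O.paths_Cons QG_simps QG_ends)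
  then show ?thesis using assms by (cases x) force
qed

text \<open>Any representative of the first arrow orbit can be translated so that it starts at the
  given vertex; its head is then the start vertex for the rest of the path.\<close>

lemma opath_lift:
  assumes "y \<in> paths QG" "a \<in> verts Q" "vo a = fst y"
  obtains x where "x \<in> paths Q" "fst x = a" "opath x = y"
proof -
  have "\<exists>p. (a, p) \<in> paths Q \<and> map ao p = q" if "(vo a, q) \<in> paths QG" "a \<in> verts Q" for a q
    using that
  proof (induction q arbitrary: a)
    case (Cons \<beta> q)
    then obtain \<alpha> where \<alpha>: "\<alpha> \<in> arcs Q" "\<beta> = ao \<alpha>" "vo a = vo (tail Q \<alpha>)"
      by (auto simp: O.paths_Cons QG_simps QG_ends)
    then obtain g where g: "g \<in> G" "a = fst g (tail Q \<alpha>)" using Cons.prems vo_eqD by (metis tail_in_verts)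
    let ?\<alpha> = "snd g \<alpha>"
    have \<alpha>': "?\<alpha> \<in> arcs Q" "tail Q ?\<alpha> = a" "ao ?\<alpha> = \<beta>"
      using \<alpha> g by (simp_all add: act_arcs act_tail ao_act)
    then have "(vo (head Q ?\<alpha>), q) \<in> paths QG"
      using Cons.prems QG_ends(2)[of ?\<alpha>] by (simp add: O.paths_Cons)
    then obtain p where "(head Q ?\<alpha>, p) \<in> paths Q" "map ao p = q"
      using Cons.IH \<alpha>' by (metis head_in_verts)
    then show ?case using \<alpha>' by (intro exI[of _ "?\<alpha> # p"]) (simp add: paths_Cons)
  qed (auto simp: paths_Nil)
  then obtain p where "(a, p) \<in> paths Q" "map ao p = snd y" using assms by (cases y) auto
  then show ?thesis using that[of "(a, p)"] assms by (simp add: opath_def)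
qed

text \<open>If two arrows of one orbit have the same tail, the element relating them fixes that tail
  and is the identity. The lifts therefore agree arrow by arrow.\<close>

lemma opath_inj:
  assumes "x \<in> paths Q" "y \<in> paths Q" "fst x = fst y" "opath x = opath y" shows "x = y"
proof -
  have "p = q" if "(u, p) \<in> paths Q" "(u, q) \<in> paths Q" "map ao p = map ao q" for u p q
    using that
  proof (induction p arbitrary: u q)
    case (Cons \<alpha> p)
    then obtain \<beta> q' where q: "q = \<beta> # q'" by (cases q) auto
    obtain g where g: "g \<in> G" "\<beta> = snd g \<alpha>"
      using Cons.prems ao_eqD[of \<alpha> \<beta>] by (auto simp: q paths_Cons)
    then have "g = \<one>\<^bsub>Grp\<^esub>" using Cons.prems act_tail[of g \<alpha>] free[of g "\<one>\<^bsub>Grp\<^esub>" "tail Q \<alpha>"] Grp_one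
      by (simp add: q paths_Cons act_one)
    then have "\<alpha> = \<beta>" using g Cons.prems act_one by (simp add: paths_Cons)
    then show ?case using Cons by (auto simp: q paths_Cons)
  qed auto
  then show ?thesis using assms by (cases x; cases y) (auto simp: opath_def)
qed

lemma path_map_paths:
  assumes "g \<in> G" "x \<in> paths Q"
  shows "path_map g x \<in> paths Q \<and> tgt (path_map g x) = fst g (tgt x) \<and> opath (path_map g x) = opath x"
proof -
  have "path_map g (u, p) \<in> paths Q \<and> tgt (path_map g (u, p)) = fst g (awlast u p)
    \<and> opath (path_map g (u, p)) = opath (u, p)" if "(u, p) \<in> paths Q" for u p
    using that assms(1)
    by (induction p arbitrary: u)
      (auto simp: opath_def path_map_def paths_Nil paths_Cons act_verts act_arcs act_tail act_head vo_act ao_act)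
  then show ?thesis using assms(2) by (cases x) force
qed

lemma path_map_mult:
  assumes "g \<in> G" "h \<in> G" "x \<in> paths Q"
  shows "path_map (g \<otimes>\<^bsub>Grp\<^esub> h) x = path_map g (path_map h x)"
  using assms paths_ends(1)[of x] paths_arcs[of "fst x" "snd x"]
  by (auto simp: path_map_def act_mult)

lemma path_map_one: "x \<in> paths Q \<Longrightarrow> path_map \<one>\<^bsub>Grp\<^esub> x = x"
  using paths_ends(1)[of x] paths_arcs[of "fst x" "snd x"]
  by (cases x) (auto simp: path_map_def act_one intro!: map_idI)

lemma path_map_inv:
  assumes "g \<in> G" "x \<in> paths Q"
  shows "path_map (inv\<^bsub>Grp\<^esub> g) (path_map g x) = x" "path_map g (path_map (inv\<^bsub>Grp\<^esub> g) x) = x"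
  using path_map_mult[of "inv\<^bsub>Grp\<^esub> g" g x] path_map_mult[of g "inv\<^bsub>Grp\<^esub> g" x] assms
  by (simp_all add: Grp_inv path_map_one carrier_Grp)

text \<open>Some g carries the start of x to that of y. Then gx and y are lifts of the same path
  from the same vertex, hence equal.\<close>

lemma opath_eqD:
  assumes "x \<in> paths Q" "y \<in> paths Q" "opath x = opath y"
  obtains g where "g \<in> G" "y = path_map g x"
proof -
  obtain g where g: "g \<in> G" "fst y = fst g (fst x)"
    using assms vo_eqD[of "fst x" "fst y"] paths_ends(1) by (auto simp: opath_def)
  then have "y = path_map g x"
    using path_map_paths[OF g(1) assms(1)] assms by (intro opath_inj) (auto simp: path_map_def)
  then show ?thesis using g that by blast
qed

end

section \<open>Potentials on orbit quivers\<close>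

lemma card_filter_sum: "finite A \<Longrightarrow> card {x \<in> A. P x} = (\<Sum>x\<in>A. if P x then 1 else 0)"
  by (simp only: card_eq_sum sum.inter_filter)

context qp_action
begin

section \<open>Cycles under projection and translation\<close>

lemma cycles_iff: "p \<in> cycles Q \<longleftrightarrow>
    p \<noteq> [] \<and> (tail Q (hd p), p) \<in> paths Q \<and> awlast (tail Q (hd p)) p = tail Q (hd p)"
proof (cases p)
  case Nil
  then show ?thesis by (simp add: cycles_def)
qed (auto simp: cycles_Cons paths_Cons)

lemma cycles_arcs: "p \<in> cycles Q \<Longrightarrow> set p \<subseteq> arcs Q"
  using paths_arcs by (auto simp: cycles_iff)

lemma map_cycles:
  assumes "g \<in> G" "p \<in> cycles Q" shows "map (snd g) p \<in> cycles Q"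
proof -
  have "p \<noteq> []" "hd p \<in> arcs Q" using assms cycles_arcs[of p] by (cases p; auto simp: cycles_def)+
  then show ?thesis
    using path_map_paths[of g "(tail Q (hd p), p)"] assms
    by (auto simp: cycles_iff path_map_def hd_map act_tail)
qed

lemma opath_cycles:
  assumes "p \<in> cycles Q" shows "map ao p \<in> cycles QG"
proof (cases p)
  case (Cons \<alpha> r)
  then show ?thesis
    using assms opath_paths[of "(head Q \<alpha>, r)"] by (auto simp: cycles_Cons O.cycles_Cons QG_simps QG_ends opath_def)
qed (use assms in \<open>simp add: cycles_def\<close>)

lemma map_ao_act: "g \<in> G \<Longrightarrow> p \<in> cycles Q \<Longrightarrow> map ao (map (snd g) p) = map ao p"
  using cycles_arcs[of p] by (auto simp: ao_act)

text \<open>A cycle is a list without a start vertex. The tail of its first arrow supplies one, and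
  the claim becomes the one for paths.\<close>

lemma cycle_lift_unique:
  assumes "p \<in> cycles Q" "q \<in> cycles Q" "map ao p = map ao q"
  obtains g where "g \<in> G" "q = map (snd g) p"
proof -
  obtain \<alpha> r \<beta> s where pq: "p = \<alpha> # r" "q = \<beta> # s"
    using assms(1,2) by (cases p; cases q) (auto simp: cycles_def)
  then have "vo (tail Q \<alpha>) = vo (tail Q \<beta>)"
    using assms QG_ends(1)[of \<alpha>] QG_ends(1)[of \<beta>] by (simp add: cycles_Cons)
  then have "opath (tail Q \<alpha>, p) = opath (tail Q \<beta>, q)" using assms by (simp add: opath_def)
  then obtain g where "g \<in> G" "(tail Q \<beta>, q) = path_map g (tail Q \<alpha>, p)"
    using opath_eqD[of "(tail Q \<alpha>, p)" "(tail Q \<beta>, q)"] assms(1,2) by (auto simp: pq cycles_iff)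
  then show ?thesis using that by (simp add: path_map_def)
qed

lemma map_act_inj:
  assumes "g \<in> G" "h \<in> G" "p \<in> cycles Q" "map (snd g) p = map (snd h) p" shows "g = h"
  using assms free_arcs[of g h "hd p"] by (cases p) (auto simp: cycles_Cons cycles_def)

lemma cyc_map_class: "cyc_map g (cyc_class p) = cyc_class (map (snd g) p)"
  by (auto simp: cyc_map_def cyc_class_def rotate_map)

lemma cyc_class_in_cyc: "p \<in> cycles Q \<Longrightarrow> cyc_class p \<in> cyc Q"
  by (simp add: cyc_def)

lemma map_map_act:
  assumes "g \<in> G" "h \<in> G" "p \<in> cycles Q"
  shows "map (snd (g \<otimes>\<^bsub>Grp\<^esub> h)) p = map (snd g) (map (snd h) p)"
  using assms cycles_arcs[of p] by (auto simp: act_mult)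

lemma map_inv_act:
  assumes "g \<in> G" "p \<in> cycles Q"
  shows "map (snd (inv\<^bsub>Grp\<^esub> g)) (map (snd g) p) = p"
  using assms cycles_arcs[of p] by (auto simp: act_inv intro!: map_idI)

text \<open>Automorphisms are only required to preserve nonzero coefficients. A zero coefficient
  stays zero because otherwise the inverse would carry the nonzero value back.\<close>

lemma W_act:
  assumes "g \<in> G" "p \<in> cycles Q"
  shows "W (cyc_class (map (snd g) p)) = W (cyc_class p)"
proof -
  have W: "W (cyc_class (map (snd h) q)) = W (cyc_class q)"
    if "h \<in> G" "q \<in> cycles Q" "W (cyc_class q) \<noteq> 0" for h q
    using that admissible cyc_class_in_cyc[of q]
    by (auto simp: admissible_group_def qp_automorphisms_def simp flip: cyc_map_class)
  show ?thesis
    using W[OF assms] W[OF Grp_inv[OF assms(1)] map_cycles[OF assms]] map_inv_act[OF assms] by metis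
qed

section \<open>Stabilizers and periods of cycle classes\<close>

definition stab :: "'e list \<Rightarrow> ('v, 'e) quiver_map set" where
  "stab p = {g \<in> G. cyc_class (map (snd g) p) = cyc_class p}"

definition cyc_orbit :: "'e list \<Rightarrow> 'e list set set" where
  "cyc_orbit p = (\<lambda>g. cyc_class (map (snd g) p)) ` G"

text \<open>The orbit-stabilizer formula, by counting G along the fibres of g -> [gp]; each fibre is
  a left coset of the stabilizer.\<close>

lemma card_orbit_stab:
  assumes p: "p \<in> cycles Q" shows "card (cyc_orbit p) * card (stab p) = card G"
proof -
  let ?f = "\<lambda>g. cyc_class (map (snd g) p)"
  have "card {h \<in> G. ?f h = ?f g} = card (stab p)" if g: "g \<in> G" for g
  proof (rule bij_betw_same_card[symmetric])
    have eq: "?f (g \<otimes>\<^bsub>Grp\<^esub> h) = cyc_map g (?f h)" if "h \<in> G" for h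
      using that g p by (simp only: map_map_act cyc_map_class)
    have eq': "?f (inv\<^bsub>Grp\<^esub> g \<otimes>\<^bsub>Grp\<^esub> h) = ?f \<one>\<^bsub>Grp\<^esub>" if "h \<in> G" "?f h = ?f g" for h
    proof -
      have "?f (inv\<^bsub>Grp\<^esub> g \<otimes>\<^bsub>Grp\<^esub> k) = cyc_map (inv\<^bsub>Grp\<^esub> g) (?f k)" if "k \<in> G" for k
        using that g p Grp_inv by (simp only: map_map_act cyc_map_class)
      then show ?thesis using that g Grp.l_inv carrier_Grp by metis
    qed
    have one: "map (snd \<one>\<^bsub>Grp\<^esub>) p = p"
      using cycles_arcs[OF p] by (auto simp: act_one intro!: map_idI)
    show "bij_betw (\<lambda>h. g \<otimes>\<^bsub>Grp\<^esub> h) (stab p) {h \<in> G. ?f h = ?f g}"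
    proof (rule bij_betwI)
      show "(\<lambda>h. g \<otimes>\<^bsub>Grp\<^esub> h) \<in> stab p \<rightarrow> {h \<in> G. ?f h = ?f g}"
        using g by (auto simp: stab_def Grp_mult eq cyc_map_class)
      show "(\<lambda>h. inv\<^bsub>Grp\<^esub> g \<otimes>\<^bsub>Grp\<^esub> h) \<in> {h \<in> G. ?f h = ?f g} \<rightarrow> stab p"
        using g one eq' by (auto simp: stab_def Grp_mult Grp_inv)
      show "inv\<^bsub>Grp\<^esub> g \<otimes>\<^bsub>Grp\<^esub> (g \<otimes>\<^bsub>Grp\<^esub> h) = h" if "h \<in> stab p" for h
        using that g Grp.inv_solve_left'[of h g "g \<otimes>\<^bsub>Grp\<^esub> h"] by (simp add: stab_def carrier_Grp Grp_mult)
      show "g \<otimes>\<^bsub>Grp\<^esub> (inv\<^bsub>Grp\<^esub> g \<otimes>\<^bsub>Grp\<^esub> h) = h" if "h \<in> {h \<in> G. ?f h = ?f g}" for h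
        using that g Grp.m_assoc[of g "inv\<^bsub>Grp\<^esub> g" h] Grp_inv[OF g] by (simp add: carrier_Grp)
    qed
  qed
  then have "card {h \<in> G. ?f h = c} = card (stab p)" if "c \<in> cyc_orbit p" for c
    using that unfolding cyc_orbit_def by (elim imageE) simp
  then have "(\<Sum>c\<in>cyc_orbit p. card {h \<in> G. ?f h = c}) = card (cyc_orbit p) * card (stab p)"
    by simp
  moreover have "card G = (\<Sum>c\<in>cyc_orbit p. card {h \<in> G. ?f h = c})"
    using sum.image_gen[OF finite_G, of "\<lambda>_. 1::nat" ?f] by (simp add: cyc_orbit_def)
  ultimately show ?thesis by simp
qed

text \<open>A rotation fixing the image of a cycle p in the orbit quiver arises from a unique group
  element that rotates p; hence the stabilizer of the class of p accounts for the additional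
  periodicity of the image.\<close>

lemma period_count_pi:
  assumes p: "p \<in> cycles Q" shows "period_count (map ao p) = period_count p * card (stab p)"
proof -
  let ?n = "length p" and ?R = "\<lambda>i g. rotate i p = map (snd g) p"
  have "period_count (map ao p) = card {i \<in> {..<?n}. rotate i (map ao p) = map ao p}"
    by (simp add: period_count_def)
  also have "\<dots> = (\<Sum>i<?n. if rotate i (map ao p) = map ao p then 1 else 0)"
    by (rule card_filter_sum) simp
  \<comment> \<open>Double count of the pairs (i, g) for which rotation by i and translation by g
    have the same effect on p. Each i that fixes the image belongs to exactly one g, by
    freeness.\<close>
  also have "\<dots> = (\<Sum>i<?n. \<Sum>g\<in>G. if ?R i g then 1 else 0)"
  proof (rule sum.cong[OF refl])
    fix i
    have r: "rotate i p \<in> cycles Q" using p by (rule rotate_cycles)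
    show "(if rotate i (map ao p) = map ao p then 1 else 0) = (\<Sum>g\<in>G. if ?R i g then 1 else (0::nat))"
    proof (cases "rotate i (map ao p) = map ao p")
      case True
      then obtain g where g: "g \<in> G" "?R i g"
        using cycle_lift_unique[OF p r] by (auto simp: rotate_map)
      then have "?R i h \<longleftrightarrow> h = g" if "h \<in> G" for h
        using map_act_inj[OF that g(1) p] by auto
      then have "(\<Sum>h\<in>G. if ?R i h then 1 else (0::nat)) = (\<Sum>h\<in>G. if h = g then 1 else 0)"
        by (intro sum.cong) auto
      then show ?thesis using True g finite_G by simp
    next
      case False
      then have "\<not> ?R i g" if "g \<in> G" for g
        using map_ao_act[OF that p] by (auto simp: rotate_map simp del: map_map)
      then show ?thesis using False by simp
    qed
  qed
  also have "\<dots> = (\<Sum>g\<in>G. card {i. i < ?n \<and> ?R i g})"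
    by (subst sum.swap) (simp flip: card_filter_sum)
  \<comment> \<open>For fixed g, rotations that take p to gp exist exactly when g stabilizes the
    class. Their number is then the period count of gp, which is that of p as g is injective on
    arrows.\<close>
  also have "\<dots> = (\<Sum>g\<in>G. if g \<in> stab p then period_count p else 0)"
  proof (rule sum.cong[OF refl])
    fix g assume g: "g \<in> G"
    have "inj_on (map (snd g)) (lists (arcs Q))"
      using G_bij_betw(2)[OF g] by (intro inj_on_mapI) (auto simp: bij_betw_def inj_on_def)
    then have "map (snd g) (rotate i p) = map (snd g) p \<longleftrightarrow> rotate i p = p" for i
      using cycles_arcs[OF p] cycles_arcs[OF rotate_cycles[OF p], of i] by (auto simp: inj_on_def in_lists_conv_set subset_eq)
    then have "period_count (map (snd g) p) = period_count p"
      by (simp add: period_count_def rotate_map)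
    moreover have "map (snd g) p \<in> cyc_class p \<longleftrightarrow> g \<in> stab p"
      using g cyc_class_eq cyc_class_refl by (auto simp: stab_def)
    ultimately show "card {i. i < ?n \<and> ?R i g} = (if g \<in> stab p then period_count p else 0)"
      by (simp add: card_rotations)
  qed
  also have "\<dots> = period_count p * card (stab p)"
    using finite_G by (simp add: sum.If_cases stab_def Int_def)
  finally show ?thesis .
qed

section \<open>Coefficients and derivatives of the induced potential\<close>

abbreviation WG :: "'e set list set \<Rightarrow> 'k" where "WG \<equiv> orbit_potential Q G W"

lemma orbits_cyc: "orbits Grp (cyc Q) cyc_map = cyc_orbit ` cycles Q"
proof -
  have "orbit Grp cyc_map (cyc_class p) = cyc_orbit p" for p
    unfolding orbit_def cyc_orbit_def carrier_Grp cyc_map_class by blast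
  then show ?thesis by (auto simp: orbits_def cyc_def)
qed

lemma orbit_class_cyc_orbit:
  assumes "p \<in> cycles Q" shows "orbit_class Q G (cyc_orbit p) = cyc_class (map ao p)"
proof -
  have img: "map ao ` cyc_class q = cyc_class (map ao q)" for q
    by (auto simp: cyc_class_def rotate_map)
  have "orbit_class Q G (cyc_orbit p) = (\<Union>g\<in>G. cyc_class (map ao (map (snd g) p)))"
    unfolding orbit_class_def cyc_orbit_def image_Union image_image img ..
  also have "\<dots> = (\<Union>g\<in>G. cyc_class (map ao p))"
    using map_ao_act[OF _ assms] by (intro SUP_cong) (simp_all del: map_map)
  finally show ?thesis using Grp_one by auto
qed

text \<open>The injectivity that makes the sum in \<open>orbit_potential\<close> a single term: some
  rotation of p has the image of q, so by unique lifting q is a translate of that rotation.\<close>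

lemma cyc_orbit_eqI:
  assumes p: "p \<in> cycles Q" and q: "q \<in> cycles Q" and eq: "cyc_class (map ao p) = cyc_class (map ao q)"
  shows "cyc_orbit p = cyc_orbit q"
proof -
  have sub: "cyc_orbit q \<subseteq> cyc_orbit p"
    if p: "p \<in> cycles Q" and q: "q \<in> cycles Q" and eq: "cyc_class (map ao p) = cyc_class (map ao q)" for p q
  proof
    fix c assume "c \<in> cyc_orbit q"
    then obtain h where h: "h \<in> G" "c = cyc_class (map (snd h) q)" by (auto simp: cyc_orbit_def)
    have "map ao q \<in> cyc_class (map ao p)" using cyc_class_refl eq by blast
    then obtain i where "map ao q = map ao (rotate i p)" by (auto simp: cyc_class_def rotate_map)
    then obtain g where g: "g \<in> G" "q = map (snd g) (rotate i p)"
      using cycle_lift_unique[OF rotate_cycles[OF p] q] by metis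
    then have "map (snd h) q = rotate i (map (snd (h \<otimes>\<^bsub>Grp\<^esub> g)) p)"
      using h g p by (simp only: map_map_act rotate_map)
    then have "c = cyc_class (map (snd (h \<otimes>\<^bsub>Grp\<^esub> g)) p)"
      unfolding h by (intro cyc_class_eq) (auto simp: cyc_class_def)
    then show "c \<in> cyc_orbit p" using Grp_mult h g by (auto simp: cyc_orbit_def)
  qed
  show ?thesis using sub[OF p q eq] sub[OF q p eq[symmetric]] by blast
qed

lemma WG_pi:
  assumes p: "p \<in> cycles Q"
  shows "WG (cyc_class (map ao p)) = W (cyc_class p) * of_nat (card (cyc_orbit p))"
proof -
  have "{C \<in> orbits Grp (cyc Q) cyc_map. orbit_class Q G C = cyc_class (map ao p)} = {cyc_orbit p}"
  proof -
    have "C = cyc_orbit p"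
      if C: "C \<in> orbits Grp (cyc Q) cyc_map" "orbit_class Q G C = cyc_class (map ao p)" for C
    proof -
      obtain q where q: "q \<in> cycles Q" "C = cyc_orbit q" using C(1) unfolding orbits_cyc by blast
      show ?thesis
        unfolding q(2) using C(2) orbit_class_cyc_orbit[OF q(1)] q by (intro cyc_orbit_eqI p) simp_all
    qed
    moreover have "cyc_orbit p \<in> orbits Grp (cyc Q) cyc_map" unfolding orbits_cyc using p by blast
    ultimately show ?thesis using orbit_class_cyc_orbit[OF p] by blast
  qed
  \<comment> \<open>The class picked by \<open>SOME\<close> does not matter, since W is constant on
    the orbit.\<close>
  moreover have "W (SOME c. c \<in> cyc_orbit p) = W (cyc_class p)"
  proof -
    have "(SOME c. c \<in> cyc_orbit p) \<in> cyc_orbit p"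
      using Grp_one by (intro someI_ex[of "\<lambda>c. c \<in> cyc_orbit p"]) (auto simp: cyc_orbit_def)
    then show ?thesis using W_act[OF _ p] unfolding cyc_orbit_def by auto
  qed
  ultimately show ?thesis by (simp add: orbit_potential_def)
qed

text \<open>The support of the induced potential consists of classes with a closed lift; this
  disposes of the cycles that open up in Q.\<close>

lemma WG_nonzero:
  assumes "WG d \<noteq> 0" obtains p where "p \<in> cycles Q" "d = cyc_class (map ao p)" "W (cyc_class p) \<noteq> 0"
proof -
  have "\<exists>C. C \<in> orbits Grp (cyc Q) cyc_map \<and> orbit_class Q G C = d"
  proof (rule ccontr)
    assume "\<not> ?thesis"
    then have "{C \<in> orbits Grp (cyc Q) cyc_map. orbit_class Q G C = d} = {}" by blast
    then show False using assms by (simp only: orbit_potential_def sum.empty simp_thms)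
  qed
  then obtain p where "p \<in> cycles Q" "d = cyc_class (map ao p)"
    using orbit_class_cyc_orbit by (auto simp: orbits_cyc)
  then show ?thesis using that assms WG_pi[of p] by auto
qed

text \<open>The coefficient contributes the orbit length and the period contributes the order of the
  stabilizer; only their product is the same for all cycles.\<close>

lemma WG_pi_period:
  assumes "p \<in> cycles Q"
  shows "WG (cyc_class (map ao p)) * of_nat (period_count (map ao p))
    = of_nat (card G) * (W (cyc_class p) * of_nat (period_count p))"
  using WG_pi[OF assms] period_count_pi[OF assms] card_orbit_stab[OF assms]
  by (simp add: mult_ac flip: of_nat_mult)

lemma potential_deriv_pi:
  assumes \<alpha>: "\<alpha> \<in> arcs Q" and x: "x \<in> paths Q" "fst x = head Q \<alpha>"
  shows "potential_deriv QG WG (ao \<alpha>) (opath x) = of_nat (card G) * potential_deriv Q W \<alpha> x"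
proof (cases "tgt x = tail Q \<alpha>")
  case True
  then have p: "\<alpha> # snd x \<in> cycles Q" using \<alpha> x by (cases x) (simp add: cycles_Cons)
  then have "ao \<alpha> # map ao (snd x) \<in> cycles QG" using opath_cycles[OF p] by simp
  then show ?thesis
    using p x \<alpha> WG_pi_period[OF p] QG_ends[OF \<alpha>] by (cases x) (simp add: potential_deriv_eq O.potential_deriv_eq opath_def)
next
  case False
  \<comment> \<open>The path \<alpha> followed by x does not close up in Q, although its image may
    close up in the orbit quiver. A nonzero coefficient would provide a cycle with that image, and a
    rotated translate of it would have to be this very path.\<close>
  have "WG (cyc_class (ao \<alpha> # map ao (snd x))) = 0"
  proof (rule ccontr)
    assume "\<not> ?thesis"
    then obtain p where p: "p \<in> cycles Q" "cyc_class (ao \<alpha> # map ao (snd x)) = cyc_class (map ao p)"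
      by (rule WG_nonzero)
    then have "ao \<alpha> # map ao (snd x) \<in> cyc_class (map ao p)" using cyc_class_refl by metis
    then obtain i where "ao \<alpha> # map ao (snd x) = rotate i (map ao p)"
      unfolding cyc_class_def by blast
    then have i: "ao \<alpha> # map ao (snd x) = map ao (rotate i p)" by (simp only: rotate_map)
    obtain \<beta> s where \<beta>: "rotate i p = \<beta> # s" "ao \<alpha> = ao \<beta>" "map ao (snd x) = map ao s"
      using i by (cases "rotate i p") auto
    have cyc: "\<beta> # s \<in> cycles Q" using rotate_cycles[OF p(1), of i] \<beta> by simp
    then obtain g where g: "g \<in> G" "\<alpha> = snd g \<beta>"
      using ao_eqD[of \<beta> \<alpha>] \<beta> \<alpha> by (auto simp: cycles_Cons)
    have gc: "\<alpha> # map (snd g) s \<in> cycles Q" using map_cycles[OF g(1) cyc] g by simp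
    \<comment> \<open>Both are lifts of the same path from the head of \<alpha>.\<close>
    have "x = (head Q \<alpha>, map (snd g) s)"
      using gc x \<beta>(3) map_ao_act[OF g(1) cyc]
      by (intro opath_inj) (auto simp: cycles_Cons opath_def)
    then show False using gc False by (simp add: cycles_Cons)
  qed
  moreover have "potential_deriv Q W \<alpha> x = 0" using False potential_deriv_nonzero(3) by blast
  ultimately show ?thesis by (cases x) (simp add: O.potential_deriv_eq opath_def)
qed

end

section \<open>Projection and lifting of series\<close>

lemma (in quiver) sum_mem_ideal:
  fixes J :: "(('v, 'e) path \<Rightarrow> 'k::field) set"
  assumes "ideal J A" "finite I" "\<And>i. i \<in> I \<Longrightarrow> f i \<in> J"
  shows "(\<lambda>x. \<Sum>i\<in>I. f i x) \<in> J"
proof -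
  interpret J: ideal J A by (rule assms(1))
  show ?thesis using assms(2,3)
  proof (induction I rule: finite_induct)
    case (insert i I)
    then show ?case using J.a_closed[of "f i" "\<lambda>x. \<Sum>i\<in>I. f i x"] by (simp add: path_algebra_simps)
  qed (use J.zero_closed in \<open>simp add: path_algebra_simps\<close>)
qed

lemma (in quiver) restr_in_ideal:
  assumes "ideal J A" "f \<in> J" "a \<in> verts Q" "b \<in> verts Q"
  shows "restr a b f \<in> J"
proof -
  interpret J: ideal J A by (rule assms(1))
  have "f \<in> carrier A" using assms(2) by (rule J.a_Hcarr)
  then show ?thesis
    unfolding restr_eq[OF \<open>f \<in> carrier A\<close>]
    using assms by (intro J.I_l_closed J.I_r_closed) (auto simp: vertex_elem_closed)
qed

context qp_action
begin

text \<open>The fibres are finite (\<open>finite_fibre\<close>); over an infinite one the sum would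
  take its default value 0.\<close>

definition proj :: "(('v, 'e) path \<Rightarrow> 'k) \<Rightarrow> ('v set, 'e set) path \<Rightarrow> 'k" where
  "proj f y = (\<Sum>x\<in>{x \<in> paths Q. opath x = y}. f x)"

text \<open>A path of the orbit quiver has at most one lift from a. The condition on the target cuts
  the lifted series down to its component in Hom(a,b), which is zero unless some lifts end at
  b.\<close>

definition lift_hom :: "'v \<Rightarrow> 'v \<Rightarrow> (('v set, 'e set) path \<Rightarrow> 'k) \<Rightarrow> ('v, 'e) path \<Rightarrow> 'k" where
  "lift_hom a b f x = (if x \<in> paths Q \<and> fst x = a \<and> tgt x = b then f (opath x) else 0)"

lemma finite_fibre: "finite {x \<in> paths Q. opath x = y}"
  by (rule finite_subset[OF _ finite_paths[of "Suc (length (snd y))"]]) (auto simp: opath_def)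

lemma proj_zero: "proj (\<lambda>_. 0) = (\<lambda>_. 0)"
  and proj_add: "proj (\<lambda>x. f x + h x) = (\<lambda>y. proj f y + proj h y)"
  and proj_smult: "proj (\<lambda>x. r * f x) = (\<lambda>y. r * proj f y)"
  and proj_sum: "proj (\<lambda>x. \<Sum>i\<in>I. F i x) = (\<lambda>y. \<Sum>i\<in>I. proj (F i) y)"
  unfolding proj_def fun_eq_iff by (simp_all add: sum.distrib sum_distrib_left sum.swap[of _ I])

lemma lift_hom_zero: "lift_hom a b (\<lambda>_. 0) = (\<lambda>_. 0)"
  and lift_hom_add: "lift_hom a b (\<lambda>x. f x + h x) = (\<lambda>y. lift_hom a b f y + lift_hom a b h y)"
  and lift_hom_sum: "lift_hom a b (\<lambda>x. \<Sum>i\<in>I. F i x) = (\<lambda>y. \<Sum>i\<in>I. lift_hom a b (F i) y)"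
  unfolding lift_hom_def fun_eq_iff by (auto simp del: split_paired_All intro!: sum.neutral)

text \<open>Lifts from a are unique, so only one member of the fibre can lie in the support of
  f.\<close>

lemma proj_pi:
  assumes "a \<in> verts Q" "b \<in> verts Q" "f \<in> Mor PC a b" "x \<in> paths Q" "fst x = a"
  shows "proj f (opath x) = f x"
proof -
  have f: "f z \<noteq> 0 \<Longrightarrow> fst z = a" for z
    using assms(3) unfolding Mor_path_category[OF assms(1,2)] by blast
  have "f z = 0" if "z \<in> {z \<in> paths Q. opath z = opath x} - {x}" for z
    using that assms(4,5) opath_inj[of z x] f[of z] by auto
  then have "proj f (opath x) = sum f {x}"
    unfolding proj_def using assms by (intro sum.mono_neutral_right finite_fibre) auto
  then show ?thesis by simp
qed

lemma proj_nonzero: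
  assumes "a \<in> verts Q" "b \<in> verts Q" "f \<in> Mor PC a b" "proj f y \<noteq> 0"
  obtains x where "x \<in> paths Q" "fst x = a" "tgt x = b" "opath x = y" "f x \<noteq> 0"
proof -
  from assms(4)[unfolded proj_def] obtain x where x: "x \<in> {x \<in> paths Q. opath x = y}" "f x \<noteq> 0"
    by (rule sum.not_neutral_contains_not_neutral)
  moreover have "fst x = a \<and> tgt x = b"
    using assms(3) x(2) unfolding Mor_path_category[OF assms(1,2)] by blast
  ultimately show ?thesis using that by blast
qed

lemma vo_verts: "a \<in> verts Q \<Longrightarrow> vo a \<in> verts QG"
  by (simp add: QG_simps)

lemma proj_Mor:
  assumes "a \<in> verts Q" "b \<in> verts Q" "f \<in> Mor PC a b"
  shows "proj f \<in> Mor O.PC (vo a) (vo b)"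
  unfolding O.Mor_path_category[OF vo_verts[OF assms(1)] vo_verts[OF assms(2)]]
  using proj_nonzero[OF assms] opath_paths opath_simps(2) by metis

lemma lift_hom_Mor:
  assumes "a \<in> verts Q" "b \<in> verts Q"
  shows "lift_hom a b f \<in> Mor PC a b"
  unfolding Mor_path_category[OF assms] by (auto simp: lift_hom_def simp del: split_paired_All split: if_splits)

text \<open>Lifting with a prescribed start vertex is compatible with splitting a path, which makes
  the projection multiplicative on composable morphisms (but not on the whole algebra).\<close>

lemma proj_mult:
  assumes v: "a \<in> verts Q" "b \<in> verts Q" "c \<in> verts Q"
    and f: "f \<in> Mor PC b c" and h: "h \<in> Mor PC a b"
  shows "proj (f \<otimes>\<^bsub>A\<^esub> h) = proj f \<otimes>\<^bsub>O.A\<^esub> proj h"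
proof
  fix y :: "('v set, 'e set) path"
  have fh: "f \<otimes>\<^bsub>A\<^esub> h \<in> Mor PC a c"
    using PC.cmp_closed[OF _ _ _ h f] v by (simp add: path_category_simps)
  obtain u q where y: "y = (u, q)" by (cases y)
  show "proj (f \<otimes>\<^bsub>A\<^esub> h) y = (proj f \<otimes>\<^bsub>O.A\<^esub> proj h) y"
  proof (cases "\<exists>x. x \<in> paths Q \<and> fst x = a \<and> opath x = y")
    case True
    then obtain p where p: "(a, p) \<in> paths Q" "opath (a, p) = y" by (metis prod.collapse)
    have yp: "y \<in> paths QG" "u = vo a" "q = map ao p" using opath_paths[OF p(1)] p(2) y by (auto simp: opath_def)
    have "f (awlast a (take i p), drop i p) * h (a, take i p)
      = proj f (O.awlast u (take i q), drop i q) * proj h (u, take i q)" for i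
    proof -
      have i: "(a, take i p) \<in> paths Q" "(awlast a (take i p), drop i p) \<in> paths Q"
        using p(1) paths_take_drop by blast+
      have pi1: "(u, take i q) = opath (a, take i p)" by (simp add: yp opath_def take_map)
      then have pi2: "(O.awlast u (take i q), drop i q) = opath (awlast a (take i p), drop i p)"
        using opath_paths[OF i(1)] by (simp add: yp opath_def drop_map)
      have ph: "proj h (u, take i q) = h (a, take i p)"
        unfolding pi1 using v h i by (intro proj_pi[of a b]) auto
      show ?thesis
      proof (cases "awlast a (take i p) = b")
        case True
        then have "proj f (O.awlast u (take i q), drop i q) = f (awlast a (take i p), drop i p)"
          unfolding pi2 using v f i by (intro proj_pi[of b c]) auto
        then show ?thesis by (simp add: ph)
      next
        case False
        \<comment> \<open>Here \<open>proj f\<close> may be nonzero because of another lift of the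
          final segment, but the factor from h vanishes.\<close>
        then have "h (a, take i p) = 0"
          using h unfolding Mor_path_category[OF v(1,2)] by (metis fst_conv snd_conv)
        then show ?thesis by (simp add: ph)
      qed
    qed
    moreover have "proj (f \<otimes>\<^bsub>A\<^esub> h) y = (f \<otimes>\<^bsub>A\<^esub> h) (a, p)"
      using proj_pi[OF v(1,3) fh p(1)] p(2) by simp
    ultimately show ?thesis
      using p(1) yp(1) by (simp add: y path_algebra_mult O.path_algebra_mult yp(3))
  next
    case False
    then have "proj (f \<otimes>\<^bsub>A\<^esub> h) y = 0" using proj_nonzero[OF v(1,3) fh] by metis
    \<comment> \<open>A nonzero term would give a lift of the initial segment from a to b and a lift
      of the final segment from b; joined, they lift y from a.\<close>
    moreover have "proj f (O.awlast u (take i q), drop i q) * proj h (u, take i q) = 0" for i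
    proof (rule ccontr)
      assume "\<not> ?thesis"
      then have nz: "proj f (O.awlast u (take i q), drop i q) \<noteq> 0" "proj h (u, take i q) \<noteq> 0" by auto
      obtain r where r: "(a, r) \<in> paths Q" "awlast a r = b" "opath (a, r) = (u, take i q)"
        using proj_nonzero[OF v(1,2) h nz(2)] by (metis prod.collapse)
      obtain s where s: "(b, s) \<in> paths Q" "opath (b, s) = (O.awlast u (take i q), drop i q)"
        using proj_nonzero[OF v(2,3) f nz(1)] by (metis prod.collapse)
      have "(a, r @ s) \<in> paths Q" using r s by (simp add: paths_append_iff)
      moreover have "opath (a, r @ s) = y" using r s by (simp add: opath_def y)
      ultimately show False using False by force
    qed
    ultimately show ?thesis by (simp add: y O.path_algebra_mult sum.neutral del: mult_eq_0_iff)
  qed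
qed

lemma proj_path_elem: "x \<in> paths Q \<Longrightarrow> proj (path_elem x) = path_elem (opath x)"
proof
  fix y assume x: "x \<in> paths Q"
  show "proj (path_elem x) y = path_elem (opath x) y"
    using x finite_fibre[of y] by (auto simp: proj_def path_elem_def)
qed

text \<open>Lifting is a left inverse of projection on each Hom space and kills the components with
  another end. This separates the summands of the covering map and so yields injectivity.\<close>

lemma lift_hom_proj:
  assumes "a \<in> verts Q" "b \<in> verts Q" "f \<in> Mor PC a b"
  shows "lift_hom a c (proj f) = (if b = c then f else (\<lambda>_. 0))"
proof
  fix x
  have f: "f x \<noteq> 0 \<Longrightarrow> x \<in> paths Q \<and> fst x = a \<and> tgt x = b"
    using assms(3) unfolding Mor_path_category[OF assms(1,2)] by blast
  show "lift_hom a c (proj f) x = (if b = c then f else (\<lambda>_. 0)) x"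
    using proj_pi[OF assms, of x] f by (cases "f x = 0") (auto simp: lift_hom_def)
qed

text \<open>The lift of y from a ends at gb for exactly one g, by freeness, so each coefficient is
  recovered once. This yields surjectivity of the covering map.\<close>

lemma sum_proj_lam:
  assumes ab: "a \<in> verts Q" "b \<in> verts Q" and f: "f \<in> Mor O.PC (vo a) (vo b)"
  shows "(\<lambda>y. \<Sum>g\<in>G. proj (lift_hom a (fst g b) f) y) = f"
proof
  fix y
  have fy: "f y \<noteq> 0 \<Longrightarrow> y \<in> paths QG \<and> fst y = vo a \<and> O.tgt y = vo b"
    using f unfolding O.Mor_path_category[OF vo_verts[OF ab(1)] vo_verts[OF ab(2)]] by blast
  show "(\<Sum>g\<in>G. proj (lift_hom a (fst g b) f) y) = f y"
  proof (cases "\<exists>x. x \<in> paths Q \<and> fst x = a \<and> opath x = y")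
    case True
    then obtain x where x: "x \<in> paths Q" "fst x = a" "opath x = y" by blast
    have p: "proj (lift_hom a (fst g b) f) y = (if tgt x = fst g b then f y else 0)" if "g \<in> G" for g
      using proj_pi[OF ab(1) act_verts[OF that ab(2)] lift_hom_Mor x(1,2)] ab act_verts that x
      by (simp add: lift_hom_def)
    show ?thesis
    proof (cases "f y = 0")
      case False
      then have "vo b = vo (tgt x)" using fy opath_paths[OF x(1)] x by auto
      then obtain h where h: "h \<in> G" "tgt x = fst h b" using vo_eqD ab paths_ends(2)[OF x(1)] by blast
      have "tgt x = fst g b \<longleftrightarrow> g = h" if "g \<in> G" for g
        using free[OF that h(1) ab(2)] h(2) by metis
      then have "(\<Sum>g\<in>G. proj (lift_hom a (fst g b) f) y) = (\<Sum>g\<in>G. if g = h then f y else 0)"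
        using p by (intro sum.cong) auto
      then show ?thesis using h finite_G by simp
    qed (auto simp: p intro!: sum.neutral)
  next
    case False
    then have "proj (lift_hom a (fst g b) f) y = 0" if "g \<in> G" for g
      using proj_nonzero[OF ab(1) act_verts[OF that ab(2)] lift_hom_Mor] ab act_verts that by metis
    moreover have "f y = 0" using fy False opath_lift[of y a] ab by metis
    ultimately show ?thesis by simp
  qed
qed

text \<open>Every cut of a lift from a passes through a single vertex c of Q. Summing over c turns
  lifting into a homomorphism to matrices indexed by the vertices, with arbitrary series u and
  f.\<close>

lemma lift_hom_mult:
  assumes "a \<in> verts Q"
  shows "lift_hom a b (u \<otimes>\<^bsub>O.A\<^esub> f) = (\<lambda>x. \<Sum>c\<in>verts Q. (lift_hom c b u \<otimes>\<^bsub>A\<^esub> lift_hom a c f) x)"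
proof
  fix x :: "('v, 'e) path"
  obtain v p where x: "x = (v, p)" by (cases x)
  show "lift_hom a b (u \<otimes>\<^bsub>O.A\<^esub> f) x = (\<Sum>c\<in>verts Q. (lift_hom c b u \<otimes>\<^bsub>A\<^esub> lift_hom a c f) x)"
  proof (cases "x \<in> paths Q")
    case True
    have i: "(v, take i p) \<in> paths Q" "(awlast v (take i p), drop i p) \<in> paths Q"
      "awlast v (take i p) \<in> verts Q" for i
      using True x paths_take_drop[of v p i] paths_ends(2)[of "(v, take i p)"] by auto
    have "(\<Sum>c\<in>verts Q. (lift_hom c b u \<otimes>\<^bsub>A\<^esub> lift_hom a c f) x)
      = (\<Sum>c\<in>verts Q. \<Sum>i\<le>length p. if awlast v (take i p) = c then
          (if v = a \<and> awlast v p = b then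
            u (opath (awlast v (take i p), drop i p)) * f (opath (v, take i p)) else 0) else 0)"
      using True i by (intro sum.cong refl)
        (auto simp: x path_algebra_mult lift_hom_def awlast_take_drop intro!: sum.cong)
    also have "\<dots> = (\<Sum>i\<le>length p. if v = a \<and> awlast v p = b
        then u (opath (awlast v (take i p), drop i p)) * f (opath (v, take i p)) else 0)"
      using i by (subst sum.swap) simp
    also have "\<dots> = lift_hom a b (u \<otimes>\<^bsub>O.A\<^esub> f) x"
    proof (cases "v = a \<and> awlast v p = b")
      case True
      then have [simp]: "a = v" "b = awlast v p" by auto
      have "vo (awlast v (take i p)) = O.awlast (vo v) (take i (map ao p))" for i
        using opath_paths[OF i(1)[of i]] by (simp add: opath_simps take_map)
      moreover have "(vo v, map ao p) \<in> paths QG"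
        using opath_paths[of "(v, p)"] \<open>x \<in> paths Q\<close> by (simp add: x opath_simps)
      ultimately show ?thesis
        using \<open>x \<in> paths Q\<close> by (simp add: x lift_hom_def O.path_algebra_mult opath_simps take_map drop_map)
    qed (auto simp: x lift_hom_def intro!: sum.neutral)
    finally show ?thesis ..
  qed (simp add: x path_algebra_mult lift_hom_def)
qed

section \<open>Compatibility with the Jacobian ideals\<close>

abbreviation JI :: "(('v, 'e) path \<Rightarrow> 'k) set" where "JI \<equiv> jacobian_ideal Q W"
abbreviation JIG :: "(('v set, 'e set) path \<Rightarrow> 'k) set" where "JIG \<equiv> jacobian_ideal QG WG"

text \<open>Projection preserves the lengths of paths, hence congruences.\<close>

lemma agree_proj: "agree n f h \<Longrightarrow> O.agree n (proj f) (proj h)"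
  unfolding agree_def O.agree_def proj_def by (intro allI impI sum.cong refl) (auto simp: opath_def)

lemma agree_restr: "agree n f h \<Longrightarrow> agree n (restr a b f) (restr a b h)"
  by (auto simp: agree_def restr_def simp del: split_paired_All)

lemma agree_lam: "O.agree n f h \<Longrightarrow> agree n (lift_hom a b f) (lift_hom a b h)"
  unfolding agree_def O.agree_def lift_hom_def by (intro allI impI) (auto simp: opath_def)

lemma restr_potential_deriv:
  "restr a b (potential_deriv Q W \<alpha>)
    = (if a = head Q \<alpha> \<and> b = tail Q \<alpha> then potential_deriv Q W \<alpha> else (\<lambda>_. 0))"
  using potential_deriv_nonzero[of W \<alpha>] by (fastforce simp: restr_def fun_eq_iff simp del: split_paired_All)

lemma potential_deriv_Mor:
  assumes "\<alpha> \<in> arcs Q" shows "potential_deriv Q W \<alpha> \<in> Mor PC (head Q \<alpha>) (tail Q \<alpha>)"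
  unfolding Mor_path_category[OF head_in_verts[OF assms] tail_in_verts[OF assms]]
  using potential_deriv_nonzero by blast

lemma potential_deriv_QG:
  assumes \<alpha>: "\<alpha> \<in> arcs Q"
  shows "potential_deriv QG WG (ao \<alpha>) = (\<lambda>y. of_nat (card G) * proj (potential_deriv Q W \<alpha>) y)"
proof
  fix y
  note m = head_in_verts[OF \<alpha>] tail_in_verts[OF \<alpha>] potential_deriv_Mor[OF \<alpha>]
  show "potential_deriv QG WG (ao \<alpha>) y = of_nat (card G) * proj (potential_deriv Q W \<alpha>) y"
  proof (cases "\<exists>x. x \<in> paths Q \<and> fst x = head Q \<alpha> \<and> opath x = y")
    case True
    then obtain x where "x \<in> paths Q" "fst x = head Q \<alpha>" "opath x = y" by blast
    then show ?thesis using potential_deriv_pi[OF \<alpha>, of x] proj_pi[OF m, of x] by simp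
  next
    case False
    then have "potential_deriv QG WG (ao \<alpha>) y = 0"
      using O.potential_deriv_nonzero(1,2)[of WG "ao \<alpha>" y] QG_ends(2)[OF \<alpha>] opath_lift[of y "head Q \<alpha>"] m(1)
      by metis
    moreover have "proj (potential_deriv Q W \<alpha>) y = 0" using False proj_nonzero[OF m] by metis
    ultimately show ?thesis by simp
  qed
qed

lemma proj_in_JIG:
  assumes char: "of_nat (card G) \<noteq> (0 :: 'k)" and f: "f \<in> JI" and ab: "a \<in> verts Q" "b \<in> verts Q"
  shows "proj (restr a b f) \<in> JIG"
proof -
  let ?S = "{f \<in> carrier A. \<forall>a\<in>verts Q. \<forall>b\<in>verts Q. proj (restr a b f) \<in> JIG}"
  have restr_add: "restr a b (\<lambda>x. f x + h x) = (\<lambda>x. restr a b f x + restr a b h x)" for a b f h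
    by (auto simp: restr_def)
  \<comment> \<open>Each term of the matrix product is a composite of morphisms, where
    \<open>proj\<close> is multiplicative. This is what lets \<open>?S\<close> absorb factors on
    both sides.\<close>
  have pmult: "proj (restr a b (f \<otimes>\<^bsub>A\<^esub> h))
      = (\<lambda>y. \<Sum>c\<in>verts Q. (proj (restr c b f) \<otimes>\<^bsub>O.A\<^esub> proj (restr a c h)) y)"
    if "a \<in> verts Q" "b \<in> verts Q" "f \<in> carrier A" "h \<in> carrier A" for a b f h
    unfolding restr_mult proj_sum using that by (intro ext sum.cong refl) (simp add: proj_mult[of a _ b] restr_in_Mor)
  have pclosed: "proj (restr a b f) \<in> carrier O.A" if "a \<in> verts Q" "b \<in> verts Q" "f \<in> carrier A" for a b f
    using O.Mor_carrier[OF _ _ proj_Mor[OF that(1,2) restr_in_Mor[OF that(3,1,2)]]] vo_verts that by blast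
  have "ideal ?S A"
  proof (rule A.A.ideal_of_closed_set)
    show "\<zero>\<^bsub>A\<^esub> \<in> ?S"
      using O.J.I.zero_closed[of WG] A.A.zero_closed by (simp add: path_algebra_simps O.path_algebra_simps restr_def proj_zero)
    show "f \<oplus>\<^bsub>A\<^esub> h \<in> ?S" if "f \<in> ?S" "h \<in> ?S" for f h
      using that A.A.a_closed[of f h] O.J.I.a_closed[of _ WG]
      by (simp add: path_algebra_simps O.path_algebra_simps restr_add proj_add)
    show "u \<otimes>\<^bsub>A\<^esub> f \<in> ?S" if "f \<in> ?S" "u \<in> carrier A" for f u
      using that pclosed
      by (auto simp: mult_closed pmult intro!: O.sum_mem_ideal O.ideal_jacobian O.J.I.I_l_closed)
    show "f \<otimes>\<^bsub>A\<^esub> u \<in> ?S" if "f \<in> ?S" "u \<in> carrier A" for f u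
      using that pclosed
      by (auto simp: mult_closed pmult intro!: O.sum_mem_ideal O.ideal_jacobian O.J.I.I_r_closed)
  qed auto
  moreover have "f \<in> ?S" if f: "f \<in> carrier A" "\<forall>n. \<exists>h\<in>?S. agree n f h" for f
  proof -
    have "proj (restr a b f) \<in> JIG" if ab: "a \<in> verts Q" "b \<in> verts Q" for a b
    proof -
      have "\<exists>h\<in>JIG. O.agree n (proj (restr a b f)) h" for n
      proof -
        obtain h where "h \<in> ?S" "agree n f h" using f(2) by blast
        then show ?thesis using agree_proj agree_restr ab by blast
      qed
      then show ?thesis using O.closed_ideal_jacobian[of WG] pclosed[OF ab f(1)]
        unfolding O.closed_ideal_def by blast
    qed
    then show ?thesis using f(1) by simp
  qed
  ultimately have "closed_ideal ?S" unfolding closed_ideal_def by blast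
  moreover have "potential_deriv Q W \<alpha> \<in> ?S" if \<alpha>: "\<alpha> \<in> arcs Q" for \<alpha>
  proof -
    have "potential_deriv QG WG (ao \<alpha>) \<in> JIG"
      using \<alpha> by (intro O.potential_deriv_in_jacobian_ideal) (simp add: QG_simps)
    \<comment> \<open>This scalar cancels the factor |G| in \<open>potential_deriv_QG\<close>; here
      the condition on the characteristic enters.\<close>
    then have "(1 / of_nat (card G)) \<odot>\<^bsub>O.A\<^esub> potential_deriv QG WG (ao \<alpha>) \<in> JIG"
      by (intro O.J.smult_mem) (auto simp: ring_of_type_algebra_def)
    then have "proj (potential_deriv Q W \<alpha>) \<in> JIG"
      using char by (simp add: potential_deriv_QG[OF \<alpha>] O.path_algebra_simps)
    then show ?thesis using O.J.I.zero_closed[of WG]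
      by (simp add: potential_deriv_closed restr_potential_deriv proj_zero O.path_algebra_simps)
  qed
  ultimately have "JI \<subseteq> ?S" by (intro jacobian_ideal_minimal)
  then show ?thesis using f ab by blast
qed

lemma lift_hom_in_JI:
  assumes f: "f \<in> JIG" and ab: "a \<in> verts Q" "b \<in> verts Q"
  shows "lift_hom a b f \<in> JI"
proof -
  let ?T = "{f \<in> carrier O.A. \<forall>a\<in>verts Q. \<forall>b\<in>verts Q. lift_hom a b f \<in> JI}"
  have closed: "lift_hom a b f \<in> carrier A" if "a \<in> verts Q" "b \<in> verts Q" for a b f
    using Mor_carrier[OF that lift_hom_Mor[OF that]] .
  have "ideal ?T O.A"
  proof (rule O.A.A.ideal_of_closed_set)
    show "\<zero>\<^bsub>O.A\<^esub> \<in> ?T"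
      using J.I.zero_closed[of W] O.A.A.zero_closed by (simp add: path_algebra_simps O.path_algebra_simps lift_hom_zero)
    show "f \<oplus>\<^bsub>O.A\<^esub> h \<in> ?T" if "f \<in> ?T" "h \<in> ?T" for f h
      using that O.A.A.a_closed[of f h] J.I.a_closed[of _ W]
      by (simp add: path_algebra_simps O.path_algebra_simps lift_hom_add)
    show "u \<otimes>\<^bsub>O.A\<^esub> f \<in> ?T" if "f \<in> ?T" "u \<in> carrier O.A" for f u
      using that closed
      by (auto simp: O.mult_closed lift_hom_mult intro!: sum_mem_ideal ideal_jacobian J.I.I_l_closed)
    show "f \<otimes>\<^bsub>O.A\<^esub> u \<in> ?T" if "f \<in> ?T" "u \<in> carrier O.A" for f u
      using that closed
      by (auto simp: O.mult_closed lift_hom_mult intro!: sum_mem_ideal ideal_jacobian J.I.I_r_closed)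
  qed auto
  moreover have "f \<in> ?T" if f: "f \<in> carrier O.A" "\<forall>n. \<exists>h\<in>?T. O.agree n f h" for f
  proof -
    have "lift_hom a b f \<in> JI" if ab: "a \<in> verts Q" "b \<in> verts Q" for a b
    proof -
      have "\<exists>h\<in>JI. agree n (lift_hom a b f) h" for n
      proof -
        obtain h where "h \<in> ?T" "O.agree n f h" using f(2) by blast
        then show ?thesis using agree_lam ab by blast
      qed
      then show ?thesis using closed_ideal_jacobian[of W] closed[OF ab]
        unfolding closed_ideal_def by blast
    qed
    then show ?thesis using f(1) by simp
  qed
  ultimately have "O.closed_ideal ?T" unfolding O.closed_ideal_def by blast
  moreover have "potential_deriv QG WG \<gamma> \<in> ?T" if \<gamma>: "\<gamma> \<in> arcs QG" for \<gamma>
  proof -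
    have "lift_hom a b (potential_deriv QG WG \<gamma>) \<in> JI" if ab: "a \<in> verts Q" "b \<in> verts Q" for a b
    proof (cases "\<exists>\<alpha>\<in>arcs Q. ao \<alpha> = \<gamma> \<and> head Q \<alpha> = a")
      case True
      then obtain \<alpha> where \<alpha>: "\<alpha> \<in> arcs Q" "ao \<alpha> = \<gamma>" "head Q \<alpha> = a" by blast
      \<comment> \<open>An arrow of the orbit with head a supplies the derivative seen by lifts from
        a; the factor |G| is merely a scalar, and the ideal is closed under scalars.\<close>
      have eq: "lift_hom a b (potential_deriv QG WG \<gamma>)
          = of_nat (card G) \<odot>\<^bsub>A\<^esub> restr a b (potential_deriv Q W \<alpha>)"
      proof
        fix x
        show "lift_hom a b (potential_deriv QG WG \<gamma>) x
          = (of_nat (card G) \<odot>\<^bsub>A\<^esub> restr a b (potential_deriv Q W \<alpha>)) x"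
          using potential_deriv_pi[OF \<alpha>(1), of x] \<alpha> potential_deriv_nonzero(1)[of W \<alpha> x]
          by (auto simp: lift_hom_def path_algebra_simps restr_def)
      qed
      show ?thesis unfolding eq
        using \<alpha> ab by (intro J.smult_mem restr_in_ideal ideal_jacobian potential_deriv_in_jacobian_ideal)
          (auto simp: ring_of_type_algebra_def)
    next
      case False
      obtain \<beta> where \<beta>: "\<beta> \<in> arcs Q" "\<gamma> = ao \<beta>" using \<gamma> by (auto simp: QG_simps)
      \<comment> \<open>Paths in the support of the derivative start at the head of \<gamma>. If a
        lies in that vertex orbit, some translate of \<beta> has head a, which this case
        excludes.\<close>
      have "lift_hom a b (potential_deriv QG WG \<gamma>) x = 0" for x
      proof (rule ccontr)
        assume "\<not> ?thesis"
        then have x: "fst x = a" "potential_deriv QG WG \<gamma> (opath x) \<noteq> 0"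
          by (auto simp: lift_hom_def split: if_splits)
        then have "vo a = vo (head Q \<beta>)"
          using O.potential_deriv_nonzero(2)[OF x(2)] QG_ends(2)[OF \<beta>(1)] \<beta> by (simp add: opath_def)
        then obtain g where "g \<in> G" "a = fst g (head Q \<beta>)" using vo_eqD ab \<beta> by (metis head_in_verts)
        then have "snd g \<beta> \<in> arcs Q" "ao (snd g \<beta>) = \<gamma>" "head Q (snd g \<beta>) = a"
          using \<beta> by (simp_all add: act_arcs ao_act act_head)
        then show False using False by blast
      qed
      then have "lift_hom a b (potential_deriv QG WG \<gamma>) = (\<lambda>_. 0)" by blast
      then show ?thesis using J.I.zero_closed[of W] by (simp add: path_algebra_simps)
    qed
    then show ?thesis by (simp add: O.potential_deriv_closed)
  qed
  ultimately have "JIG \<subseteq> ?T" by (intro O.jacobian_ideal_minimal)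
  then show ?thesis using f ab by blast
qed

end

section \<open>The group actions\<close>

context qp_action
begin

abbreviation pact :: "('v, 'e) quiver_map \<Rightarrow> (('v, 'e) path \<Rightarrow> 'k) \<Rightarrow> ('v, 'e) path \<Rightarrow> 'k" where
  "pact \<equiv> path_action Q"

lemma pact_eq:
  "g \<in> G \<Longrightarrow> pact g f x = (if x \<in> paths Q then f (path_map (inv\<^bsub>Grp\<^esub> g) x) else 0)"
  by (simp add: path_action_def inv_bij_group)

lemma pact_add: "pact g (\<lambda>x. f x + h x) = (\<lambda>x. pact g f x + pact g h x)"
  and pact_smult: "pact g (\<lambda>x. r * f x) = (\<lambda>x. r * pact g f x)"
  and pact_sum: "pact g (\<lambda>x. \<Sum>i\<in>I. F i x) = (\<lambda>x. \<Sum>i\<in>I. pact g (F i) x)"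
  unfolding path_action_def fun_eq_iff by (simp_all del: split_paired_All)

lemma pact_mult_group:
  assumes "g \<in> G" "h \<in> G" shows "pact (g \<otimes>\<^bsub>Grp\<^esub> h) f = pact g (pact h f)"
proof
  fix x
  have inv: "inv\<^bsub>Grp\<^esub> (g \<otimes>\<^bsub>Grp\<^esub> h) = inv\<^bsub>Grp\<^esub> h \<otimes>\<^bsub>Grp\<^esub> inv\<^bsub>Grp\<^esub> g"
    using assms by (simp add: Grp.inv_mult_group carrier_Grp)
  show "pact (g \<otimes>\<^bsub>Grp\<^esub> h) f x = pact g (pact h f) x"
    using assms path_map_paths[of "inv\<^bsub>Grp\<^esub> g" x]
    by (simp add: pact_eq Grp_mult Grp_inv inv path_map_mult)
qed

lemma pact_one: "f \<in> carrier A \<Longrightarrow> pact \<one>\<^bsub>Grp\<^esub> f = f"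
  by (auto simp: fun_eq_iff pact_eq Grp_one path_map_one carrier_path_algebra simp del: split_paired_All)

lemma pact_inv:
  assumes "g \<in> G" "f \<in> carrier A" shows "pact g (pact (inv\<^bsub>Grp\<^esub> g) f) = f"
  using assms pact_mult_group[of g "inv\<^bsub>Grp\<^esub> g" f] by (simp add: Grp_inv carrier_Grp pact_one)

text \<open>The translate gf is supported on paths from ga to gb, where lifts are unique, and
  translation does not change images. The lemma reduces questions about the action to projection and
  lifting.\<close>

lemma pact_eq_lam:
  assumes g: "g \<in> G" and ab: "a \<in> verts Q" "b \<in> verts Q" and f: "f \<in> Mor PC a b"
  shows "pact g f = lift_hom (fst g a) (fst g b) (proj f)"
proof
  fix x
  show "pact g f x = lift_hom (fst g a) (fst g b) (proj f) x"
  proof (cases "x \<in> paths Q")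
    case True
    let ?z = "path_map (inv\<^bsub>Grp\<^esub> g) x"
    have z: "?z \<in> paths Q" "tgt ?z = fst (inv\<^bsub>Grp\<^esub> g) (tgt x)" "opath ?z = opath x"
      "fst ?z = fst (inv\<^bsub>Grp\<^esub> g) (fst x)"
      using path_map_paths[OF Grp_inv[OF g] True] by (simp_all add: path_map_def)
    have inv: "fst (inv\<^bsub>Grp\<^esub> g) w = v \<longleftrightarrow> w = fst g v" if "w \<in> verts Q" "v \<in> verts Q" for v w
      using act_inv(1)[OF g that(2)] act_inv(2)[OF g that(1)] by auto
    have ends1: "fst ?z = a \<longleftrightarrow> fst x = fst g a"
      unfolding z(4) by (rule inv[OF paths_ends(1)[OF True] ab(1)])
    have ends2: "tgt ?z = b \<longleftrightarrow> tgt x = fst g b"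
      unfolding z(2) by (rule inv[OF paths_ends(2)[OF True] ab(2)])
    note ends = ends1 ends2
    have nz: "f ?z \<noteq> 0 \<Longrightarrow> fst ?z = a \<and> tgt ?z = b"
      using f unfolding Mor_path_category[OF ab] by blast
    show ?thesis
      using proj_pi[OF ab f z(1)] nz ends z(3) True by (auto simp: pact_eq[OF g] lift_hom_def)
  qed (simp add: pact_eq[OF g] lift_hom_def)
qed

lemma pact_Mor:
  assumes "g \<in> G" "a \<in> verts Q" "b \<in> verts Q" "f \<in> Mor PC a b"
  shows "pact g f \<in> Mor PC (fst g a) (fst g b)"
  using assms by (simp add: pact_eq_lam lift_hom_Mor act_verts)

lemma proj_pact:
  assumes g: "g \<in> G" and ab: "a \<in> verts Q" "b \<in> verts Q" and f: "f \<in> Mor PC a b"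
  shows "proj (pact g f) = proj f"
proof
  fix y
  note gab = act_verts[OF g ab(1)] act_verts[OF g ab(2)]
  show "proj (pact g f) y = proj f y"
  proof (cases "\<exists>x. x \<in> paths Q \<and> fst x = a \<and> opath x = y")
    case True
    then obtain x where x: "x \<in> paths Q" "fst x = a" "opath x = y" by blast
    let ?z = "path_map g x"
    have z: "?z \<in> paths Q" "opath ?z = y" "fst ?z = fst g a"
      using path_map_paths[OF g x(1)] x by (simp_all add: path_map_def)
    have "proj (pact g f) y = pact g f ?z"
      using proj_pi[OF gab pact_Mor[OF g ab f] z(1,3)] z(2) by simp
    also have "\<dots> = f x" using z x g by (simp add: pact_eq path_map_inv)
    also have "\<dots> = proj f y" using proj_pi[OF ab f x(1,2)] x(3) by simp
    finally show ?thesis .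
  next
    case False
    then have "proj f y = 0" using proj_nonzero[OF ab f] by metis
    moreover have "proj (pact g f) y = 0"
    proof (rule ccontr)
      assume "proj (pact g f) y \<noteq> 0"
      then obtain z where z: "z \<in> paths Q" "fst z = fst g a" "opath z = y"
        using proj_nonzero[OF gab pact_Mor[OF g ab f]] by metis
      then have "fst (path_map (inv\<^bsub>Grp\<^esub> g) z) = a"
        using act_inv(1)[OF g ab(1)] by (simp add: path_map_def)
      then show False using False path_map_paths[OF Grp_inv[OF g] z(1)] z(3) by metis
    qed
    ultimately show ?thesis by simp
  qed
qed

text \<open>Both sides are morphisms from ga to gc with the same projection, and lifting recovers a
  morphism from its projection.\<close>

lemma pact_mult:
  assumes g: "g \<in> G" and v: "a \<in> verts Q" "b \<in> verts Q" "c \<in> verts Q"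
    and f: "f \<in> Mor PC b c" and h: "h \<in> Mor PC a b"
  shows "pact g (f \<otimes>\<^bsub>A\<^esub> h) = pact g f \<otimes>\<^bsub>A\<^esub> pact g h"
proof -
  note gv = act_verts[OF g v(1)] act_verts[OF g v(2)] act_verts[OF g v(3)]
  have fh: "f \<otimes>\<^bsub>A\<^esub> h \<in> Mor PC a c"
    using PC.cmp_closed[OF _ _ _ h f] v by (simp add: path_category_simps)
  have gm: "pact g f \<in> Mor PC (fst g b) (fst g c)" "pact g h \<in> Mor PC (fst g a) (fst g b)"
    using pact_Mor g v f h by blast+
  then have gfh: "pact g f \<otimes>\<^bsub>A\<^esub> pact g h \<in> Mor PC (fst g a) (fst g c)"
    using PC.cmp_closed[OF _ _ _ gm(2,1)] gv by (simp add: path_category_simps)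
  have "pact g (f \<otimes>\<^bsub>A\<^esub> h) = lift_hom (fst g a) (fst g c) (proj f \<otimes>\<^bsub>O.A\<^esub> proj h)"
    using pact_eq_lam[OF g v(1,3) fh] proj_mult[OF v f h] by simp
  also have "proj f \<otimes>\<^bsub>O.A\<^esub> proj h = proj (pact g f \<otimes>\<^bsub>A\<^esub> pact g h)"
    using proj_mult[OF gv gm] proj_pact[OF g v(2,3) f] proj_pact[OF g v(1,2) h] by simp
  also have "lift_hom (fst g a) (fst g c) \<dots> = pact g f \<otimes>\<^bsub>A\<^esub> pact g h"
    using lift_hom_proj[OF gv(1,3) gfh] by simp
  finally show ?thesis .
qed

lemma pact_vertex: "g \<in> G \<Longrightarrow> v \<in> verts Q \<Longrightarrow> pact g (vertex_elem v) = vertex_elem (fst g v)"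
proof
  fix x assume g: "g \<in> G" and v: "v \<in> verts Q"
  show "pact g (vertex_elem v) x = vertex_elem (fst g v) x"
    using act_inv[OF g] v act_verts[OF g v] paths_ends(1)[of x]
    by (cases x) (auto simp: pact_eq[OF g] path_elem_def path_map_def paths_Nil)
qed

abbreviation PA where "PA \<equiv> path_category_action Q :: _ \<Rightarrow> ('v, _ \<Rightarrow> 'k, 'v, _ \<Rightarrow> 'k) kfunctor"

lemma PA_simps: "fobj (PA g) = fst g" "fmor (PA g) a b f = pact g f"
  by (simp_all add: path_category_action_def)

lemma linear_functor_PA:
  assumes g: "g \<in> G" shows "linear_functor ring_of_type_algebra PC PC (PA g)"
  using g by unfold_locales
    (simp_all add: PA_simps path_category_simps act_verts pact_Mor pact_vertex pact_mult pact_add pact_smult)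

lemma category_action_PA: "category_action ring_of_type_algebra PC Grp PA"
proof (intro category_action.intro category_action_axioms.intro Grp.group_axioms,
    unfold carrier_Grp PA_simps path_category_simps)
  show "pact \<one>\<^bsub>Grp\<^esub> f = f" if "a \<in> verts Q" "b \<in> verts Q" "f \<in> Mor PC a b" for a b f
    using Mor_carrier[OF that] by (rule pact_one)
qed (simp_all add: linear_functor_PA act_one act_mult pact_mult_group)

section \<open>The projection functor\<close>

lemma proj_carrier: "proj f \<in> carrier O.A"
proof -
  have "y \<in> paths QG" if nz: "proj f y \<noteq> 0" for y
  proof -
    from nz[unfolded proj_def] obtain x where "x \<in> {x \<in> paths Q. opath x = y}"
      by (rule sum.not_neutral_contains_not_neutral)
    then show ?thesis using opath_paths by blast
  qed
  then show ?thesis unfolding O.carrier_path_algebra by blast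
qed

definition PF :: "('v, ('v, 'e) path \<Rightarrow> 'k, 'v set, ('v set, 'e set) path \<Rightarrow> 'k) kfunctor" where
  "PF = \<lparr>fobj = vo, fmor = (\<lambda>a b. proj)\<rparr>"

lemma linear_functor_PF: "linear_functor ring_of_type_algebra PC O.PC PF"
  by unfold_locales
    (simp_all add: PF_def path_category_simps O.path_category_simps vo_verts proj_Mor proj_mult
      proj_add proj_smult proj_path_elem paths_Nil opath_simps)

lemma continuous_proj:
  assumes "a \<in> verts Q" "b \<in> verts Q"
  shows "continuous_map (subtopology (adic_topology Q) (Mor PC a b)) (adic_topology QG) proj"
  unfolding continuous_map_def
proof (intro conjI allI impI)
  show "proj \<in> topspace (subtopology (adic_topology Q) (Mor PC a b)) \<rightarrow> topspace (adic_topology QG)"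
    by (simp add: O.topspace_adic proj_carrier)
  fix U :: "(('v set, 'e set) path \<Rightarrow> 'k) set"
  assume U: "openin (adic_topology QG) U"
  \<comment> \<open>The preimage is open already in the whole algebra, since congruent series have
    congruent projections.\<close>
  let ?T = "{f \<in> carrier A. proj f \<in> U}"
  have "adic_open Q ?T"
    unfolding adic_open_def
  proof (intro conjI ballI)
    fix f assume f: "f \<in> ?T"
    then obtain n where n: "\<forall>h\<in>carrier O.A. O.agree n (proj f) h \<longrightarrow> h \<in> U"
      using U unfolding O.openin_adic adic_open_def O.agree_def by blast
    have "h \<in> ?T" if "h \<in> carrier A" "agree n f h" for h
      using n that proj_carrier agree_proj by blast
    then show "\<exists>n. \<forall>g\<in>carrier A. (\<forall>x. length (snd x) < n \<longrightarrow> g x = f x) \<longrightarrow> g \<in> ?T"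
      unfolding agree_def by blast
  qed auto
  then show "openin (subtopology (adic_topology Q) (Mor PC a b))
      {f \<in> topspace (subtopology (adic_topology Q) (Mor PC a b)). proj f \<in> U}"
    unfolding openin_subtopology openin_adic
    by (intro exI[of _ ?T]) (auto simp: topspace_adic topspace_subtopology)
qed

lemma projection_functor_PF: "projection_functor Q G PF"
  unfolding projection_functor_def
  using linear_functor_PF continuous_proj
  by (auto simp: PF_def proj_path_elem paths_Cons paths_Nil opath_simps QG_ends)

section \<open>Uniqueness of the projection functor\<close>

lemma path_elem_mult:
  assumes "(u, p @ q) \<in> paths Q"
  shows "path_elem (awlast u p, q) \<otimes>\<^bsub>A\<^esub> path_elem (u, p) = (path_elem (u, p @ q) :: _ \<Rightarrow> 'k)"
proof
  fix x :: "('v, 'e) path"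
  obtain v r where x: "x = (v, r)" by (cases x)
  have "(\<Sum>i\<le>length r. (path_elem (awlast u p, q) (awlast v (take i r), drop i r) :: 'k) * path_elem (u, p) (v, take i r))
      = (\<Sum>i\<le>length r. if i = length p then (if v = u \<and> r = p @ q then 1 else 0) else 0)"
  proof (intro sum.cong refl)
    fix i assume "i \<in> {..length r}"
    then have len: "length (take i r) = i" by simp
    show "(path_elem (awlast u p, q) (awlast v (take i r), drop i r) :: 'k) * path_elem (u, p) (v, take i r)
      = (if i = length p then (if v = u \<and> r = p @ q then 1 else 0) else 0)"
    proof (cases "i = length p")
      case True
      have "take i r = p \<and> drop i r = q \<longleftrightarrow> r = p @ q"
        unfolding True by (metis append_eq_conv_conj)
      then show ?thesis using True by (auto simp: path_elem_def)
    next
      case False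
      then have "take i r \<noteq> p" using len by auto
      then show ?thesis using False by (simp add: path_elem_def)
    qed
  qed
  also have "\<dots> = (if v = u \<and> r = p @ q then 1 else 0)" by auto
  finally show "(path_elem (awlast u p, q) \<otimes>\<^bsub>A\<^esub> path_elem (u, p)) x = (path_elem (u, p @ q) :: _ \<Rightarrow> 'k) x"
    using assms by (auto simp: x path_algebra_mult path_elem_def)
qed

lemma path_elem_Mor: "x \<in> paths Q \<Longrightarrow> path_elem x \<in> Mor PC (fst x) (tgt x)"
  using paths_ends[of x] by (auto simp: Mor_path_category path_elem_def simp del: split_paired_All split: if_splits)

text \<open>Multiplicativity determines a projection functor on paths, hence on the dense subspace of
  finite linear combinations of paths, and continuity determines it everywhere.\<close>

context
  fixes \<pi> :: "('v, ('v, 'e) path \<Rightarrow> 'k, 'v set, ('v set, 'e set) path \<Rightarrow> 'k) kfunctor"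
  assumes \<pi>: "projection_functor Q G \<pi>"
begin

interpretation \<pi>: linear_functor ring_of_type_algebra PC O.PC \<pi>
  using \<pi> by (simp add: projection_functor_def)

lemma fobj_projection: "v \<in> verts Q \<Longrightarrow> fobj \<pi> v = vo v"
  using \<pi> by (simp add: projection_functor_def)

lemma projection_path_elem:
  "(u, p) \<in> paths Q \<Longrightarrow> fmor \<pi> u (awlast u p) (path_elem (u, p)) = path_elem (opath (u, p))"
proof (induction p arbitrary: u)
  case Nil
  then show ?case
    using \<pi>.fmor_idn[of u] fobj_projection[of u]
    by (simp add: path_category_simps O.path_category_simps paths_Nil opath_simps)
next
  case (Cons \<alpha> p)
  then have \<alpha>: "\<alpha> \<in> arcs Q" "u = tail Q \<alpha>" "(head Q \<alpha>, p) \<in> paths Q" by (auto simp: paths_Cons)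
  have arr: "(u, [\<alpha>]) \<in> paths Q" using \<alpha> by (simp add: paths_Cons paths_Nil)
  have eq: "path_elem (u, \<alpha> # p) = path_elem (head Q \<alpha>, p) \<otimes>\<^bsub>A\<^esub> (path_elem (u, [\<alpha>]) :: _ \<Rightarrow> 'k)"
    using path_elem_mult[of u "[\<alpha>]" p] Cons.prems by simp
  have "fmor \<pi> u (awlast (head Q \<alpha>) p) (path_elem (u, \<alpha> # p))
    = fmor \<pi> (head Q \<alpha>) (awlast (head Q \<alpha>) p) (path_elem (head Q \<alpha>, p))
      \<otimes>\<^bsub>O.A\<^esub> fmor \<pi> u (head Q \<alpha>) (path_elem (u, [\<alpha>]))"
    unfolding eq using \<pi>.fmor_cmp[of u "head Q \<alpha>" "awlast (head Q \<alpha>) p"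
        "path_elem (u, [\<alpha>])" "path_elem (head Q \<alpha>, p)"]
      path_elem_Mor[OF arr] path_elem_Mor[OF \<alpha>(3)] paths_ends[OF \<alpha>(3)] \<alpha>
    by (simp add: path_category_simps O.path_category_simps)
  also have "\<dots> = path_elem (opath (head Q \<alpha>, p)) \<otimes>\<^bsub>O.A\<^esub> path_elem (opath (u, [\<alpha>]))"
    using Cons.IH[OF \<alpha>(3)] \<pi> \<alpha> by (simp add: projection_functor_def opath_simps QG_ends)
  \<comment> \<open>\<open>proj\<close> obeys the same recursion, which replaces a computation of
    the product in the orbit quiver.\<close>
  also have "\<dots> = proj (path_elem (u, \<alpha> # p))"
    unfolding eq using proj_mult[OF _ _ _ path_elem_Mor[OF \<alpha>(3), simplified] path_elem_Mor[OF arr, simplified]]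
      paths_ends[OF \<alpha>(3)] \<alpha> proj_path_elem[OF \<alpha>(3)] proj_path_elem[OF arr] by simp
  also have "\<dots> = path_elem (opath (u, \<alpha> # p))" using Cons.prems by (rule proj_path_elem)
  finally show ?case using \<alpha> by simp
qed

text \<open>A series with bounded path lengths is a finite combination of paths, so linearity
  reduces the claim to single paths.\<close>

lemma projection_truncated:
  assumes ab: "a \<in> verts Q" "b \<in> verts Q" and f: "f \<in> Mor PC a b"
    and tr: "\<And>x. f x \<noteq> 0 \<Longrightarrow> length (snd x) < n"
  shows "fmor \<pi> a b f = proj f"
proof -
  let ?S = "{x \<in> paths Q. fst x = a \<and> tgt x = b \<and> length (snd x) < n}"
  have fin: "finite ?S" by (rule finite_subset[OF _ finite_paths[of n]]) auto
  let ?F = "\<lambda>x y. f x * path_elem x y"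
  have m: "?F x \<in> Mor PC a b" if "x \<in> ?S" for x
    using that path_elem_Mor[of x] unfolding Mor_path_category[OF ab] by (auto simp: path_elem_def)
  have fS: "f x \<noteq> 0 \<Longrightarrow> x \<in> ?S" for x
    using f tr unfolding Mor_path_category[OF ab] by blast
  have f_eq: "f = (\<lambda>y. \<Sum>x\<in>?S. ?F x y)"
  proof
    fix y
    have "(\<Sum>x\<in>?S. ?F x y) = (\<Sum>x\<in>?S. if x = y then f x else 0)"
      by (intro sum.cong) (auto simp: path_elem_def)
    also have "\<dots> = f y" using fin fS[of y] by (cases "f y = 0") (auto simp: sum.neutral)
    finally show "f y = (\<Sum>x\<in>?S. ?F x y)" ..
  qed
  have Fx: "fmor \<pi> a b (?F x) = (\<lambda>y. f x * path_elem (opath x) y)" if x: "x \<in> ?S" for x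
  proof -
    have pm: "path_elem x \<in> Mor PC a b" using x path_elem_Mor[of x] by auto
    have "fmor \<pi> a b (path_elem x) = path_elem (opath x)"
      using x projection_path_elem[of "fst x" "snd x"] by auto
    then show ?thesis
      using \<pi>.fmor_smult[of a b "f x", OF _ _ _ pm] ab
      by (simp add: path_category_simps O.path_category_simps ring_of_type_algebra_def)
  qed
  have fs: "finsum (Hom PC a b) ?F ?S = (\<lambda>y. \<Sum>x\<in>?S. ?F x y)"
    by (rule finsum_PC[OF ab _ fin]) (rule m)
  have "fmor \<pi> a b f = fmor \<pi> a b (finsum (Hom PC a b) ?F ?S)"
    unfolding fs f_eq[symmetric] ..
  also have "\<dots> = finsum (Hom O.PC (vo a) (vo b)) (\<lambda>x. fmor \<pi> a b (?F x)) ?S"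
  proof (rule PC.additive_finsum(2))
    show "abelian_group (Hom O.PC (vo a) (vo b))"
      by (intro O.PC.abelian_group_Hom) (simp_all add: O.path_category_simps vo_verts ab)
  qed (use ab fin m \<pi>.fmor_closed \<pi>.fmor_add fobj_projection in \<open>simp_all add: path_category_simps\<close>)
  also have "\<dots> = (\<lambda>y. \<Sum>x\<in>?S. fmor \<pi> a b (?F x) y)"
    using ab fin m \<pi>.fmor_closed[of a b] fobj_projection vo_verts
    by (intro O.finsum_PC) (auto simp: path_category_simps)
  also have "\<dots> = (\<lambda>y. \<Sum>x\<in>?S. f x * path_elem (opath x) y)"
    by (intro ext sum.cong refl) (simp only: Fx)
  also have "\<dots> = proj (\<lambda>y. \<Sum>x\<in>?S. ?F x y)"
    unfolding proj_sum proj_smult by (intro ext sum.cong refl) (simp add: proj_path_elem)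
  finally show ?thesis using f_eq by simp
qed

text \<open>Continuity at 0, made explicit: n is the precision asked for in the orbit quiver, m the
  one that suffices in Q.\<close>

lemma projection_small:
  assumes ab: "a \<in> verts Q" "b \<in> verts Q"
  obtains m where "\<And>h (y :: ('v set, 'e set) path). h \<in> Mor PC a b \<Longrightarrow> (\<And>x. length (snd x) < m \<Longrightarrow> h x = 0)
    \<Longrightarrow> length (snd y) < n \<Longrightarrow> fmor \<pi> a b h y = 0"
proof -
  let ?X = "subtopology (adic_topology Q) (Mor PC a b)"
  let ?U = "{h \<in> carrier O.A. O.agree n (\<lambda>_. 0) h}"
  have "continuous_map ?X (adic_topology QG) (fmor \<pi> a b)"
    using \<pi> ab by (simp add: projection_functor_def)
  moreover have "openin (adic_topology QG) ?U"
    unfolding O.openin_adic using O.A.A.zero_closed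
    by (intro O.adic_open_ball) (simp add: O.path_algebra_simps)
  ultimately have "openin ?X {f \<in> topspace ?X. fmor \<pi> a b f \<in> ?U}"
    by (rule openin_continuous_map_preimage)
  then obtain T where T: "adic_open Q T" "{f \<in> topspace ?X. fmor \<pi> a b f \<in> ?U} = T \<inter> Mor PC a b"
    unfolding openin_subtopology openin_adic by blast
  have top: "topspace ?X = Mor PC a b"
    using Mor_carrier[OF ab] by (auto simp: topspace_subtopology topspace_adic)
  have zero: "(\<lambda>_. 0) \<in> Mor PC a b" using ab by (simp add: Mor_path_category)
  have "fmor \<pi> a b (\<lambda>_. 0) = proj (\<lambda>_. 0)"
    using projection_truncated[OF ab zero, of 0] by simp
  then have "fmor \<pi> a b (\<lambda>_. 0) \<in> ?U"
    using O.A.A.zero_closed by (simp add: proj_zero O.path_algebra_simps O.agree_def)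
  then have "(\<lambda>_. 0) \<in> T" using T(2) zero unfolding top by blast
  then obtain m where m: "\<forall>g\<in>carrier A. (\<forall>x. length (snd x) < m \<longrightarrow> g x = 0) \<longrightarrow> g \<in> T"
    using T(1) unfolding adic_open_def by blast
  show ?thesis
  proof (rule that)
    fix h :: "('v, 'e) path \<Rightarrow> 'k" and y :: "('v set, 'e set) path"
    assume h: "h \<in> Mor PC a b" "\<And>x. length (snd x) < m \<Longrightarrow> h x = 0"
      and y: "length (snd y) < n"
    have "h \<in> T \<inter> Mor PC a b" using m h Mor_carrier[OF ab h(1)] by blast
    then have "fmor \<pi> a b h \<in> ?U" unfolding T(2)[symmetric] by blast
    then show "fmor \<pi> a b h y = 0" using y by (simp add: O.agree_def del: split_paired_All)
  qed
qed

lemma fmor_projection: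
  assumes ab: "a \<in> verts Q" "b \<in> verts Q" and f: "f \<in> Mor PC a b"
  shows "fmor \<pi> a b f = proj f"
proof
  fix y :: "('v set, 'e set) path"
  obtain m where m: "\<And>h (z :: ('v set, 'e set) path). h \<in> Mor PC a b
    \<Longrightarrow> (\<And>x. length (snd x) < m \<Longrightarrow> h x = 0)
    \<Longrightarrow> length (snd z) < Suc (length (snd y)) \<Longrightarrow> fmor \<pi> a b h z = 0"
    using projection_small[OF ab] by metis
  \<comment> \<open>The bound m makes the image of the remainder \<open>?h\<close> vanish at y; the
    other bound keeps the truncation from changing \<open>proj f\<close> at y, as lengths are
    preserved.\<close>
  let ?k = "max m (Suc (length (snd y)))"
  let ?t = "\<lambda>x. if length (snd x) < ?k then f x else 0"
  let ?h = "\<lambda>x. if length (snd x) < ?k then 0 else f x"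
  have t: "?t \<in> Mor PC a b" and h: "?h \<in> Mor PC a b"
    using f unfolding Mor_path_category[OF ab] by (auto simp del: split_paired_All split: if_splits)
  have f_eq: "f = (\<lambda>x. ?t x + ?h x)" by auto
  have "fmor \<pi> a b f = (\<lambda>y. fmor \<pi> a b ?t y + fmor \<pi> a b ?h y)"
    using \<pi>.fmor_add[OF _ _ t h] ab by (subst f_eq) (simp add: path_category_simps O.path_category_simps)
  moreover have "fmor \<pi> a b ?h y = 0" by (rule m[OF h]) auto
  moreover have "fmor \<pi> a b ?t = proj ?t"
    by (rule projection_truncated[OF ab t, of ?k]) (auto split: if_splits)
  moreover have "proj f y = proj ?t y"
    using agree_proj[of ?k f ?t] by (simp add: agree_def O.agree_def del: split_paired_All)
  ultimately show "fmor \<pi> a b f y = proj f y" by simp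
qed

lemma sum_projection:
  assumes "a \<in> verts Q" "b \<in> verts Q" "\<And>g. g \<in> G \<Longrightarrow> x g \<in> Mor PC a (fst g b)"
  shows "(\<Oplus>\<^bsub>Hom O.PC (vo a) (vo b)\<^esub> g \<in> G. fmor \<pi> a (fst g b) (x g)) = (\<lambda>y. \<Sum>g\<in>G. proj (x g) y)"
proof -
  have "proj (x g) \<in> Mor O.PC (vo a) (vo b)" if "g \<in> G" for g
    using proj_Mor[of a "fst g b" "x g"] assms that by (simp add: act_verts vo_act)
  then show ?thesis
    using assms by (subst O.finsum_PC) (auto simp: vo_verts finite_G fmor_projection act_verts)
qed

end

text \<open>The vertices gb are pairwise distinct by freeness, so lifting towards hb keeps only the
  summand at h.\<close>

lemma lift_hom_sum_proj:
  assumes ab: "a \<in> verts Q" "b \<in> verts Q" and x: "\<And>g. g \<in> G \<Longrightarrow> x g \<in> Mor PC a (fst g b)"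
    and h: "h \<in> G"
  shows "lift_hom a (fst h b) (\<lambda>y. \<Sum>g\<in>G. proj (x g) y) = x h"
proof
  fix z
  have "lift_hom a (fst h b) (\<lambda>y. \<Sum>g\<in>G. proj (x g) y) z = (\<Sum>g\<in>G. lift_hom a (fst h b) (proj (x g)) z)"
    by (simp add: lift_hom_sum)
  also have "\<dots> = (\<Sum>g\<in>G. if g = h then x h z else 0)"
    using ab x h free[OF _ h ab(2)]
    by (intro sum.cong refl) (auto simp: lift_hom_proj[OF ab(1) act_verts[OF _ ab(2)]])
  also have "\<dots> = x h z" using h finite_G by simp
  finally show "lift_hom a (fst h b) (\<lambda>y. \<Sum>g\<in>G. proj (x g) y) z = x h z" .
qed

lemma finite_covering_path:
  assumes \<pi>: "projection_functor Q G \<pi>"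
  shows "finite_covering ring_of_type_algebra PC O.PC Grp PA \<pi>"
proof -
  interpret \<pi>: linear_functor ring_of_type_algebra PC O.PC \<pi>
    using \<pi> by (simp add: projection_functor_def)
  interpret category_action ring_of_type_algebra PC Grp PA by (rule category_action_PA)
  note s = path_category_simps O.path_category_simps PA_simps carrier_Grp
  show ?thesis
  proof (intro finite_covering.intro finite_covering_axioms.intro \<pi>.linear_functor_axioms
      category_action_axioms, unfold s)
    show "finite G" by (rule finite_G)
    show "fobj \<pi> ` verts Q = verts QG" using fobj_projection[OF \<pi>] by (auto simp: QG_simps)
  next
    fix g a assume "g \<in> G" "a \<in> verts Q"
    then show "fobj \<pi> (fst g a) = fobj \<pi> a" by (simp add: fobj_projection[OF \<pi>] act_verts vo_act)
  next
    fix g a b and f :: "('v, 'e) path \<Rightarrow> 'k"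
    assume "g \<in> G" "a \<in> verts Q" "b \<in> verts Q" "f \<in> Mor PC a b"
    then show "fmor \<pi> (fst g a) (fst g b) (pact g f) = fmor \<pi> a b f"
      by (simp add: fmor_projection[OF \<pi>] act_verts pact_Mor proj_pact)
  next
    fix a b x g assume ab: "a \<in> verts Q" "b \<in> verts Q"
      and x: "\<And>g. g \<in> G \<Longrightarrow> x g \<in> Mor PC a (fst g b)"
      and eq: "(\<Oplus>\<^bsub>Hom O.PC (fobj \<pi> a) (fobj \<pi> b)\<^esub> g \<in> G. fmor \<pi> a (fst g b) (x g)) = (\<lambda>_. 0)"
      and g: "g \<in> G"
    have "(\<lambda>y. \<Sum>g\<in>G. proj (x g) y) = (\<lambda>_. 0)"
      using eq sum_projection[OF \<pi> ab x] ab by (simp add: fobj_projection[OF \<pi>])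
    then show "x g = (\<lambda>_. 0)" using lift_hom_sum_proj[OF ab x g] by (simp add: lift_hom_zero)
  next
    fix a b and y :: "('v set, 'e set) path \<Rightarrow> 'k"
    assume ab: "a \<in> verts Q" "b \<in> verts Q" and y: "y \<in> Mor O.PC (fobj \<pi> a) (fobj \<pi> b)"
    let ?x = "\<lambda>g. lift_hom a (fst g b) y"
    have x: "\<And>g. g \<in> G \<Longrightarrow> ?x g \<in> Mor PC a (fst g b)" using ab by (simp add: lift_hom_Mor act_verts)
    have "(\<lambda>z. \<Sum>g\<in>G. proj (?x g) z) = y"
      using y ab by (intro sum_proj_lam) (simp_all add: fobj_projection[OF \<pi>])
    then show "\<exists>x. (\<forall>g\<in>G. x g \<in> Mor PC a (fst g b)) \<and>
      (\<Oplus>\<^bsub>Hom O.PC (fobj \<pi> a) (fobj \<pi> b)\<^esub> g \<in> G. fmor \<pi> a (fst g b) (x g)) = y"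
      using sum_projection[OF \<pi> ab x] x ab by (intro exI[of _ ?x]) (simp add: fobj_projection[OF \<pi>])
  qed
qed

end

section \<open>The covering of Jacobian categories\<close>

text \<open>Stated for two arbitrary quivers, so that it covers both the projection and each element
  of G. Independence of representatives is contained in \<open>induced_functor\<close>; the laws are
  then checked on representatives.\<close>

lemma linear_functor_jacobian:
  fixes W :: "'e list set \<Rightarrow> 'k::field" and W' :: "'f list set \<Rightarrow> 'k"
  assumes Q: "quiver Q" and Q': "quiver Q'"
    and P: "linear_functor ring_of_type_algebra (path_category Q) (path_category Q') P"
    and F: "induced_functor Q W Q' W' P F"
  shows "linear_functor ring_of_type_algebra (jacobian_category Q W) (jacobian_category Q' W') F"
proof -
  interpret Q: quiver Q by (rule Q)
  interpret Q': quiver Q' by (rule Q')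
  interpret P: linear_functor ring_of_type_algebra "path_category Q" "path_category Q'" P by (rule P)
  interpret JQ: k_category ring_of_type_algebra "jacobian_category Q W" by (rule Q.k_category_JC)
  interpret JQ': k_category ring_of_type_algebra "jacobian_category Q' W'" by (rule Q'.k_category_JC)
  have obj: "fobj F a = fobj P a" if "a \<in> verts Q" for a
    using F that by (simp add: induced_functor_def)
  have mor: "fmor F a b (jacobian_class Q W f) = jacobian_class Q' W' (fmor P a b f)"
    if "a \<in> verts Q" "b \<in> verts Q" "f \<in> Mor (path_category Q) a b" for a b f
    using F that by (simp add: induced_functor_def)
  have v: "fobj P a \<in> verts Q'" if "a \<in> verts Q" for a
    using P.fobj_closed[of a] that by (simp add: Q.path_category_simps Q'.path_category_simps)
  have Pm: "fmor P a b f \<in> Mor (path_category Q') (fobj P a) (fobj P b)"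
    if "a \<in> verts Q" "b \<in> verts Q" "f \<in> Mor (path_category Q) a b" for a b f
    using P.fmor_closed that by (simp add: Q.path_category_simps)
  have Pc: "fmor P a b f \<in> carrier (path_algebra Q')"
    if "a \<in> verts Q" "b \<in> verts Q" "f \<in> Mor (path_category Q) a b" for a b f
    using Q'.Mor_carrier[OF v[OF that(1)] v[OF that(2)] Pm[OF that]] .
  note c = Q.Mor_carrier
  have ops: "(\<lambda>x. f x + f' x) \<in> Mor (path_category Q) a b" "(\<lambda>x. r * f x) \<in> Mor (path_category Q) a b"
    if "a \<in> verts Q" "b \<in> verts Q" "f \<in> Mor (path_category Q) a b" "f' \<in> Mor (path_category Q) a b"
    for a b f f' and r :: 'k
  proof -
    have nz: "f x \<noteq> 0 \<or> f' x \<noteq> 0 \<Longrightarrow> x \<in> paths Q \<and> fst x = a \<and> Q.tgt x = b" for x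
      using that(3,4) unfolding Q.Mor_path_category[OF that(1,2)] by blast
    have "f x + f' x \<noteq> 0 \<Longrightarrow> f x \<noteq> 0 \<or> f' x \<noteq> 0" "r * f x \<noteq> 0 \<Longrightarrow> f x \<noteq> 0" for x by auto
    with nz show "(\<lambda>x. f x + f' x) \<in> Mor (path_category Q) a b" "(\<lambda>x. r * f x) \<in> Mor (path_category Q) a b"
      unfolding Q.Mor_path_category[OF that(1,2)] by blast+
  qed
  show ?thesis
  proof (intro linear_functor.intro linear_functor_axioms.intro JQ.k_category_axioms JQ'.k_category_axioms,
      unfold Q.jacobian_category_simps Q'.jacobian_category_simps)
    show "fobj F a \<in> verts Q'" if "a \<in> verts Q" for a
      using that v obj by simp
    show "fmor F a b f \<in> Mor (jacobian_category Q' W') (fobj F a) (fobj F b)"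
      if "a \<in> verts Q" "b \<in> verts Q" "f \<in> Mor (jacobian_category Q W) a b" for a b f
      using that Pm by (auto simp: Q.Mor_JC Q'.Mor_JC obj v mor)
    show "fmor F a a (jacobian_class Q W (vertex_elem a)) = jacobian_class Q' W' (vertex_elem (fobj F a))"
      if a: "a \<in> verts Q" for a
    proof (subst mor[OF a a])
      show "vertex_elem a \<in> Mor (path_category Q) a a"
        using a by (auto simp: Q.Mor_path_category path_elem_def Q.paths_Nil split: if_splits)
      show "jacobian_class Q' W' (fmor P a a (vertex_elem a)) = jacobian_class Q' W' (vertex_elem (fobj F a))"
        using P.fmor_idn[of a] a by (simp add: obj Q.path_category_simps Q'.path_category_simps)
    qed
    show "fmor F a c (cmp (jacobian_category Q W) g f)
        = cmp (jacobian_category Q' W') (fmor F b c g) (fmor F a b f)"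
      if v3: "a \<in> verts Q" "b \<in> verts Q" "c \<in> verts Q" and
        fg: "f \<in> Mor (jacobian_category Q W) a b" "g \<in> Mor (jacobian_category Q W) b c" for a b c f g
    proof -
      obtain f' g' where f': "f' \<in> Mor (path_category Q) a b" "f = jacobian_class Q W f'"
        and g': "g' \<in> Mor (path_category Q) b c" "g = jacobian_class Q W g'"
        using fg unfolding Q.Mor_JC[OF v3(1,2)] Q.Mor_JC[OF v3(2,3)] by blast
      have gf: "g' \<otimes>\<^bsub>path_algebra Q\<^esub> f' \<in> Mor (path_category Q) a c"
        using Q.PC.cmp_closed[OF _ _ _ f'(1) g'(1)] v3 by (simp add: Q.path_category_simps)
      have "fmor P a c (g' \<otimes>\<^bsub>path_algebra Q\<^esub> f') = fmor P b c g' \<otimes>\<^bsub>path_algebra Q'\<^esub> fmor P a b f'"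
        using P.fmor_cmp[OF _ _ _ f'(1) g'(1)] v3 by (simp add: Q.path_category_simps Q'.path_category_simps)
      then show ?thesis
        using v3 f'(1) g'(1) gf c[OF v3(1,2) f'(1)] c[OF v3(2,3) g'(1)]
          Pc[OF v3(1,2) f'(1)] Pc[OF v3(2,3) g'(1)]
        by (simp add: f'(2) g'(2) Q.jacobian_class_simps Q'.jacobian_class_simps mor)
    qed
    show "fmor F a b (f \<oplus>\<^bsub>Hom (jacobian_category Q W) a b\<^esub> f')
        = fmor F a b f \<oplus>\<^bsub>Hom (jacobian_category Q' W') (fobj F a) (fobj F b)\<^esub> fmor F a b f'"
      if v2: "a \<in> verts Q" "b \<in> verts Q" and
        ff: "f \<in> Mor (jacobian_category Q W) a b" "f' \<in> Mor (jacobian_category Q W) a b" for a b f f'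
    proof -
      obtain h h' where h: "h \<in> Mor (path_category Q) a b" "f = jacobian_class Q W h"
        and h': "h' \<in> Mor (path_category Q) a b" "f' = jacobian_class Q W h'"
        using ff unfolding Q.Mor_JC[OF v2] by blast
      have "fmor P a b (\<lambda>x. h x + h' x) = (\<lambda>x. fmor P a b h x + fmor P a b h' x)"
        using P.fmor_add[OF _ _ h(1) h'(1)] v2 by (simp add: Q.path_category_simps Q'.path_category_simps)
      then show ?thesis
        using v2 h(1) h'(1) ops(1)[OF v2 h(1) h'(1)] c[OF v2 h(1)] c[OF v2 h'(1)]
          Pc[OF v2 h(1)] Pc[OF v2 h'(1)]
        by (simp add: h(2) h'(2) Q.jacobian_class_simps Q'.jacobian_class_simps mor)
    qed
    show "fmor F a b (r \<odot>\<^bsub>Hom (jacobian_category Q W) a b\<^esub> f)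
        = r \<odot>\<^bsub>Hom (jacobian_category Q' W') (fobj F a) (fobj F b)\<^esub> fmor F a b f"
      if v2: "a \<in> verts Q" "b \<in> verts Q" and
        r: "r \<in> carrier ring_of_type_algebra" and f: "f \<in> Mor (jacobian_category Q W) a b" for a b r f
    proof -
      obtain h where h: "h \<in> Mor (path_category Q) a b" "f = jacobian_class Q W h"
        using f unfolding Q.Mor_JC[OF v2] by blast
      have "fmor P a b (\<lambda>x. r * h x) = (\<lambda>x. r * fmor P a b h x)"
        using P.fmor_smult[OF _ _ r h(1)] v2 by (simp add: Q.path_category_simps Q'.path_category_simps)
      then show ?thesis
        using v2 h(1) ops(2)[OF v2 h(1) h(1), of r] Q.jacobian_class_simps(3)[OF c[OF v2 h(1)] c[OF v2 h(1)]]
          Q'.jacobian_class_simps(3)[OF Pc[OF v2 h(1)] Pc[OF v2 h(1)]]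
        by (simp add: h(2) mor)
    qed
  qed
qed

lemma (in quiver) jacobian_class_eq_zero_iff:
  "f \<in> carrier A \<Longrightarrow> jcl W f = jcl W (\<lambda>_. 0) \<longleftrightarrow> f \<in> jacobian_ideal Q W"
  using jacobian_class_simps(5)[of f "\<lambda>_. 0" W] by (simp add: carrier_path_algebra)

section \<open>Projection and translation of residue classes\<close>

context qp_action
begin

context
  assumes card_nonzero: "of_nat (card G) \<noteq> (0 :: 'k)"
begin

lemma proj_JI:
  assumes f: "f \<in> JI" shows "proj f \<in> JIG"
proof -
  have "f \<in> carrier A" using f J.I.a_subset[of W] by blast
  then have "proj f = proj (\<lambda>x. \<Sum>a\<in>verts Q. \<Sum>b\<in>verts Q. restr a b f x)"
    using restr_sum by metis
  also have "\<dots> = (\<lambda>y. \<Sum>a\<in>verts Q. \<Sum>b\<in>verts Q. proj (restr a b f) y)"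
    by (simp add: proj_sum)
  also have "\<dots> \<in> JIG"
    by (intro O.sum_mem_ideal O.ideal_jacobian finite_verts proj_in_JIG card_nonzero f)
  finally show ?thesis .
qed

text \<open>A translated component is the lift of its projection, so invariance follows from the two
  inclusions of ideals already proved, without another closed ideal.\<close>

lemma pact_JI:
  assumes g: "g \<in> G" and f: "f \<in> JI" shows "pact g f \<in> JI"
proof -
  have c: "f \<in> carrier A" using f J.I.a_subset[of W] by blast
  then have "pact g f = pact g (\<lambda>x. \<Sum>a\<in>verts Q. \<Sum>b\<in>verts Q. restr a b f x)"
    using restr_sum by metis
  also have "\<dots> = (\<lambda>y. \<Sum>a\<in>verts Q. \<Sum>b\<in>verts Q. pact g (restr a b f) y)"
    by (simp add: pact_sum)
  also have "\<dots> \<in> JI"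
  proof (intro sum_mem_ideal ideal_jacobian finite_verts)
    fix a b assume ab: "a \<in> verts Q" "b \<in> verts Q"
    have "pact g (restr a b f) = lift_hom (fst g a) (fst g b) (proj (restr a b f))"
      using g ab c by (intro pact_eq_lam restr_in_Mor)
    also have "\<dots> \<in> JI"
      using g ab by (intro lift_hom_in_JI proj_in_JIG card_nonzero f act_verts)
    finally show "pact g (restr a b f) \<in> JI" .
  qed
  finally show ?thesis .
qed

lemma jcl_eq: "jcl W f = (\<lambda>h x. h x + f x) ` JI"
  by (auto simp: jacobian_class_def a_r_coset_def' path_algebra_simps)

text \<open>The action on classes takes images of cosets, so equality of \<open>pact g\<close>
  applied to the ideal and the ideal itself is required; the reverse inclusion comes from the
  inverse of g.\<close>

lemma pact_jcl:
  assumes g: "g \<in> G" shows "pact g ` jcl W f = jcl W (pact g f)"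
proof -
  have "JI \<subseteq> pact g ` JI"
  proof
    fix h assume h: "h \<in> JI"
    then have "h \<in> carrier A" using J.I.a_subset[of W] by blast
    then have "pact g (pact (inv\<^bsub>Grp\<^esub> g) h) = h" using g by (rule_tac pact_inv)
    then show "h \<in> pact g ` JI" using pact_JI[OF Grp_inv[OF g] h] by (metis image_eqI)
  qed
  then have "pact g ` JI = JI" using pact_JI[OF g] by blast
  moreover have "pact g ` jcl W f = (\<lambda>h x. h x + pact g f x) ` pact g ` JI"
    unfolding jcl_eq image_image pact_add ..
  ultimately show ?thesis by (simp add: jcl_eq)
qed

abbreviation JA :: "_ \<Rightarrow> ('v, (_ \<Rightarrow> 'k) set, 'v, (_ \<Rightarrow> 'k) set) kfunctor" where
  "JA \<equiv> jacobian_category_action Q"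

lemma JA_simps: "fobj (JA g) = fst g" "fmor (JA g) a b Y = pact g ` Y"
  by (simp_all add: jacobian_category_action_def)

lemma linear_functor_JA:
  assumes g: "g \<in> G" shows "linear_functor ring_of_type_algebra (JC W) (JC W) (JA g)"
  using g by (intro linear_functor_jacobian[OF _ _ linear_functor_PA[OF g]] quiver_axioms)
    (simp add: induced_functor_def JA_simps PA_simps pact_jcl)

lemma category_action_JA: "category_action ring_of_type_algebra (JC W) Grp JA"
proof (intro category_action.intro category_action_axioms.intro Grp.group_axioms,
    unfold carrier_Grp JA_simps jacobian_category_simps)
  show "pact \<one>\<^bsub>Grp\<^esub> ` Y = Y" if ab: "a \<in> verts Q" "b \<in> verts Q" and Y: "Y \<in> Mor (JC W) a b" for a b Y
  proof -
    obtain f where f: "f \<in> Mor PC a b" "Y = jcl W f"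
      using Y unfolding Mor_JC[OF ab] by blast
    show ?thesis
      unfolding f(2) pact_jcl[OF Grp_one] pact_one[OF Mor_carrier[OF ab f(1)]] ..
  qed
qed (simp_all add: linear_functor_JA act_one act_mult image_image pact_mult_group)

lemma induced_functor_exists:
  assumes \<pi>: "projection_functor Q G \<pi>"
  obtains F where "induced_functor Q W QG WG \<pi> F"
proof
  \<comment> \<open>The chosen representative may lie outside the Hom space from a to b, so
    \<open>proj\<close> is applied in place of \<open>fmor \<pi> a b\<close>. By
    \<open>proj_JI\<close> the choice is immaterial.\<close>
  let ?F = "\<lparr>fobj = fobj \<pi>, fmor = (\<lambda>a b Y. O.jcl WG (proj (SOME f. f \<in> Y)))\<rparr>"
  have "O.jcl WG (proj (SOME h. h \<in> jcl W f)) = O.jcl WG (proj f)" for f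
  proof -
    have "f \<in> jcl W f"
      unfolding jcl_eq using J.I.zero_closed[of W] by (intro image_eqI[of _ _ "\<lambda>_. 0"]) (simp_all add: path_algebra_simps)
    then have "(SOME h. h \<in> jcl W f) \<in> jcl W f" by (rule someI[of "\<lambda>h. h \<in> jcl W f"])
    then obtain h where h: "h \<in> JI" "(SOME h. h \<in> jcl W f) = (\<lambda>x. h x + f x)"
      unfolding jcl_eq by blast
    have "(\<lambda>y. proj (\<lambda>x. h x + f x) y - proj f y) \<in> JIG"
      using proj_JI[OF h(1)] by (simp add: proj_add)
    then show ?thesis unfolding h(2) by (simp add: O.jacobian_class_simps(5)[OF proj_carrier proj_carrier])
  qed
  then show "induced_functor Q W QG WG \<pi> ?F"
    using fmor_projection[OF \<pi>] by (simp add: induced_functor_def)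
qed

lemma finite_covering_jacobian:
  assumes \<pi>: "projection_functor Q G \<pi>" and ind: "induced_functor Q W QG WG \<pi> F"
  shows "finite_covering ring_of_type_algebra (JC W) (O.JC WG) Grp JA F"
proof -
  interpret F: linear_functor ring_of_type_algebra "JC W" "O.JC WG" F
    using linear_functor_jacobian[OF quiver_axioms O.quiver_axioms _ ind] \<pi>
    by (simp add: projection_functor_def)
  interpret category_action ring_of_type_algebra "JC W" Grp JA by (rule category_action_JA)
  have obj: "fobj F v = vo v" if "v \<in> verts Q" for v
    using ind that fobj_projection[OF \<pi>] by (simp add: induced_functor_def)
  have mor: "fmor F a b (jcl W f) = O.jcl WG (proj f)"
    if "a \<in> verts Q" "b \<in> verts Q" "f \<in> Mor PC a b" for a b f
    using ind that fmor_projection[OF \<pi>] by (simp add: induced_functor_def)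
  have sum: "(\<Oplus>\<^bsub>Hom (O.JC WG) (fobj F a) (fobj F b)\<^esub> g \<in> G. fmor F a (fst g b) (jcl W (x g)))
      = O.jcl WG (\<lambda>y. \<Sum>g\<in>G. proj (x g) y)"
    if ab: "a \<in> verts Q" "b \<in> verts Q" and x: "\<And>g. g \<in> G \<Longrightarrow> x g \<in> Mor PC a (fst g b)" for a b x
  proof -
    have m: "proj (x g) \<in> Mor O.PC (vo a) (vo b)" if "g \<in> G" for g
      using proj_Mor[of a "fst g b" "x g"] ab x that by (simp add: act_verts vo_act)
    have "O.jcl WG (\<lambda>y. \<Sum>g\<in>G. proj (x g) y)
        = (\<Oplus>\<^bsub>Hom (O.JC WG) (vo a) (vo b)\<^esub> g \<in> G. O.jcl WG (proj (x g)))"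
      using ab m finite_G by (intro O.finsum_JC[symmetric] vo_verts)
    also have "\<dots> = (\<Oplus>\<^bsub>Hom (O.JC WG) (vo a) (vo b)\<^esub> g \<in> G. fmor F a (fst g b) (jcl W (x g)))"
    proof (rule abelian_monoid.finsum_cong'[OF _ refl])
      show "abelian_monoid (Hom (O.JC WG) (vo a) (vo b))"
        using F.B.abelian_group_Hom vo_verts ab by (simp add: O.jacobian_category_simps abelian_group_def)
    qed (use ab x m F.fmor_closed in \<open>auto simp: mor act_verts O.Mor_JC vo_verts\<close>)
    finally show ?thesis using ab by (simp add: obj)
  qed
  note s = jacobian_category_simps O.jacobian_category_simps JA_simps carrier_Grp
    zero_Hom_JC O.zero_Hom_JC
  show ?thesis
  proof (intro finite_covering.intro finite_covering_axioms.intro F.linear_functor_axioms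
      category_action_axioms, unfold s)
    show "finite G" by (rule finite_G)
    show "fobj F ` verts Q = verts QG" using obj by (auto simp: QG_simps)
  next
    fix g a assume "g \<in> G" "a \<in> verts Q"
    then show "fobj F (fst g a) = fobj F a" by (simp add: obj act_verts vo_act)
  next
    fix g a b Y assume g: "g \<in> G" and ab: "a \<in> verts Q" "b \<in> verts Q" and Y: "Y \<in> Mor (JC W) a b"
    then obtain f where "f \<in> Mor PC a b" "Y = jcl W f" by (auto simp: Mor_JC)
    then show "fmor F (fst g a) (fst g b) (pact g ` Y) = fmor F a b Y"
      using g ab by (simp add: pact_jcl mor act_verts pact_Mor proj_pact)
  next
    fix a b g and Z :: "('v, 'e) quiver_map \<Rightarrow> (('v, 'e) path \<Rightarrow> 'k) set"
    assume ab: "a \<in> verts Q" "b \<in> verts Q"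
      and Z: "\<And>g. g \<in> G \<Longrightarrow> Z g \<in> Mor (JC W) a (fst g b)"
      and eq: "(\<Oplus>\<^bsub>Hom (O.JC WG) (fobj F a) (fobj F b)\<^esub> g \<in> G. fmor F a (fst g b) (Z g))
        = O.jcl WG (\<lambda>_. 0)"
      and g: "g \<in> G"
    have "\<forall>g\<in>G. \<exists>f. f \<in> Mor PC a (fst g b) \<and> Z g = jcl W f"
      using Z ab act_verts by (simp add: Mor_JC image_iff) blast
    then obtain x where x: "\<And>g. g \<in> G \<Longrightarrow> x g \<in> Mor PC a (fst g b)"
      and Zx: "\<And>g. g \<in> G \<Longrightarrow> Z g = jcl W (x g)" by metis
    let ?y = "\<lambda>y. \<Sum>g\<in>G. proj (x g) y"
    have y: "?y \<in> carrier O.A"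
      using proj_carrier by (simp flip: proj_sum)
    have "(\<Oplus>\<^bsub>Hom (O.JC WG) (fobj F a) (fobj F b)\<^esub> g \<in> G. fmor F a (fst g b) (Z g))
      = (\<Oplus>\<^bsub>Hom (O.JC WG) (fobj F a) (fobj F b)\<^esub> g \<in> G. fmor F a (fst g b) (jcl W (x g)))"
    proof (rule abelian_monoid.finsum_cong'[OF _ refl])
      show "abelian_monoid (Hom (O.JC WG) (fobj F a) (fobj F b))"
        using F.B.abelian_group_Hom F.fobj_closed ab by (simp add: s abelian_group_def)
      have "fmor F a (fst g b) (jcl W (x g)) \<in> Mor (O.JC WG) (fobj F a) (fobj F b)" if "g \<in> G" for g
      proof -
        note v = ab(1) act_verts[OF that ab(2)]
        have "jcl W (x g) \<in> Mor (JC W) a (fst g b)" unfolding Mor_JC[OF v] using x[OF that] by blast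
        then have "fmor F a (fst g b) (jcl W (x g)) \<in> Mor (O.JC WG) (fobj F a) (fobj F (fst g b))"
          using v by (intro F.fmor_closed) (simp_all only: jacobian_category_simps)
        then show ?thesis using that ab v by (simp only: obj vo_act)
      qed
      then show "(\<lambda>g. fmor F a (fst g b) (jcl W (x g))) \<in> G \<rightarrow> Mor (O.JC WG) (fobj F a) (fobj F b)"
        by blast
    qed (simp add: Zx)
    also have "\<dots> = O.jcl WG ?y" by (rule sum[OF ab]) (rule x)
    finally have sum_Z: "(\<Oplus>\<^bsub>Hom (O.JC WG) (fobj F a) (fobj F b)\<^esub> g \<in> G. fmor F a (fst g b) (Z g))
      = O.jcl WG ?y" .
    have "?y \<in> JIG"
      using eq unfolding sum_Z O.jacobian_class_eq_zero_iff[OF y] .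
    \<comment> \<open>Lifting towards gb isolates the representative at g, and lifting carries one
      Jacobian ideal into the other.\<close>
    then have "lift_hom a (fst g b) ?y \<in> JI" using ab g by (intro lift_hom_in_JI act_verts)
    then have mem: "x g \<in> JI" using lift_hom_sum_proj[OF ab x g] by simp
    have "x g \<in> carrier A" using Mor_carrier[OF ab(1) act_verts[OF g ab(2)] x[OF g]] .
    then show "Z g = jcl W (\<lambda>_. 0)"
      using Zx[OF g] mem jacobian_class_eq_zero_iff[of "x g" W] by simp
  next
    fix a b Y assume ab: "a \<in> verts Q" "b \<in> verts Q" and Y: "Y \<in> Mor (O.JC WG) (fobj F a) (fobj F b)"
    then obtain y where y: "y \<in> Mor O.PC (vo a) (vo b)" "Y = O.jcl WG y"
      by (auto simp: obj O.Mor_JC vo_verts)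
    let ?x = "\<lambda>g. lift_hom a (fst g b) y"
    have x: "\<And>g. g \<in> G \<Longrightarrow> ?x g \<in> Mor PC a (fst g b)" using ab by (simp add: lift_hom_Mor act_verts)
    have "(\<Oplus>\<^bsub>Hom (O.JC WG) (fobj F a) (fobj F b)\<^esub> g \<in> G. fmor F a (fst g b) (jcl W (?x g)))
      = O.jcl WG (\<lambda>z. \<Sum>g\<in>G. proj (?x g) z)"
      by (rule sum[OF ab]) (rule x)
    also have "\<dots> = Y" unfolding sum_proj_lam[OF ab y(1)] y(2) ..
    finally show "\<exists>x. (\<forall>g\<in>G. x g \<in> Mor (JC W) a (fst g b)) \<and>
      (\<Oplus>\<^bsub>Hom (O.JC WG) (fobj F a) (fobj F b)\<^esub> g \<in> G. fmor F a (fst g b) (x g)) = Y"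
      using x ab by (intro exI[of _ "\<lambda>g. jcl W (?x g)"]) (simp add: Mor_JC act_verts)
  qed
qed

end

lemma length_WG:
  assumes "\<And>c p. W c \<noteq> 0 \<Longrightarrow> p \<in> c \<Longrightarrow> length p \<ge> 2" "WG d \<noteq> 0" "q \<in> d"
  shows "length q \<ge> 2"
proof -
  obtain p where "d = cyc_class (map ao p)" "W (cyc_class p) \<noteq> 0"
    using assms(2) by (rule WG_nonzero)
  moreover from this have "length p \<ge> 2" using assms(1) cyc_class_refl by metis
  ultimately show ?thesis using assms(3) by (auto simp: cyc_class_def)
qed

end

text \<open>The existence clause keeps the statement about all projection functors from being
  vacuous. Terms of length at least 2 keep trivial paths out of the support of the Jacobian ideals,
  on which skeletality of the quotients rests.\<close>

theorem proposition3p1: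
  fixes Q :: "('v, 'e) pre_digraph"
    and W :: "'e list set \<Rightarrow> 'k::alg_closed_field"
    and G :: "('v, 'e) quiver_map set"
  assumes "fin_digraph Q"
    and "potential Q W"
    and "finite G"
    and "\<not> CHAR('k) dvd card G"
    and "admissible_group Q W G"
  shows
    "(\<exists>\<pi> :: ('v, ('v, 'e) path \<Rightarrow> 'k, 'v set, ('v set, 'e set) path \<Rightarrow> 'k) kfunctor.
        projection_functor Q G \<pi>) \<and>
     (\<forall>\<pi> :: ('v, ('v, 'e) path \<Rightarrow> 'k, 'v set, ('v set, 'e set) path \<Rightarrow> 'k) kfunctor.
        projection_functor Q G \<pi> \<longrightarrow>
          G_covering ring_of_type_algebra (path_category Q) (path_category (orbit_quiver Q G))
            (acting_group Q G) (path_category_action Q) \<pi> \<and>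
          (\<exists>F. induced_functor Q W (orbit_quiver Q G) (orbit_potential Q G W) \<pi> F \<and>
            G_covering ring_of_type_algebra
              (jacobian_category Q W)
              (jacobian_category (orbit_quiver Q G) (orbit_potential Q G W))
              (acting_group Q G) (jacobian_category_action Q) F)) \<and>
     skeletal (path_category Q :: ('v, 'k, ('v, 'e) path \<Rightarrow> 'k) kcat) \<and>
     skeletal (path_category (orbit_quiver Q G)
       :: ('v set, 'k, ('v set, 'e set) path \<Rightarrow> 'k) kcat) \<and>
     ((\<forall>c p. W c \<noteq> 0 \<longrightarrow> p \<in> c \<longrightarrow> length p \<ge> 2) \<longrightarrow>
        skeletal (jacobian_category Q W) \<and>
        skeletal (jacobian_category (orbit_quiver Q G) (orbit_potential Q G W)))"
proof -
  interpret qp_action Q W G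
    using assms by (intro qp_action.intro quiver.intro qp_action_axioms.intro)
  have card: "of_nat (card G) \<noteq> (0 :: 'k)"
    using assms(4) by (simp add: of_nat_eq_0_iff_char_dvd)
  show ?thesis
  proof (intro conjI allI impI)
    show "\<exists>\<pi> :: ('v, ('v, 'e) path \<Rightarrow> 'k, 'v set, ('v set, 'e set) path \<Rightarrow> 'k) kfunctor.
        projection_functor Q G \<pi>"
      using projection_functor_PF by blast
  next
    fix \<pi> :: "('v, ('v, 'e) path \<Rightarrow> 'k, 'v set, ('v set, 'e set) path \<Rightarrow> 'k) kfunctor"
    assume \<pi>: "projection_functor Q G \<pi>"
    show "G_covering ring_of_type_algebra PC O.PC Grp (path_category_action Q) \<pi>"
      using finite_covering_path[OF \<pi>] by (rule finite_covering.G_covering)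
    show "\<exists>F. induced_functor Q W QG WG \<pi> F \<and>
      G_covering ring_of_type_algebra (JC W) (O.JC WG) Grp (jacobian_category_action Q) F"
      using induced_functor_exists[OF card \<pi>]
        finite_covering.G_covering[OF finite_covering_jacobian[OF card \<pi>]] by metis
  next
    assume "\<forall>c p. W c \<noteq> 0 \<longrightarrow> p \<in> c \<longrightarrow> length p \<ge> 2"
    then show "skeletal (JC W)" "skeletal (O.JC WG)"
      using skeletal_JC[of W] O.skeletal_JC[of WG] length_WG by blast+
  qed (rule skeletal_PC O.skeletal_PC)+
qed

end
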